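(* Define, for polynomials $p$ on $\mathbb{R}^m$ and $z\in\mathbb{R}^m$, $$\mathcal W(p)(z):=c_\kappa^{-1}\int_{\mathbb{R}^m}L(iy,z)\,\mathcal F_\kappa\big(p(\cdot)e^{-|\cdot|^2/2}\big)(y)\,\omega_\kappa(y)\,dy,$$ with $L(iy,z)=c_\kappa^{-1}\int_{\mathbb{R}^m}E_\kappa(-ix,y)e^{-\langle x,z\rangle}e^{-|x|^2/2}e^{|y|^2/2}\omega_\kappa(x)dx$. Then $\mathcal W(T_jp)=\partial_j\mathcal W(p)$ for every polynomial $p$ and every $j=1,\dots,m$ (with $\partial_j$ acting in $z$).
   Context: Let $G\subset O(m)$ be a finite reflection group with root system $R$, fixed positive subsystem $R_+$, and let $\kappa:R\to[0,\infty)$ be a $G$-invariant multiplicity function. For $\alpha\in R$, $\sigma_\alpha x=x-2\langle x,\alpha\rangle\alpha/\|\alpha\|^2$. The Dunkl operators are $T_jf(x)=\partial_jf(x)+\sum_{\alpha\in R_+}\kappa(\alpha)\alpha_j\frac{f(x)-f(\sigma_\alpha x)}{\langle \alpha,x\rangle}$. The Dunkl kernel $E_\kappa(x,y)$ (holomorphic on $\mathbb{C}^m\times\mathbb{C}^m$) satisfies $T_j^{(x)}E_\kappa(x,y)=y_jE_\kappa(x,y)$, $E_\kappa(0,y)=1$. The weight is $\omega_\kappa(x)=\prod_{\alpha\in R_+}|\langle\alpha,x\rangle|^{2\kappa(\alpha)}$, $c_\kappa=\int_{\mathbb{R}^m}e^{-|x|^2/2}\omega_\kappa(x)dx$, and the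 Dunkl transform is $\mathcal F_\kappa f(y)=c_\kappa^{-1}\int_{\mathbb{R}^m}E_\kappa(-ix,y)f(x)\omega_\kappa(x)\,dx$. *)

theory Defs
  imports "HOL-Analysis.Analysis"
begin

definition refl :: "real^'n \<Rightarrow> real^'n \<Rightarrow> real^'n" where
  "refl \<alpha> x = x - (2 * (x \<bullet> \<alpha>) / (norm \<alpha>)\<^sup>2) *\<^sub>R \<alpha>"

text \<open>Root system (Dunkl's convention: finite, reduced, reflection-stable, nonzero roots).\<close>
definition root_system :: "(real^'n) set \<Rightarrow> bool" where
  "root_system R \<longleftrightarrow> finite R \<and> 0 \<notin> R \<and>
     (\<forall>\<alpha>\<in>R. R \<inter> {c *\<^sub>R \<alpha> | c. True} = {\<alpha>, -\<alpha>}) \<and>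
     (\<forall>\<alpha>\<in>R. \<forall>\<beta>\<in>R. refl \<alpha> \<beta> \<in> R)"

definition positive_subsystem :: "(real^'n) set \<Rightarrow> (real^'n) set \<Rightarrow> bool" where
  "positive_subsystem R Rp \<longleftrightarrow>
     (\<exists>\<beta>. (\<forall>\<alpha>\<in>R. \<alpha> \<bullet> \<beta> \<noteq> 0) \<and> Rp = {\<alpha>\<in>R. \<alpha> \<bullet> \<beta> > 0})"

inductive_set refl_group :: "(real^'n) set \<Rightarrow> (real^'n \<Rightarrow> real^'n) set" for R where
  id_in: "id \<in> refl_group R"
| step: "g \<in> refl_group R \<Longrightarrow> \<alpha> \<in> R \<Longrightarrow> refl \<alpha> \<circ> g \<in> refl_group R"

definition multiplicity :: "(real^'n) set \<Rightarrow> (real^'n \<Rightarrow> real) \<Rightarrow> bool" where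
  "multiplicity R \<kappa> \<longleftrightarrow> (\<forall>\<alpha>\<in>R. \<kappa> \<alpha> \<ge> 0) \<and>
     (\<forall>g\<in>refl_group R. \<forall>\<alpha>\<in>R. \<kappa> (g \<alpha>) = \<kappa> \<alpha>)"

definition cvec :: "real^'n \<Rightarrow> complex^'n" where
  "cvec x = (\<chi> i. complex_of_real (x $ i))"

definition bil :: "real^'n \<Rightarrow> complex^'n \<Rightarrow> complex" where
  "bil \<alpha> x = (\<Sum>i\<in>UNIV. complex_of_real (\<alpha> $ i) * x $ i)"

definition reflC :: "real^'n \<Rightarrow> complex^'n \<Rightarrow> complex^'n" where
  "reflC \<alpha> x = x - (2 * bil \<alpha> x / complex_of_real ((norm \<alpha>)\<^sup>2)) *s cvec \<alpha>"

text \<open>Dunkl operator T_j on functions on R^m. On the hyperplane where the pairing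
  with alpha vanishes the difference quotient is replaced by its continuous
  extension (2/|alpha|^2 times the derivative in direction alpha).\<close>
definition dunkl_op ::
  "(real^'n) set \<Rightarrow> (real^'n \<Rightarrow> real) \<Rightarrow> 'n \<Rightarrow> (real^'n \<Rightarrow> complex) \<Rightarrow> real^'n \<Rightarrow> complex" where
  "dunkl_op Rp \<kappa> j f x =
     frechet_derivative f (at x) (axis j 1) +
     (\<Sum>\<alpha>\<in>Rp. complex_of_real (\<kappa> \<alpha> * \<alpha> $ j) *
        (if \<alpha> \<bullet> x = 0 then complex_of_real (2 / (norm \<alpha>)\<^sup>2) * frechet_derivative f (at x) \<alpha>
         else (f x - f (refl \<alpha> x)) / complex_of_real (\<alpha> \<bullet> x)))"

definition dunkl_opC ::
  "(real^'n) set \<Rightarrow> (real^'n \<Rightarrow> real) \<Rightarrow> 'n \<Rightarrow> (complex^'n \<Rightarrow> complex) \<Rightarrow> complex^'n \<Rightarrow> complex" where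
  "dunkl_opC Rp \<kappa> j f x =
     frechet_derivative f (at x) (axis j 1) +
     (\<Sum>\<alpha>\<in>Rp. complex_of_real (\<kappa> \<alpha> * \<alpha> $ j) *
        (if bil \<alpha> x = 0 then complex_of_real (2 / (norm \<alpha>)\<^sup>2) * frechet_derivative f (at x) (cvec \<alpha>)
         else (f x - f (reflC \<alpha> x)) / bil \<alpha> x))"

definition holomorphic2 :: "(complex^'n \<Rightarrow> complex^'n \<Rightarrow> complex) \<Rightarrow> bool" where
  "holomorphic2 E \<longleftrightarrow> (\<forall>x y. \<exists>D. ((\<lambda>(u, v). E u v) has_derivative D) (at (x, y)) \<and>
      (\<forall>c u v. D (c *s u, c *s v) = c * D (u, v)))"

definition dunkl_kernel ::
  "(real^'n) set \<Rightarrow> (real^'n \<Rightarrow> real) \<Rightarrow> (complex^'n \<Rightarrow> complex^'n \<Rightarrow> complex) \<Rightarrow> bool" where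
  "dunkl_kernel Rp \<kappa> E \<longleftrightarrow> holomorphic2 E \<and>
     (\<forall>j x y. dunkl_opC Rp \<kappa> j (\<lambda>u. E u y) x = y $ j * E x y) \<and>
     (\<forall>y. E 0 y = 1)"

definition weight :: "(real^'n) set \<Rightarrow> (real^'n \<Rightarrow> real) \<Rightarrow> real^'n \<Rightarrow> real" where
  "weight Rp \<kappa> x = (\<Prod>\<alpha>\<in>Rp. if \<kappa> \<alpha> = 0 then 1 else \<bar>\<alpha> \<bullet> x\<bar> powr (2 * \<kappa> \<alpha>))"

definition cconst :: "(real^'n) set \<Rightarrow> (real^'n \<Rightarrow> real) \<Rightarrow> real" where
  "cconst Rp \<kappa> = (\<integral>x. exp (- (norm x)\<^sup>2 / 2) * weight Rp \<kappa> x \<partial>lborel)"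

definition mi :: "real^'n \<Rightarrow> complex^'n" where
  "mi x = (\<chi> k. - \<i> * complex_of_real (x $ k))"

definition dunkl_transform ::
  "(real^'n) set \<Rightarrow> (real^'n \<Rightarrow> real) \<Rightarrow> (complex^'n \<Rightarrow> complex^'n \<Rightarrow> complex) \<Rightarrow>
   (real^'n \<Rightarrow> complex) \<Rightarrow> real^'n \<Rightarrow> complex" where
  "dunkl_transform Rp \<kappa> E f y =
     complex_of_real (1 / cconst Rp \<kappa>) *
     (\<integral>x. E (mi x) (cvec y) * f x * complex_of_real (weight Rp \<kappa> x) \<partial>lborel)"

definition Lker ::
  "(real^'n) set \<Rightarrow> (real^'n \<Rightarrow> real) \<Rightarrow> (complex^'n \<Rightarrow> complex^'n \<Rightarrow> complex) \<Rightarrow>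
   real^'n \<Rightarrow> real^'n \<Rightarrow> complex" where
  "Lker Rp \<kappa> E y z =
     complex_of_real (1 / cconst Rp \<kappa>) *
     (\<integral>x. E (mi x) (cvec y) *
        complex_of_real (exp (- (x \<bullet> z)) * exp (- (norm x)\<^sup>2 / 2) * exp ((norm y)\<^sup>2 / 2)
                          * weight Rp \<kappa> x) \<partial>lborel)"

definition Wop ::
  "(real^'n) set \<Rightarrow> (real^'n \<Rightarrow> real) \<Rightarrow> (complex^'n \<Rightarrow> complex^'n \<Rightarrow> complex) \<Rightarrow>
   (real^'n \<Rightarrow> complex) \<Rightarrow> real^'n \<Rightarrow> complex" where
  "Wop Rp \<kappa> E p z =
     complex_of_real (1 / cconst Rp \<kappa>) *
     (\<integral>y. Lker Rp \<kappa> E y z *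
        dunkl_transform Rp \<kappa> E (\<lambda>x. p x * complex_of_real (exp (- (norm x)\<^sup>2 / 2))) y *
        complex_of_real (weight Rp \<kappa> y) \<partial>lborel)"

definition polynomial_fun :: "(real^'n \<Rightarrow> complex) \<Rightarrow> bool" where
  "polynomial_fun p \<longleftrightarrow> (\<exists>(S :: ('n \<Rightarrow> nat) set) c. finite S \<and>
     p = (\<lambda>x. \<Sum>a\<in>S. c a * (\<Prod>i\<in>UNIV. complex_of_real (x $ i) ^ a i)))"

end

theory Submission
  imports Defs "HOL-Complex_Analysis.Cauchy_Integral_Formula"
begin

text \<open>
  Let \<open>\<G>\<close> be the Gaussian. Up to normalisation, \<open>W p z\<close> is the integral of \<open>\<F>(e\<^sup>-\<^sup>\<langle>\<^sup>\<cdot>\<^sup>,\<^sup>z\<^sup>\<rangle> \<G>) q(p) \<omega>\<close>, where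
  \<open>q p = \<F>(p \<G>) / \<G>\<close>. Integration by parts against \<open>\<omega>\<close> and the eigenvalue equation of the kernel give
  \<open>q (\<langle>u, \<cdot>\<rangle> p) = q (T\<^sub>u p) - i \<langle>y, u\<rangle> q p\<close>, and \<open>q 1 = 1\<close>. By induction on the degree, \<open>q p\<close> is therefore a
  polynomial and \<open>q (T\<^sub>u p) = i T\<^sub>u (q p)\<close>; neither the symmetry of the kernel nor the commutativity of the
  Dunkl operators enters. A second integration by parts shows that
  \<open>[r, p] = \<integral> q(r) q(p) \<G> \<omega>\<close> satisfies \<open>[\<langle>u, \<cdot>\<rangle> r, p] = - [r, T\<^sub>u p]\<close>. Expanding the exponential gives
  \<open>W p z = c\<^sup>-\<^sup>1 \<Sum>\<^sub>n [(- \<langle>\<cdot>, z\<rangle>)\<^sup>n, p] / n!\<close>, a finite sum because Dunkl operators lower the degree, and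
  differentiating it in \<open>z\<close> moves a factor \<open>- x\<^sub>j\<close> to a \<open>T\<^sub>j\<close> on \<open>p\<close>.
\<close>

section \<open>Lebesgue measure and Gaussian bounds\<close>

text \<open>The kernel is known only through holomorphy, the eigenvalue equation and its value at 0,
  so its growth has to be derived: |E(x, y)| <= exp ((|y| + 1) |x|) comes from a maximum principle,
  and a bound on the derivative from Cauchy's inequality. This makes every inner integral converge,
  but it cannot justify expanding the exponential under the outer integral: it bounds the Gaussian
  integral of \<open>ker y\<close> by about exp (|y|^2 / 2), \<open>q\<close> multiplies by exp
  (|y|^2 / 2) once more, and the outer Gaussian offers only exp (- |y|^2 / 2). The domination is
  therefore taken from the algebraic recursion of \<open>q\<close>, which yields exp (|z| |y| +
  const |z|^2). A second obstacle is that the weight need not be differentiable on the reflecting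
  hyperplanes; integration by parts is carried out for a smooth weight and passed to the limit. For
  \<kappa> = 0 in one dimension, \<open>q\<close> sends x^n to (-i)^n times the Hermite polynomial
  He_n(y).\<close>

lemma nn_integral_lborel_translate:
  fixes f :: "'a::euclidean_space \<Rightarrow> ennreal"
  assumes [measurable]: "f \<in> borel_measurable borel"
  shows "(\<integral>\<^sup>+x. f (c + x) \<partial>lborel) = (\<integral>\<^sup>+x. f x \<partial>lborel)"
  by (subst (2) lborel_distr_plus[of c, symmetric]) (simp add: nn_integral_distr)

lemma lborel_integral_translate:
  fixes f :: "'a::euclidean_space \<Rightarrow> 'b::{banach, second_countable_topology}"
  assumes [measurable]: "f \<in> borel_measurable borel"
  shows "(\<integral>x. f (c + x) \<partial>lborel) = (\<integral>x. f x \<partial>lborel)"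
  by (subst (2) lborel_distr_plus[of c, symmetric]) (simp add: integral_distr)

lemma lborel_integrable_translate:
  fixes f :: "'a::euclidean_space \<Rightarrow> 'b::{banach, second_countable_topology}"
  assumes [measurable]: "f \<in> borel_measurable borel"
  shows "integrable lborel (\<lambda>x. f (c + x)) \<longleftrightarrow> integrable lborel f"
  by (subst (2) lborel_distr_plus[of c, symmetric]) (simp add: integrable_distr_eq)

text \<open>Fubini for \<open>1\<^sub>A (T x) 1\<^sub>B (y - T x)\<close>, with \<open>B\<close> the unit ball, reduces orthogonal invariance to
  translation invariance.\<close>

lemma lborel_distr_orthogonal_transformation:
  fixes T :: "'a::euclidean_space \<Rightarrow> 'a"
  assumes T: "orthogonal_transformation T"
  shows "distr lborel borel T = lborel"
proof (rule measure_eqI)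
  show "sets (distr lborel borel T) = sets (lborel :: 'a measure)" by simp
  fix A assume "A \<in> sets (distr lborel borel T)"
  then have A[measurable]: "A \<in> sets borel" by simp
  have lin: "linear T" using T by (rule orthogonal_transformation_linear)
  have Tm[measurable]: "T \<in> borel_measurable borel"
    by (intro borel_measurable_continuous_onI linear_continuous_on linear_conv_bounded_linear[THEN iffD1] lin)
  define B where "B = ball (0::'a) 1"
  have Bm[measurable]: "B \<in> sets borel" by (simp add: B_def)
  have neg: "indicator B (- T x) = (indicator B x :: ennreal)" for x
    using orthogonal_transformation_norm[OF T, of x] by (auto simp: B_def indicator_def)
  have Bpos: "emeasure lborel B \<noteq> 0" "emeasure lborel B \<noteq> \<infinity>"
    by (auto simp: B_def emeasure_ball ennreal_eq_0_iff unit_ball_vol_pos not_le)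
  have distr: "emeasure (distr lborel borel T) A = (\<integral>\<^sup>+x. indicator A (T x) \<partial>lborel)"
    using nn_integral_distr[of T lborel borel "indicator A"] by (simp add: nn_integral_indicator)
  have "emeasure (distr lborel borel T) A * emeasure lborel B
      = (\<integral>\<^sup>+x. indicator A (T x) * (\<integral>\<^sup>+y. indicator B y \<partial>lborel) \<partial>lborel)"
    by (simp add: nn_integral_multc distr)
  also have "\<dots> = (\<integral>\<^sup>+x. indicator A (T x) * (\<integral>\<^sup>+y. indicator B (- T x + y) \<partial>lborel) \<partial>lborel)"
    by (subst nn_integral_lborel_translate) auto
  also have "\<dots> = (\<integral>\<^sup>+x. (\<integral>\<^sup>+y. indicator A (T x) * indicator B (- T x + y) \<partial>lborel) \<partial>lborel)"
    by (subst nn_integral_cmult) auto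
  also have "\<dots> = (\<integral>\<^sup>+y. (\<integral>\<^sup>+x. indicator A (T x) * indicator B (- T x + y) \<partial>lborel) \<partial>lborel)"
    by (rule lborel_pair.Fubini') measurable
  also have "\<dots> = (\<integral>\<^sup>+y. (\<integral>\<^sup>+x. indicator A (T x + y) * indicator B (- T x) \<partial>lborel) \<partial>lborel)"
  proof (rule nn_integral_cong)
    fix y :: 'a
    \<comment> \<open>Surjectivity turns translation by y in the image into translation by c in the
      source, where the invariance of \<open>lborel\<close> applies.\<close>
    obtain c where c: "T c = y" using orthogonal_transformation_surj[OF T] by (metis surjD)
    have "(\<integral>\<^sup>+x. indicator A (T x) * indicator B (- T x + y) \<partial>lborel)
       = (\<integral>\<^sup>+x. indicator A (T (c + x)) * indicator B (- T (c + x) + y) \<partial>lborel)"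
      by (rule nn_integral_lborel_translate[symmetric]) measurable
    also have "\<dots> = (\<integral>\<^sup>+x. indicator A (T x + y) * indicator B (- T x) \<partial>lborel)"
      by (simp add: linear_add[OF lin] c add.commute)
    finally show "(\<integral>\<^sup>+x. indicator A (T x) * indicator B (- T x + y) \<partial>lborel)
       = (\<integral>\<^sup>+x. indicator A (T x + y) * indicator B (- T x) \<partial>lborel)" .
  qed
  also have "\<dots> = (\<integral>\<^sup>+x. (\<integral>\<^sup>+y. indicator A (T x + y) * indicator B (- T x) \<partial>lborel) \<partial>lborel)"
    by (rule lborel_pair.Fubini') measurable
  also have "\<dots> = (\<integral>\<^sup>+x. (\<integral>\<^sup>+y. indicator A (T x + y) \<partial>lborel) * indicator B (- T x) \<partial>lborel)"
    by (subst nn_integral_multc) auto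
  also have "\<dots> = (\<integral>\<^sup>+x. emeasure lborel A * indicator B x \<partial>lborel)"
    by (subst nn_integral_lborel_translate) (auto simp: neg)
  also have "\<dots> = emeasure lborel A * emeasure lborel B"
    by (simp add: nn_integral_cmult)
  finally show "emeasure (distr lborel borel T) A = emeasure lborel A"
    using Bpos by (auto simp: ennreal_mult_cancel_left mult.commute[of _ "emeasure lborel B"] top_unique)
qed

lemma lborel_integral_orthogonal_transformation:
  fixes T :: "'a::euclidean_space \<Rightarrow> 'a" and f :: "'a \<Rightarrow> 'b::{banach, second_countable_topology}"
  assumes T: "orthogonal_transformation T" and [measurable]: "f \<in> borel_measurable borel"
  shows "(\<integral>x. f (T x) \<partial>lborel) = (\<integral>x. f x \<partial>lborel)"
proof -
  have "T \<in> borel_measurable borel"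
    by (intro borel_measurable_continuous_onI linear_continuous_on linear_conv_bounded_linear[THEN iffD1]
        orthogonal_transformation_linear T)
  then show ?thesis
    by (subst (2) lborel_distr_orthogonal_transformation[OF T, symmetric]) (simp add: integral_distr)
qed

text \<open>The layer k <= |x| <= k + 1 lies in a ball of radius k + 1, which reduces the claim to
  convergence of the sum of exp (- k) (k + 1)^n. This function ends up dominating the other Gaussian
  integrands.\<close>

lemma integrable_exp_minus_norm:
  "integrable lborel (\<lambda>x::'a::euclidean_space. exp (- norm x))"
proof (rule integrableI_bounded)
  let ?n = "DIM('a)" and ?V = "unit_ball_vol (DIM('a))"
  have V: "?V \<ge> 0" using unit_ball_vol_pos[of "DIM('a)"] by simp
  have le: "ennreal (norm (exp (- norm x))) \<le>
     (\<Sum>k. ennreal (exp (- real k)) * indicator (cball 0 (real (Suc k))) x)" for x :: 'a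
  proof -
    define k where "k = nat \<lfloor>norm x\<rfloor>"
    have k: "real k \<le> norm x" "norm x \<le> real (Suc k)" unfolding k_def by (auto) linarith+
    have "ennreal (norm (exp (- norm x))) \<le> ennreal (exp (- real k)) * indicator (cball 0 (real (Suc k))) x"
      using k by (auto simp: indicator_def)
    also have "\<dots> \<le> (\<Sum>k. ennreal (exp (- real k)) * indicator (cball 0 (real (Suc k))) x)"
      using sum_le_suminf[of "\<lambda>k. ennreal (exp (- real k)) * indicator (cball 0 (real (Suc k))) x" "{k}"]
      by (simp only: sum.insert finite.intros sum.empty empty_iff not_False_eq_True add_0_right zero_le
          summableI simp_thms)
    finally show ?thesis .
  qed
  have s: "summable (\<lambda>k. exp (- real k) * (?V * real (Suc k) ^ ?n))"
  proof -
    have "summable (\<lambda>k. real (Suc k) ^ n * exp (- real (Suc k)))" for n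
    proof (rule summable_comparison_test')
      \<comment> \<open>The n-th power of t <= K exp (t / K) costs exp (n t / K). The choice K = 2
        (n + 1) keeps this below exp (t / 2), and the remaining exp (- t / 2) is geometric.\<close>
      define K where "K = 2 * real (Suc n)"
      have K: "K > 0" by (simp add: K_def)
      show "summable (\<lambda>k. K ^ n * exp (- (1/2)) * exp (- (1/2)) ^ k)"
        by (intro summable_mult summable_geometric) auto
      fix k
      let ?t = "real (Suc k)"
      have "?t / K \<le> exp (?t / K)" using exp_ge_add_one_self[of "?t / K"] by linarith
      then have "?t \<le> K * exp (?t / K)" using K by (simp add: field_simps)
      then have "?t ^ n \<le> (K * exp (?t / K)) ^ n" by (intro power_mono) auto
      also have "\<dots> = K ^ n * exp (real n * (?t / K))" by (simp add: power_mult_distrib flip: exp_of_nat_mult)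
      also have "\<dots> \<le> K ^ n * exp (?t / 2)"
        using K by (intro mult_left_mono) (auto simp: K_def field_simps)
      finally have "?t ^ n * exp (- ?t) \<le> K ^ n * exp (?t / 2) * exp (- ?t)" by (rule mult_right_mono) simp
      also have "\<dots> = K ^ n * exp (- ?t / 2)" by (simp add: mult.assoc flip: exp_add)
      also have "\<dots> = K ^ n * exp (- (1/2)) * exp (- (1/2)) ^ k"
        by (simp add: mult.assoc field_simps flip: exp_of_nat_mult exp_add)
      finally show "norm (?t ^ n * exp (- ?t)) \<le> K ^ n * exp (- (1/2)) * exp (- (1/2)) ^ k" by simp
    qed
    from summable_mult[OF this, of "?V * exp 1" ?n] show ?thesis
      by (rule back_subst[where P=summable]) (auto simp: fun_eq_iff exp_minus exp_add exp_diff field_simps)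
  qed
  have "(\<integral>\<^sup>+x. ennreal (norm (exp (- norm (x::'a)))) \<partial>lborel) \<le>
     (\<integral>\<^sup>+x. (\<Sum>k. ennreal (exp (- real k)) * indicator (cball (0::'a) (real (Suc k))) x) \<partial>lborel)"
    by (intro nn_integral_mono le)
  also have "\<dots> = (\<Sum>k. \<integral>\<^sup>+x. ennreal (exp (- real k)) * indicator (cball (0::'a) (real (Suc k))) x \<partial>lborel)"
    by (rule nn_integral_suminf) (intro borel_measurable_times_ennreal borel_measurable_const borel_measurable_indicator, simp)
  also have "\<dots> = (\<Sum>k. ennreal (exp (- real k) * (?V * real (Suc k) ^ ?n)))"
    by (intro suminf_cong, subst nn_integral_cmult_indicator)
      (use V in \<open>auto simp: emeasure_cball ennreal_mult simp del: of_nat_Suc\<close>)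
  also have "\<dots> < \<infinity>"
    using V s by (subst suminf_ennreal2) (auto intro!: mult_nonneg_nonneg)
  finally show "(\<integral>\<^sup>+x. ennreal (norm (exp (- norm (x::'a)))) \<partial>lborel) < \<infinity>" .
qed simp

section \<open>Functions of at most exponential growth\<close>

definition exp_bounded :: "('a::real_normed_vector \<Rightarrow> 'b::real_normed_vector) \<Rightarrow> bool" where
  "exp_bounded f \<longleftrightarrow> (\<exists>C a. 0 \<le> C \<and> 0 \<le> a \<and> (\<forall>x. norm (f x) \<le> C * exp (a * norm x)))"

lemma exp_boundedI:
  assumes "0 \<le> a" "\<And>x. norm (f x) \<le> C * exp (a * norm x)"
  shows "exp_bounded f"
proof -
  have "0 \<le> C" using order_trans[OF norm_ge_zero assms(2)[of 0]] by simp
  then show ?thesis using assms unfolding exp_bounded_def by blast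
qed

lemma exp_boundedE:
  assumes "exp_bounded f"
  obtains C a where "0 \<le> C" "0 \<le> a" "\<And>x. norm (f x) \<le> C * exp (a * norm x)"
  using assms unfolding exp_bounded_def by blast

lemma exp_bounded_mono:
  assumes "exp_bounded g" "\<And>x. norm (f x) \<le> norm (g x)"
  shows "exp_bounded f"
  using assms unfolding exp_bounded_def by (meson order_trans)

lemma exp_bounded_const [intro, simp]: "exp_bounded (\<lambda>x. c)"
  by (rule exp_boundedI[of 0 _ "norm c"]) auto

lemma exp_bounded_norm: "exp_bounded f \<Longrightarrow> exp_bounded (\<lambda>x. norm (f x))"
  unfolding exp_bounded_def by simp

lemma exp_bounded_add [intro]:
  fixes f g :: "'a::real_normed_vector \<Rightarrow> 'b::real_normed_vector"
  assumes "exp_bounded f" "exp_bounded g"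
  shows "exp_bounded (\<lambda>x. f x + g x)"
proof -
  from assms(1) obtain C a where f: "0 \<le> C" "0 \<le> a" "\<And>x. norm (f x) \<le> C * exp (a * norm x)"
    by (rule exp_boundedE) blast
  from assms(2) obtain D b where g: "0 \<le> D" "0 \<le> b" "\<And>x. norm (g x) \<le> D * exp (b * norm x)"
    by (rule exp_boundedE) blast
  show ?thesis
  proof (rule exp_boundedI[of "max a b" _ "C + D"])
    fix x :: 'a
    have "C * exp (a * norm x) \<le> C * exp (max a b * norm x)"
      "D * exp (b * norm x) \<le> D * exp (max a b * norm x)"
      using f g by (auto intro!: mult_left_mono mult_right_mono)
    then show "norm (f x + g x) \<le> (C + D) * exp (max a b * norm x)"
      using f(3)[of x] g(3)[of x] norm_triangle_ineq[of "f x" "g x"] by (simp add: distrib_right)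
  qed (use f in auto)
qed

lemma exp_bounded_mult [intro]:
  fixes f g :: "'a::real_normed_vector \<Rightarrow> 'b::real_normed_algebra"
  assumes "exp_bounded f" "exp_bounded g"
  shows "exp_bounded (\<lambda>x. f x * g x)"
proof -
  from assms(1) obtain C a where f: "0 \<le> C" "0 \<le> a" "\<And>x. norm (f x) \<le> C * exp (a * norm x)"
    by (rule exp_boundedE) blast
  from assms(2) obtain D b where g: "0 \<le> D" "0 \<le> b" "\<And>x. norm (g x) \<le> D * exp (b * norm x)"
    by (rule exp_boundedE) blast
  show ?thesis
  proof (rule exp_boundedI[of "a + b" _ "C * D"])
    fix x
    have "norm (f x * g x) \<le> norm (f x) * norm (g x)" by (rule norm_mult_ineq)
    also have "\<dots> \<le> (C * exp (a * norm x)) * (D * exp (b * norm x))"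
      using f g by (intro mult_mono) auto
    finally show "norm (f x * g x) \<le> (C * D) * exp ((a + b) * norm x)"
      by (simp add: exp_add distrib_left distrib_right mult_ac)
  qed (use f g in auto)
qed

lemma exp_bounded_sum [intro]:
  assumes "\<And>i. i \<in> S \<Longrightarrow> exp_bounded (f i)"
  shows "exp_bounded (\<lambda>x. \<Sum>i\<in>S. f i x)"
  using assms by (induction S rule: infinite_finite_induct) auto

lemma exp_bounded_diff [intro]:
  assumes "exp_bounded f" "exp_bounded g"
  shows "exp_bounded (\<lambda>x. f x - g x)"
proof -
  have "exp_bounded (\<lambda>x. - g x)" using assms(2) by (rule exp_bounded_mono) simp
  from exp_bounded_add[OF assms(1) this] show ?thesis by simp
qed

lemma norm_le_exp_norm: "norm x \<le> exp (norm x)"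
  using exp_ge_add_one_self[of "norm x"] by linarith

lemma exp_bounded_inner [intro, simp]:
  fixes u :: "'a::real_inner"
  shows "exp_bounded (\<lambda>x. of_real (u \<bullet> x) :: 'b::real_normed_algebra_1)"
proof (rule exp_boundedI[of 1 _ "norm u"])
  fix x :: 'a
  have "\<bar>u \<bullet> x\<bar> \<le> norm u * norm x" by (rule Cauchy_Schwarz_ineq2)
  also have "\<dots> \<le> norm u * exp (norm x)" using norm_le_exp_norm[of x] by (simp add: mult_left_mono)
  finally show "norm (of_real (u \<bullet> x) :: 'b) \<le> norm u * exp (1 * norm x)" by simp
qed simp

lemma exp_bounded_compose:
  assumes "exp_bounded f" "\<And>x. norm (T x) \<le> K * norm x" "0 \<le> K"
  shows "exp_bounded (\<lambda>x. f (T x))"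
proof -
  from assms(1) obtain C a where f: "0 \<le> C" "0 \<le> a" "\<And>x. norm (f x) \<le> C * exp (a * norm x)"
    by (rule exp_boundedE) blast
  show ?thesis
  proof (rule exp_boundedI[of "a * K" _ C])
    fix x
    have "a * norm (T x) \<le> a * K * norm x" using assms(2)[of x] f(2) by (simp add: mult_left_mono mult.assoc)
    then have "C * exp (a * norm (T x)) \<le> C * exp (a * K * norm x)" using f by (simp add: mult_left_mono)
    then show "norm (f (T x)) \<le> C * exp (a * K * norm x)" using f(3)[of "T x"] by simp
  qed (use f assms in auto)
qed

text \<open>Completing the square gives a r - r^2 / 2 <= (a + 1)^2 / 2 - r, so the Gaussian absorbs
  the growth and still leaves the integrable factor exp (- r).\<close>

lemma exp_bounded_gauss_le:
  fixes f :: "'a::real_normed_vector \<Rightarrow> 'b::real_normed_vector"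
  assumes "exp_bounded f"
  obtains C where "0 \<le> C" "\<And>x. norm (f x) * exp (- (norm x)\<^sup>2 / 2) \<le> C * exp (- norm x)"
proof -
  from assms obtain C a where f: "0 \<le> C" "0 \<le> a" "\<And>x. norm (f x) \<le> C * exp (a * norm x)"
    by (rule exp_boundedE) blast
  show ?thesis
  proof (rule that[of "C * exp ((a + 1)\<^sup>2 / 2)"])
    fix x :: 'a
    have "0 \<le> ((a + 1) - norm x)\<^sup>2" by simp
    then have le: "a * norm x + - (norm x)\<^sup>2 / 2 \<le> (a + 1)\<^sup>2 / 2 + - norm x"
      by (simp add: power2_eq_square field_simps)
    have "norm (f x) * exp (- (norm x)\<^sup>2 / 2) \<le> C * exp (a * norm x) * exp (- (norm x)\<^sup>2 / 2)"
      using f by (intro mult_right_mono) auto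
    also have "\<dots> = C * exp (a * norm x + - (norm x)\<^sup>2 / 2)" by (simp only: exp_add mult.assoc)
    also have "\<dots> \<le> C * exp ((a + 1)\<^sup>2 / 2 + - norm x)" using le f(1) by (intro mult_left_mono) auto
    also have "\<dots> = C * exp ((a + 1)\<^sup>2 / 2) * exp (- norm x)" by (simp only: exp_add mult.assoc)
    finally show "norm (f x) * exp (- (norm x)\<^sup>2 / 2) \<le> C * exp ((a + 1)\<^sup>2 / 2) * exp (- norm x)" .
  qed (use f in auto)
qed

lemma integrable_exp_bounded_gauss:
  fixes f :: "'a::euclidean_space \<Rightarrow> complex"
  assumes [measurable]: "f \<in> borel_measurable borel" and "exp_bounded f"
  shows "integrable lborel (\<lambda>x. f x * complex_of_real (exp (- (norm x)\<^sup>2 / 2)))"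
proof -
  from assms(2) obtain C where C: "0 \<le> C" "\<And>x. norm (f x) * exp (- (norm x)\<^sup>2 / 2) \<le> C * exp (- norm x)"
    by (rule exp_bounded_gauss_le) blast
  show ?thesis
    by (rule Bochner_Integration.integrable_bound[OF integrable_mult_right[OF integrable_exp_minus_norm, of C]])
      (use C in \<open>auto simp: norm_mult\<close>)
qed

section \<open>Difference quotients and integrals of directional derivatives\<close>

lemma has_vector_derivative_at_iff_slope:
  "(f has_vector_derivative d) (at s) \<longleftrightarrow> ((\<lambda>r. (f r - f s) /\<^sub>R (r - s)) \<longlongrightarrow> d) (at s)"
proof -
  have eq: "norm (f r - f s - (r - s) *\<^sub>R d) / norm (r - s) = norm ((f r - f s) /\<^sub>R (r - s) - d)" if "r \<noteq> s" for r
  proof -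
    have "(f r - f s) /\<^sub>R (r - s) - d = (f r - f s - (r - s) *\<^sub>R d) /\<^sub>R (r - s)"
      using that by (simp add: scaleR_diff_right)
    then show ?thesis by (simp add: divide_inverse_commute)
  qed
  have "(f has_vector_derivative d) (at s) \<longleftrightarrow> ((\<lambda>r. norm (f r - f s - (r - s) *\<^sub>R d) / norm (r - s)) \<longlongrightarrow> 0) (at s)"
    by (simp add: has_vector_derivative_def has_derivative_iff_norm bounded_linear_scaleR_left)
  also have "\<dots> \<longleftrightarrow> ((\<lambda>r. norm ((f r - f s) /\<^sub>R (r - s) - d)) \<longlongrightarrow> 0) (at s)"
    by (rule filterlim_cong) (auto simp: eventually_at_filter eq simp del: real_norm_def)
  also have "\<dots> \<longleftrightarrow> ((\<lambda>r. (f r - f s) /\<^sub>R (r - s)) \<longlongrightarrow> d) (at s)"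
    unfolding tendsto_norm_zero_iff by (rule Lim_null[symmetric])
  finally show ?thesis .
qed

lemma difference_quotient_LIMSEQ:
  fixes f :: "'a::real_normed_vector \<Rightarrow> 'b::real_normed_vector"
  assumes "(f has_derivative f') (at x)"
  shows "(\<lambda>n. (f (x + (1 / real (Suc n)) *\<^sub>R \<xi>) - f x) /\<^sub>R (1 / real (Suc n))) \<longlonglongrightarrow> f' \<xi>"
proof -
  have lin: "f' (t *\<^sub>R \<xi>) = t *\<^sub>R f' \<xi>" for t
    using has_derivative_bounded_linear[OF assms] by (simp add: bounded_linear.linear linear_scale)
  have "((\<lambda>t. f (x + t *\<^sub>R \<xi>)) has_derivative (\<lambda>t. f' (t *\<^sub>R \<xi>))) (at 0)"
    by (rule has_derivative_compose[where g=f and f="\<lambda>t. x + t *\<^sub>R \<xi>" and f'="\<lambda>t. t *\<^sub>R \<xi>"])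
      (auto intro!: derivative_eq_intros assms)
  then have "((\<lambda>t. (f (x + t *\<^sub>R \<xi>) - f x) /\<^sub>R t) \<longlongrightarrow> f' \<xi>) (at 0)"
    using has_vector_derivative_at_iff_slope[of "\<lambda>t. f (x + t *\<^sub>R \<xi>)" "f' \<xi>" 0]
    by (simp add: has_vector_derivative_def lin)
  moreover have "filterlim (\<lambda>n. 1 / real (Suc n)) (at 0) sequentially"
    using LIMSEQ_inverse_real_of_nat by (auto simp: filterlim_at inverse_eq_divide)
  ultimately show ?thesis by (rule filterlim_compose)
qed

text \<open>The derivative may be discontinuous; it is measurable as a pointwise limit of difference
  quotients of a continuous function.\<close>

lemma borel_measurable_directional_derivative:
  fixes f :: "'a::euclidean_space \<Rightarrow> complex"
  assumes "\<And>x. (f has_derivative f' x) (at x)"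
  shows "(\<lambda>x. f' x \<xi>) \<in> borel_measurable borel"
proof (rule borel_measurable_LIMSEQ_metric)
  have "continuous_on UNIV f"
    by (intro continuous_at_imp_continuous_on ballI has_derivative_continuous[OF assms])
  then have [measurable]: "f \<in> borel_measurable borel" by (rule borel_measurable_continuous_onI)
  show "(\<lambda>x. (f (x + (1 / real (Suc n)) *\<^sub>R \<xi>) - f x) /\<^sub>R (1 / real (Suc n))) \<in> borel_measurable borel" for n
    by measurable
  fix x
  show "(\<lambda>n. (f (x + (1 / real (Suc n)) *\<^sub>R \<xi>) - f x) /\<^sub>R (1 / real (Suc n))) \<longlonglongrightarrow> f' x \<xi>"
    by (rule difference_quotient_LIMSEQ assms)+
qed

text \<open>Translation invariance makes every difference quotient integrate to 0, and dominated
  convergence carries this over to the derivative.\<close>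

lemma integral_directional_derivative_eq_0:
  fixes H :: "'a::euclidean_space \<Rightarrow> complex"
  assumes H: "\<And>x. (H has_derivative H' x) (at x)"
    and bH: "\<And>x. norm (H x) \<le> C * exp (- norm x)"
    and bH': "\<And>x. norm (H' x \<xi>) \<le> C * exp (- norm x)"
  shows "(\<integral>x. H' x \<xi> \<partial>lborel) = 0"
proof -
  define s where "s n x = (H (x + (1 / real (Suc n)) *\<^sub>R \<xi>) - H x) /\<^sub>R (1 / real (Suc n))" for n x
  have "continuous_on UNIV H"
    by (intro continuous_at_imp_continuous_on ballI has_derivative_continuous[OF H])
  then have Hm[measurable]: "H \<in> borel_measurable borel" by (rule borel_measurable_continuous_onI)
  have sm[measurable]: "s n \<in> borel_measurable borel" for n
    unfolding s_def by measurable
  have C: "0 \<le> C" using order_trans[OF norm_ge_zero bH[of 0]] by simp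
  have Hi: "integrable lborel H"
    by (rule Bochner_Integration.integrable_bound[OF integrable_mult_right[OF integrable_exp_minus_norm, of C]])
      (use bH C in auto)
  have s0: "(\<integral>x. s n x \<partial>lborel) = 0" for n
  proof -
    have "(\<integral>x. H (x + (1 / real (Suc n)) *\<^sub>R \<xi>) - H x \<partial>lborel) = 0"
      using lborel_integrable_translate[OF Hm, of "(1 / real (Suc n)) *\<^sub>R \<xi>"] Hi
        lborel_integral_translate[OF Hm, of "(1 / real (Suc n)) *\<^sub>R \<xi>"]
      by (simp add: add.commute)
    then show ?thesis unfolding s_def by (simp only: integral_scaleR_right scaleR_zero_right)
  qed
  \<comment> \<open>Mean value inequality on the segment from x to x + t \<xi>. As t <= 1, moving
    along it changes exp (- |x|) by at most the factor exp |\<xi>|.\<close>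
  have bs: "norm (s n x) \<le> (C * exp (norm \<xi>)) * exp (- norm x)" for n x
  proof -
    define t where "t = 1 / real (Suc n)"
    have t: "0 < t" "t \<le> 1" by (auto simp: t_def)
    define \<phi> where "\<phi> r = H (x + r *\<^sub>R \<xi>)" for r
    have lin: "H' y (r *\<^sub>R \<xi>) = r *\<^sub>R H' y \<xi>" for r y
      using has_derivative_bounded_linear[OF H] by (simp add: bounded_linear.linear linear_scale)
    have "norm (\<phi> t - \<phi> 0) \<le> (C * exp (norm \<xi>) * exp (- norm x)) * norm (t - 0)"
    proof (rule differentiable_bound[where S="{0..t}" and f'="\<lambda>r h. h *\<^sub>R H' (x + r *\<^sub>R \<xi>) \<xi>"])
      fix r assume r: "r \<in> {0..t}"
      have "(\<phi> has_derivative (\<lambda>h. H' (x + r *\<^sub>R \<xi>) (h *\<^sub>R \<xi>))) (at r)"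
        unfolding \<phi>_def
        by (rule has_derivative_compose[where g=H and f="\<lambda>t. x + t *\<^sub>R \<xi>" and f'="\<lambda>t. t *\<^sub>R \<xi>"])
          (auto intro!: derivative_eq_intros H)
      then show "(\<phi> has_derivative (\<lambda>h. h *\<^sub>R H' (x + r *\<^sub>R \<xi>) \<xi>)) (at r within {0..t})"
        by (simp add: lin has_derivative_at_withinI)
      have "norm (r *\<^sub>R \<xi>) \<le> norm \<xi>" using r t by (simp add: mult_left_le_one_le)
      then have "norm x \<le> norm (x + r *\<^sub>R \<xi>) + norm \<xi>"
        using norm_triangle_ineq4[of "x + r *\<^sub>R \<xi>" "r *\<^sub>R \<xi>"] by simp
      then have "C * exp (- norm (x + r *\<^sub>R \<xi>)) \<le> C * (exp (norm \<xi>) * exp (- norm x))"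
        using C by (intro mult_left_mono) (auto simp flip: exp_add)
      with bH'[of "x + r *\<^sub>R \<xi>"]
      have "norm (H' (x + r *\<^sub>R \<xi>) \<xi>) \<le> C * exp (norm \<xi>) * exp (- norm x)" by simp
      then show "onorm (\<lambda>h. h *\<^sub>R H' (x + r *\<^sub>R \<xi>) \<xi>) \<le> C * exp (norm \<xi>) * exp (- norm x)"
        by (intro onorm_le) (simp add: mult.commute mult_left_mono)
    qed (use t in auto)
    then have "norm (H (x + t *\<^sub>R \<xi>) - H x) / t \<le> C * exp (norm \<xi>) * exp (- norm x)"
      using t by (simp add: \<phi>_def divide_le_eq)
    then show ?thesis unfolding s_def t_def[symmetric] using t by (simp add: divide_inverse_commute)
  qed
  have "(\<lambda>n. \<integral>x. s n x \<partial>lborel) \<longlonglongrightarrow> (\<integral>x. H' x \<xi> \<partial>lborel)"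
  proof (rule integral_dominated_convergence)
    show "integrable lborel (\<lambda>x. (C * exp (norm \<xi>)) * exp (- norm x) :: real)"
      by (intro integrable_mult_right integrable_exp_minus_norm)
    show "AE x in lborel. (\<lambda>n. s n x) \<longlonglongrightarrow> H' x \<xi>"
      unfolding s_def by (intro AE_I2 difference_quotient_LIMSEQ H)
    show "(\<lambda>x. H' x \<xi>) \<in> borel_measurable lborel"
      using borel_measurable_directional_derivative[OF H] by simp
  qed (use bs in auto)
  then show ?thesis by (simp add: s0 LIMSEQ_const_iff)
qed

text \<open>The class on which integration by parts runs: closed under sums, products and linear
  substitutions, it contains the polynomials and \<open>ker y\<close>. The bound on the derivative
  is uniform in the direction, so that the mean value inequality controls reflection quotients
  too.\<close>

definition tame :: "('a::euclidean_space \<Rightarrow> complex) \<Rightarrow> bool" where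
  "tame k \<longleftrightarrow> (\<forall>x. k differentiable (at x)) \<and> exp_bounded k \<and>
     (\<exists>C a. 0 \<le> C \<and> 0 \<le> a \<and>
        (\<forall>x u. norm (frechet_derivative k (at x) u) \<le> C * exp (a * norm x) * norm u))"

lemma tameI:
  assumes "\<And>x. (k has_derivative k' x) (at x)" "exp_bounded k"
    and "0 \<le> C" "0 \<le> a" "\<And>x u. norm (k' x u) \<le> C * exp (a * norm x) * norm u"
  shows "tame k"
  unfolding tame_def
  using assms frechet_derivative_at[OF assms(1), symmetric] by (auto simp: differentiable_def)

lemma tame_has_derivative:
  "tame k \<Longrightarrow> (k has_derivative frechet_derivative k (at x)) (at x)"
  unfolding tame_def using frechet_derivative_works by blast

lemma tame_exp_bounded [simp]: "tame k \<Longrightarrow> exp_bounded k"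
  unfolding tame_def by blast

lemma tame_derivative_bound:
  assumes "tame k"
  obtains C a where "0 \<le> C" "0 \<le> a"
    "\<And>x u. norm (frechet_derivative k (at x) u) \<le> C * exp (a * norm x) * norm u"
  using assms unfolding tame_def by blast

lemma tame_continuous: "tame k \<Longrightarrow> continuous_on UNIV k"
  by (meson tame_has_derivative continuous_at_imp_continuous_on has_derivative_continuous)

lemma tame_measurable [simp]: "tame k \<Longrightarrow> k \<in> borel_measurable borel"
  by (intro borel_measurable_continuous_onI tame_continuous)

lemma tame_derivative_measurable [simp]:
  "tame k \<Longrightarrow> (\<lambda>x. frechet_derivative k (at x) u) \<in> borel_measurable borel"
  by (rule borel_measurable_directional_derivative) (rule tame_has_derivative)

lemma tame_derivative_exp_bounded [simp]:
  assumes "tame k"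
  shows "exp_bounded (\<lambda>x. frechet_derivative k (at x) u)"
proof -
  from assms obtain C a where b: "0 \<le> C" "0 \<le> a"
    "\<And>x u. norm (frechet_derivative k (at x) u) \<le> C * exp (a * norm x) * norm u"
    by (rule tame_derivative_bound) blast
  then show ?thesis by (intro exp_boundedI[of a _ "C * norm u"]) (auto simp: mult_ac)
qed

lemma tame_const [simp]: "tame (\<lambda>x. c)"
  by (rule tameI[where k'="\<lambda>x u. 0" and C=0 and a=0]) auto

lemma tame_inner [simp]: "tame (\<lambda>x. complex_of_real (u \<bullet> x))"
proof (rule tameI[where k'="\<lambda>x v. complex_of_real (u \<bullet> v)" and C="norm u" and a=0])
  show "((\<lambda>x. complex_of_real (u \<bullet> x)) has_derivative (\<lambda>v. complex_of_real (u \<bullet> v))) (at x)" for x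
    by (auto intro!: derivative_eq_intros)
qed (auto simp: Cauchy_Schwarz_ineq2)

lemma tame_add [simp]:
  assumes "tame f" "tame g"
  shows "tame (\<lambda>x. f x + g x)"
proof -
  let ?f = "\<lambda>x. frechet_derivative f (at x)" and ?g = "\<lambda>x. frechet_derivative g (at x)"
  from assms(1) obtain C a where f: "0 \<le> C" "0 \<le> a" "\<And>x u. norm (?f x u) \<le> C * exp (a * norm x) * norm u"
    by (rule tame_derivative_bound) blast
  from assms(2) obtain D b where g: "0 \<le> D" "0 \<le> b" "\<And>x u. norm (?g x u) \<le> D * exp (b * norm x) * norm u"
    by (rule tame_derivative_bound) blast
  show ?thesis
  proof (rule tameI)
    show "((\<lambda>x. f x + g x) has_derivative (\<lambda>u. ?f x u + ?g x u)) (at x)" for x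
      by (intro has_derivative_add tame_has_derivative assms)
    fix x :: 'a and u
    have "norm (?f x u + ?g x u) \<le> C * exp (a * norm x) * norm u + D * exp (b * norm x) * norm u"
      using f(3)[of x u] g(3)[of x u] norm_triangle_ineq[of "?f x u" "?g x u"] by linarith
    also have "\<dots> \<le> C * exp ((a + b) * norm x) * norm u + D * exp ((a + b) * norm x) * norm u"
      using f g by (intro add_mono mult_right_mono mult_left_mono) (auto intro!: mult_right_mono)
    finally show "norm (?f x u + ?g x u) \<le> (C + D) * exp ((a + b) * norm x) * norm u"
      by (simp add: distrib_right)
  qed (use f g assms in auto)
qed

lemma tame_mult [simp]:
  assumes "tame f" "tame g"
  shows "tame (\<lambda>x. f x * g x)"
proof -
  let ?f = "\<lambda>x. frechet_derivative f (at x)" and ?g = "\<lambda>x. frechet_derivative g (at x)"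
  from assms(1) obtain C a where f: "0 \<le> C" "0 \<le> a" "\<And>x u. norm (?f x u) \<le> C * exp (a * norm x) * norm u"
    by (rule tame_derivative_bound) blast
  from assms(2) obtain D b where g: "0 \<le> D" "0 \<le> b" "\<And>x u. norm (?g x u) \<le> D * exp (b * norm x) * norm u"
    by (rule tame_derivative_bound) blast
  from tame_exp_bounded[OF assms(1)] obtain C' a' where f': "0 \<le> C'" "0 \<le> a'" "\<And>x. norm (f x) \<le> C' * exp (a' * norm x)"
    by (rule exp_boundedE) blast
  from tame_exp_bounded[OF assms(2)] obtain D' b' where g': "0 \<le> D'" "0 \<le> b'" "\<And>x. norm (g x) \<le> D' * exp (b' * norm x)"
    by (rule exp_boundedE) blast
  define s where "s = a + a' + b + b'"
  show ?thesis
  proof (rule tameI)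
    show "((\<lambda>x. f x * g x) has_derivative (\<lambda>u. f x * ?g x u + ?f x u * g x)) (at x)" for x
      by (intro has_derivative_mult tame_has_derivative assms)
    fix x :: 'a and u
    have "norm (f x * ?g x u + ?f x u * g x) \<le> norm (f x) * norm (?g x u) + norm (?f x u) * norm (g x)"
      by (metis norm_mult norm_triangle_ineq)
    also have "\<dots> \<le> (C' * exp (a' * norm x)) * (D * exp (b * norm x) * norm u)
        + (C * exp (a * norm x) * norm u) * (D' * exp (b' * norm x))"
      using f g f' g' by (intro add_mono mult_mono) auto
    also have "\<dots> = C' * D * exp ((a' + b) * norm x) * norm u + C * D' * exp ((a + b') * norm x) * norm u"
      by (simp add: exp_add distrib_left distrib_right mult_ac)
    also have "\<dots> \<le> C' * D * exp (s * norm x) * norm u + C * D' * exp (s * norm x) * norm u"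
      using f g f' g' by (intro add_mono mult_right_mono mult_left_mono) (auto simp: s_def intro!: mult_right_mono)
    finally show "norm (f x * ?g x u + ?f x u * g x) \<le> (C' * D + C * D') * exp (s * norm x) * norm u"
      by (simp add: distrib_right)
  qed (use f g f' g' assms in \<open>auto simp: s_def\<close>)
qed

lemma tame_sum [simp]:
  assumes "\<And>i. i \<in> S \<Longrightarrow> tame (f i)"
  shows "tame (\<lambda>x. \<Sum>i\<in>S. f i x)"
  using assms by (induction S rule: infinite_finite_induct) auto

lemma tame_compose_linear:
  fixes T :: "'a::euclidean_space \<Rightarrow> 'a"
  assumes k: "tame k" and T: "linear T"
  shows "tame (\<lambda>x. k (T x))"
proof -
  have bl: "bounded_linear T" using T by (simp add: linear_conv_bounded_linear)
  obtain K where K: "0 < K" "\<And>x. norm (T x) \<le> norm x * K"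
    using bounded_linear.pos_bounded[OF bl] by blast
  from k obtain C a where f: "0 \<le> C" "0 \<le> a"
      "\<And>x u. norm (frechet_derivative k (at x) u) \<le> C * exp (a * norm x) * norm u"
    by (rule tame_derivative_bound) blast
  show ?thesis
  proof (rule tameI)
    show "((\<lambda>x. k (T x)) has_derivative (\<lambda>u. frechet_derivative k (at (T x)) (T u))) (at x)" for x
      by (rule has_derivative_compose[OF bounded_linear_imp_has_derivative[OF bl] tame_has_derivative[OF k]])
    show "exp_bounded (\<lambda>x. k (T x))"
      by (rule exp_bounded_compose[where f=k and K=K]) (use k K in \<open>auto simp: mult.commute\<close>)
    fix x u :: 'a
    have "a * norm (T x) \<le> a * K * norm x" using mult_left_mono[OF K(2)[of x] f(2)] by (simp add: mult_ac)
    then have "C * exp (a * norm (T x)) * norm (T u) \<le> C * exp (a * K * norm x) * (norm u * K)"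
      using f K by (intro mult_mono mult_left_mono) auto
    then show "norm (frechet_derivative k (at (T x)) (T u)) \<le> (C * K) * exp (a * K * norm x) * norm u"
      using f(3)[of "T x" "T u"] by (simp add: mult_ac)
  qed (use f K in auto)
qed

section \<open>Reflections and Dunkl operators\<close>

lemma linear_refl: "linear (refl \<alpha>)"
  by (auto simp: refl_def linear_iff algebra_simps inner_simps add_divide_distrib scaleR_add_left)

lemma inner_refl_left: "refl \<alpha> x \<bullet> y = x \<bullet> refl \<alpha> y"
  by (simp add: refl_def inner_simps inner_commute)

lemma refl_refl [simp]: "refl \<alpha> (refl \<alpha> x) = x"
proof (cases "\<alpha> = 0")
  case False
  then have "(norm \<alpha>)\<^sup>2 \<noteq> 0" by simp
  then show ?thesis
    by (simp add: refl_def inner_simps algebra_simps flip: power2_norm_eq_inner scaleR_add_left)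
qed (simp add: refl_def)

lemma norm_refl [simp]: "norm (refl \<alpha> x) = norm x"
  by (metis inner_refl_left norm_eq_sqrt_inner refl_refl)

lemma orthogonal_transformation_refl: "orthogonal_transformation (refl \<alpha>)"
  by (simp add: orthogonal_transformation linear_refl)

lemma refl_self: "\<alpha> \<noteq> 0 \<Longrightarrow> refl \<alpha> \<alpha> = - \<alpha>"
  by (simp add: refl_def power2_norm_eq_inner scaleR_2)

lemma inner_refl_self: "\<alpha> \<noteq> 0 \<Longrightarrow> \<alpha> \<bullet> refl \<alpha> x = - (\<alpha> \<bullet> x)"
  by (metis inner_minus_left inner_refl_left refl_self)

lemma refl_eq_self: "\<alpha> \<bullet> x = 0 \<Longrightarrow> refl \<alpha> x = x"
  by (simp add: refl_def inner_commute)

lemma refl_minus_root: "refl (- \<alpha>) x = refl \<alpha> x"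
  by (simp add: refl_def)

lemma refl_conjugate: "refl (refl \<beta> \<alpha>) (refl \<beta> x) = refl \<beta> (refl \<alpha> x)"
proof -
  have "refl \<beta> x \<bullet> refl \<beta> \<alpha> = x \<bullet> \<alpha>" by (simp add: inner_refl_left)
  then show ?thesis
    by (simp add: refl_def[of "refl \<beta> \<alpha>"] refl_def[of \<alpha>] linear_diff[OF linear_refl] linear_scale[OF linear_refl])
qed

lemma norm_diff_refl: "\<alpha> \<noteq> 0 \<Longrightarrow> norm (x - refl \<alpha> x) = 2 * \<bar>\<alpha> \<bullet> x\<bar> / norm \<alpha>"
  by (simp add: refl_def inner_commute abs_mult power2_eq_square)

text \<open>The value on the hyperplane is the limit of the quotient along \<alpha>, since x -
  \<open>refl \<alpha> x\<close> is 2 (\<alpha> . x) / |\<alpha>|^2 times \<alpha>. Dividing costs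
  one derivative: for tame f the proof only keeps measurability and the growth bound.\<close>

definition dquot :: "real^'n \<Rightarrow> (real^'n \<Rightarrow> complex) \<Rightarrow> real^'n \<Rightarrow> complex" where
  "dquot \<alpha> f x =
     (if \<alpha> \<bullet> x = 0 then complex_of_real (2 / (norm \<alpha>)\<^sup>2) * frechet_derivative f (at x) \<alpha>
      else (f x - f (refl \<alpha> x)) / complex_of_real (\<alpha> \<bullet> x))"

lemma refl_measurable [measurable]: "refl \<alpha> \<in> borel_measurable borel"
  by (intro borel_measurable_continuous_onI linear_continuous_on linear_refl[unfolded linear_conv_bounded_linear])

lemma dquot_measurable [simp]:
  assumes "tame f"
  shows "dquot \<alpha> f \<in> borel_measurable borel"
proof -
  have [measurable]: "f \<in> borel_measurable borel" "(\<lambda>x. frechet_derivative f (at x) \<alpha>) \<in> borel_measurable borel"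
    using assms by auto
  show ?thesis unfolding dquot_def by measurable
qed

text \<open>Off the hyperplane, x and its reflection lie in the ball of radius |x|, where the mean
  value inequality applies; their distance 2 |\<alpha> . x| / |\<alpha>| cancels the
  denominator.\<close>

lemma dquot_exp_bounded [simp]:
  fixes \<alpha> :: "real^'a"
  assumes f: "tame f" and \<alpha>: "\<alpha> \<noteq> 0"
  shows "exp_bounded (dquot \<alpha> f)"
proof -
  from f obtain C a where b: "0 \<le> C" "0 \<le> a"
      "\<And>x u. norm (frechet_derivative f (at x) u) \<le> C * exp (a * norm x) * norm u"
    by (rule tame_derivative_bound) blast
  show ?thesis
  proof (rule exp_boundedI[of a _ "2 * C / norm \<alpha>"])
    fix x
    show "norm (dquot \<alpha> f x) \<le> 2 * C / norm \<alpha> * exp (a * norm x)"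
    proof (cases "\<alpha> \<bullet> x = 0")
      case True
      have "norm (dquot \<alpha> f x) = 2 / (norm \<alpha>)\<^sup>2 * norm (frechet_derivative f (at x) \<alpha>)"
        using True by (simp add: dquot_def norm_mult norm_divide norm_power)
      also have "\<dots> \<le> 2 / (norm \<alpha>)\<^sup>2 * (C * exp (a * norm x) * norm \<alpha>)"
        by (intro mult_left_mono b) auto
      finally show ?thesis using \<alpha> by (simp add: power2_eq_square field_simps)
    next
      case False
      have "norm (f x - f (refl \<alpha> x)) \<le> C * exp (a * norm x) * norm (x - refl \<alpha> x)"
      proof (rule differentiable_bound[where S="cball 0 (norm x)" and f'="\<lambda>x. frechet_derivative f (at x)"])
        fix y :: "real^'a" assume "y \<in> cball 0 (norm x)"
        then have y: "norm y \<le> norm x" by simp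
        show "(f has_derivative frechet_derivative f (at y)) (at y within cball 0 (norm x))"
          using tame_has_derivative[OF f] by (rule has_derivative_at_withinI)
        have "C * exp (a * norm y) * norm u \<le> C * exp (a * norm x) * norm u" for u :: "real^'a"
          using b y by (intro mult_right_mono mult_left_mono) (auto intro!: mult_left_mono)
        then show "onorm (frechet_derivative f (at y)) \<le> C * exp (a * norm x)"
          using b(3)[of y] by (intro onorm_le) (meson order_trans)
      qed auto
      then show ?thesis
        using False \<alpha> by (simp add: dquot_def norm_divide norm_diff_refl field_simps)
    qed
  qed (use b in auto)
qed

text \<open>Numerator and denominator are both odd under the reflection.\<close>

lemma dquot_refl [simp]:
  assumes "\<alpha> \<noteq> 0"
  shows "dquot \<alpha> f (refl \<alpha> x) = dquot \<alpha> f x"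
proof (cases "\<alpha> \<bullet> x = 0")
  case True
  then show ?thesis by (simp add: refl_eq_self)
next
  case False
  then show ?thesis using assms by (simp add: dquot_def inner_refl_self minus_divide_right[symmetric] field_simps)
qed

lemma dquot_mult_inner:
  "dquot \<alpha> f x * complex_of_real (\<alpha> \<bullet> x) = f x - f (refl \<alpha> x)"
  by (auto simp: dquot_def refl_eq_self)

text \<open>\<open>perm\<close> carries all that the proof uses of the reflection symmetry: each
  reflection permutes the positive roots up to sign and preserves \<kappa>. Invariance of the weight
  and equivariance of the Dunkl operators both rest on it.\<close>

locale dunkl_system =
  fixes Rp :: "(real^'n) set" and \<kappa> :: "real^'n \<Rightarrow> real"
  assumes finite_Rp: "finite Rp"
    and nonzero: "\<alpha> \<in> Rp \<Longrightarrow> \<alpha> \<noteq> 0"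
    and \<kappa>_nonneg: "\<alpha> \<in> Rp \<Longrightarrow> 0 \<le> \<kappa> \<alpha>"
    and perm: "\<beta> \<in> Rp \<Longrightarrow> \<exists>\<pi>. bij_betw \<pi> Rp Rp \<and>
      (\<forall>\<alpha>\<in>Rp. \<kappa> (\<pi> \<alpha>) = \<kappa> \<alpha> \<and> (\<pi> \<alpha> = refl \<beta> \<alpha> \<or> \<pi> \<alpha> = - refl \<beta> \<alpha>))"
begin

text \<open>The weight regularised by \<open>\<epsilon>\<close>, which is smooth across the reflecting hyperplanes for \<open>\<epsilon> > 0\<close>.\<close>

definition reg_weight :: "real \<Rightarrow> real^'n \<Rightarrow> real" where
  "reg_weight \<epsilon> x = (\<Prod>\<alpha>\<in>Rp. if \<kappa> \<alpha> = 0 then 1 else ((\<alpha> \<bullet> x)\<^sup>2 + \<epsilon>\<^sup>2) powr \<kappa> \<alpha>)"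

lemma reg_weight_0: "reg_weight 0 x = weight Rp \<kappa> x"
  unfolding reg_weight_def weight_def
proof (rule prod.cong)
  fix \<alpha> assume "\<alpha> \<in> Rp"
  have "((\<alpha> \<bullet> x)\<^sup>2) powr \<kappa> \<alpha> = \<bar>\<alpha> \<bullet> x\<bar> powr (2 * \<kappa> \<alpha>)"
  proof (cases "\<alpha> \<bullet> x = 0")
    case False
    then have "(\<alpha> \<bullet> x)\<^sup>2 = \<bar>\<alpha> \<bullet> x\<bar> powr 2" by simp
    then show ?thesis by (simp only: powr_powr)
  qed simp
  then show "(if \<kappa> \<alpha> = 0 then 1 else ((\<alpha> \<bullet> x)\<^sup>2 + 0\<^sup>2) powr \<kappa> \<alpha>) =
    (if \<kappa> \<alpha> = 0 then 1 else \<bar>\<alpha> \<bullet> x\<bar> powr (2 * \<kappa> \<alpha>))" by simp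
qed simp

lemma reg_weight_nonneg [simp]: "0 \<le> reg_weight \<epsilon> x"
  unfolding reg_weight_def by (intro prod_nonneg) auto

lemma weight_nonneg [simp]: "0 \<le> weight Rp \<kappa> x"
  by (metis reg_weight_0 reg_weight_nonneg)

lemma reg_weight_measurable [measurable]: "reg_weight \<epsilon> \<in> borel_measurable borel"
  unfolding reg_weight_def by measurable

lemma weight_measurable [measurable]: "weight Rp \<kappa> \<in> borel_measurable borel"
  using reg_weight_measurable[of 0] by (simp add: reg_weight_0[abs_def] cong: measurable_cong)

lemma reg_weight_refl [simp]:
  assumes "\<beta> \<in> Rp"
  shows "reg_weight \<epsilon> (refl \<beta> x) = reg_weight \<epsilon> x"
proof -
  from perm[OF assms] obtain \<pi> where \<pi>: "bij_betw \<pi> Rp Rp"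
    "\<And>\<alpha>. \<alpha> \<in> Rp \<Longrightarrow> \<kappa> (\<pi> \<alpha>) = \<kappa> \<alpha> \<and> (\<pi> \<alpha> = refl \<beta> \<alpha> \<or> \<pi> \<alpha> = - refl \<beta> \<alpha>)" by blast
  have "reg_weight \<epsilon> x = (\<Prod>\<alpha>\<in>Rp. if \<kappa> (\<pi> \<alpha>) = 0 then 1 else ((\<pi> \<alpha> \<bullet> x)\<^sup>2 + \<epsilon>\<^sup>2) powr \<kappa> (\<pi> \<alpha>))"
    unfolding reg_weight_def by (rule prod.reindex_bij_betw[OF \<pi>(1), symmetric])
  also have "\<dots> = reg_weight \<epsilon> (refl \<beta> x)"
    unfolding reg_weight_def
  proof (rule prod.cong)
    fix \<alpha> assume "\<alpha> \<in> Rp"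
    from \<pi>(2)[OF this] have "\<kappa> (\<pi> \<alpha>) = \<kappa> \<alpha>" "(\<pi> \<alpha> \<bullet> x)\<^sup>2 = (\<alpha> \<bullet> refl \<beta> x)\<^sup>2"
      by (auto simp: inner_refl_left)
    then show "(if \<kappa> (\<pi> \<alpha>) = 0 then 1 else ((\<pi> \<alpha> \<bullet> x)\<^sup>2 + \<epsilon>\<^sup>2) powr \<kappa> (\<pi> \<alpha>)) =
       (if \<kappa> \<alpha> = 0 then 1 else ((\<alpha> \<bullet> refl \<beta> x)\<^sup>2 + \<epsilon>\<^sup>2) powr \<kappa> \<alpha>)" by simp
  qed simp
  finally show ?thesis by simp
qed

text \<open>Each base is at most (1 + |\<alpha>| |x|)^2 <= exp (2 |\<alpha>| |x|). The bound is
  independent of \<epsilon>, so it dominates in the limit \<epsilon> -> 0.\<close>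

lemma reg_weight_le:
  assumes "0 \<le> \<epsilon>" "\<epsilon> \<le> 1"
  shows "reg_weight \<epsilon> x \<le> exp ((\<Sum>\<alpha>\<in>Rp. 2 * \<kappa> \<alpha> * norm \<alpha>) * norm x)"
proof -
  have "reg_weight \<epsilon> x \<le> (\<Prod>\<alpha>\<in>Rp. exp (2 * \<kappa> \<alpha> * norm \<alpha> * norm x))"
    unfolding reg_weight_def
  proof (rule prod_mono)
    fix \<alpha> assume \<alpha>: "\<alpha> \<in> Rp"
    have "\<epsilon>\<^sup>2 \<le> 1\<^sup>2" using assms by (intro power_mono) auto
    moreover have "(\<alpha> \<bullet> x)\<^sup>2 \<le> (norm \<alpha> * norm x)\<^sup>2"
      using Cauchy_Schwarz_ineq2[of \<alpha> x] by (metis abs_ge_zero power2_abs power_mono)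
    ultimately have "(\<alpha> \<bullet> x)\<^sup>2 + \<epsilon>\<^sup>2 \<le> (1 + norm \<alpha> * norm x)\<^sup>2"
      using mult_nonneg_nonneg[OF norm_ge_zero[of \<alpha>] norm_ge_zero[of x]] unfolding power2_sum by linarith
    also have "\<dots> \<le> (exp (norm \<alpha> * norm x))\<^sup>2"
      by (intro power_mono exp_ge_add_one_self) auto
    also have "\<dots> = exp (2 * (norm \<alpha> * norm x))" by (simp add: exp_double)
    finally have "((\<alpha> \<bullet> x)\<^sup>2 + \<epsilon>\<^sup>2) powr \<kappa> \<alpha> \<le> exp (2 * (norm \<alpha> * norm x)) powr \<kappa> \<alpha>"
      by (intro powr_mono2 \<kappa>_nonneg[OF \<alpha>]) auto
    also have "\<dots> = exp (2 * \<kappa> \<alpha> * norm \<alpha> * norm x)" by (simp add: powr_def mult_ac)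
    finally show "0 \<le> (if \<kappa> \<alpha> = 0 then 1 else ((\<alpha> \<bullet> x)\<^sup>2 + \<epsilon>\<^sup>2) powr \<kappa> \<alpha>) \<and>
        (if \<kappa> \<alpha> = 0 then 1 else ((\<alpha> \<bullet> x)\<^sup>2 + \<epsilon>\<^sup>2) powr \<kappa> \<alpha>) \<le> exp (2 * \<kappa> \<alpha> * norm \<alpha> * norm x)"
      by auto
  qed
  also have "\<dots> = exp ((\<Sum>\<alpha>\<in>Rp. 2 * \<kappa> \<alpha> * norm \<alpha>) * norm x)"
    by (simp add: exp_sum[OF finite_Rp] sum_distrib_right)
  finally show ?thesis .
qed

lemma reg_weight_exp_bounded:
  assumes "0 \<le> \<epsilon>" "\<epsilon> \<le> 1"
  shows "exp_bounded (\<lambda>x. complex_of_real (reg_weight \<epsilon> x))"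
proof (rule exp_boundedI[of "\<Sum>\<alpha>\<in>Rp. 2 * \<kappa> \<alpha> * norm \<alpha>" _ 1])
  show "0 \<le> (\<Sum>\<alpha>\<in>Rp. 2 * \<kappa> \<alpha> * norm \<alpha>)" by (intro sum_nonneg) (simp add: \<kappa>_nonneg)
qed (use reg_weight_le[OF assms] in simp)

text \<open>In this form differentiation directly produces the logarithmic derivative, a sum over
  the roots.\<close>

lemma reg_weight_exp:
  assumes "\<epsilon> > 0"
  shows "reg_weight \<epsilon> x = exp (\<Sum>\<alpha>\<in>Rp. \<kappa> \<alpha> * ln ((\<alpha> \<bullet> x)\<^sup>2 + \<epsilon>\<^sup>2))"
  unfolding reg_weight_def exp_sum[OF finite_Rp]
proof (rule prod.cong)
  fix \<alpha> assume "\<alpha> \<in> Rp"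
  have "(\<alpha> \<bullet> x)\<^sup>2 + \<epsilon>\<^sup>2 > 0" using assms by (simp add: add_nonneg_pos)
  then show "(if \<kappa> \<alpha> = 0 then 1 else ((\<alpha> \<bullet> x)\<^sup>2 + \<epsilon>\<^sup>2) powr \<kappa> \<alpha>) = exp (\<kappa> \<alpha> * ln ((\<alpha> \<bullet> x)\<^sup>2 + \<epsilon>\<^sup>2))"
    by (auto simp: powr_def)
qed simp

lemma reg_weight_has_derivative:
  assumes "\<epsilon> > 0"
  shows "(reg_weight \<epsilon> has_derivative
     (\<lambda>u. reg_weight \<epsilon> x * (\<Sum>\<alpha>\<in>Rp. 2 * \<kappa> \<alpha> * (\<alpha> \<bullet> u) * ((\<alpha> \<bullet> x) / ((\<alpha> \<bullet> x)\<^sup>2 + \<epsilon>\<^sup>2))))) (at x)"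
proof -
  have pos: "(\<alpha> \<bullet> x)\<^sup>2 + \<epsilon>\<^sup>2 > 0" for \<alpha> using assms by (simp add: add_nonneg_pos)
  have "((\<lambda>x. exp (\<Sum>\<alpha>\<in>Rp. \<kappa> \<alpha> * ln ((\<alpha> \<bullet> x)\<^sup>2 + \<epsilon>\<^sup>2))) has_derivative
     (\<lambda>u. (\<Sum>\<alpha>\<in>Rp. 2 * \<kappa> \<alpha> * (\<alpha> \<bullet> u) * ((\<alpha> \<bullet> x) / ((\<alpha> \<bullet> x)\<^sup>2 + \<epsilon>\<^sup>2)))
       * exp (\<Sum>\<alpha>\<in>Rp. \<kappa> \<alpha> * ln ((\<alpha> \<bullet> x)\<^sup>2 + \<epsilon>\<^sup>2)))) (at x)"
    by (rule has_derivative_exp, rule has_derivative_sum, rule derivative_eq_intros,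
        rule derivative_eq_intros, rule pos, (rule derivative_eq_intros refl)+)
      (auto simp: field_simps)
  then show ?thesis by (simp add: reg_weight_exp[OF assms, abs_def] mult.commute)
qed

lemma reg_weight_LIMSEQ: "(\<lambda>n. reg_weight (1 / real (Suc n)) x) \<longlonglongrightarrow> reg_weight 0 x"
  unfolding reg_weight_def
proof (rule tendsto_prod)
  fix \<alpha> assume \<alpha>: "\<alpha> \<in> Rp"
  have e: "(\<lambda>n. 1 / real (Suc n)) \<longlonglongrightarrow> 0"
    using LIMSEQ_inverse_real_of_nat by (simp add: inverse_eq_divide)
  have "(\<lambda>n. (\<alpha> \<bullet> x)\<^sup>2 + (1 / real (Suc n))\<^sup>2) \<longlonglongrightarrow> (\<alpha> \<bullet> x)\<^sup>2 + 0\<^sup>2"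
    by (intro tendsto_intros e)
  \<comment> \<open>On the hyperplane the base tends to 0, where convergence of the power needs a
    positive exponent; factors with \<kappa> \<alpha> = 0 are constantly 1.\<close>
  then have "(\<lambda>n. ((\<alpha> \<bullet> x)\<^sup>2 + (1 / real (Suc n))\<^sup>2) powr \<kappa> \<alpha>) \<longlonglongrightarrow> ((\<alpha> \<bullet> x)\<^sup>2 + 0\<^sup>2) powr \<kappa> \<alpha>" if "\<kappa> \<alpha> \<noteq> 0"
    by (rule tendsto_powr') (use \<kappa>_nonneg[OF \<alpha>] that in auto)
  then show "(\<lambda>n. if \<kappa> \<alpha> = 0 then 1 else ((\<alpha> \<bullet> x)\<^sup>2 + (1 / real (Suc n))\<^sup>2) powr \<kappa> \<alpha>)
     \<longlonglongrightarrow> (if \<kappa> \<alpha> = 0 then 1 else ((\<alpha> \<bullet> x)\<^sup>2 + 0\<^sup>2) powr \<kappa> \<alpha>)" by auto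
qed

section \<open>Integration against the weighted Gaussian\<close>

definition gint :: "(real^'n \<Rightarrow> complex) \<Rightarrow> complex" where
  "gint f = (\<integral>x. f x * complex_of_real (exp (- (norm x)\<^sup>2 / 2) * weight Rp \<kappa> x) \<partial>lborel)"

definition gint_ok :: "(real^'n \<Rightarrow> complex) \<Rightarrow> bool" where
  "gint_ok f \<longleftrightarrow> f \<in> borel_measurable borel \<and> exp_bounded f"

lemma gint_ok_integrable:
  assumes "gint_ok f"
  shows "integrable lborel (\<lambda>x. f x * complex_of_real (exp (- (norm x)\<^sup>2 / 2) * weight Rp \<kappa> x))"
proof -
  have [measurable]: "f \<in> borel_measurable borel" and b: "exp_bounded f" using assms by (auto simp: gint_ok_def)
  have "exp_bounded (\<lambda>x. f x * complex_of_real (weight Rp \<kappa> x))"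
    using reg_weight_exp_bounded[of 0] by (intro exp_bounded_mult b) (simp add: reg_weight_0)
  from integrable_exp_bounded_gauss[OF _ this] show ?thesis by (simp add: mult_ac)
qed

lemma gint_ok_tame [simp]: "tame f \<Longrightarrow> gint_ok f" by (simp add: gint_ok_def)

lemma gint_ok_add [simp]: "gint_ok f \<Longrightarrow> gint_ok g \<Longrightarrow> gint_ok (\<lambda>x. f x + g x)" by (auto simp: gint_ok_def)

lemma gint_ok_diff [simp]: "gint_ok f \<Longrightarrow> gint_ok g \<Longrightarrow> gint_ok (\<lambda>x. f x - g x)" by (auto simp: gint_ok_def)

lemma gint_ok_mult [simp]: "gint_ok f \<Longrightarrow> gint_ok g \<Longrightarrow> gint_ok (\<lambda>x. f x * g x)" by (auto simp: gint_ok_def)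

lemma gint_ok_sum [simp]: "(\<And>i. i \<in> S \<Longrightarrow> gint_ok (f i)) \<Longrightarrow> gint_ok (\<lambda>x. \<Sum>i\<in>S. f i x)"
  by (simp add: gint_ok_def borel_measurable_sum exp_bounded_sum)

lemma gint_ok_refl [simp]: "gint_ok f \<Longrightarrow> gint_ok (\<lambda>x. f (refl \<beta> x))"
  unfolding gint_ok_def using exp_bounded_compose[of f "refl \<beta>" 1] by auto

lemma gint_add: "gint_ok f \<Longrightarrow> gint_ok g \<Longrightarrow> gint (\<lambda>x. f x + g x) = gint f + gint g"
  unfolding gint_def by (simp only: distrib_right Bochner_Integration.integral_add gint_ok_integrable)

lemma gint_diff: "gint_ok f \<Longrightarrow> gint_ok g \<Longrightarrow> gint (\<lambda>x. f x - g x) = gint f - gint g"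
  unfolding gint_def by (simp only: left_diff_distrib Bochner_Integration.integral_diff gint_ok_integrable)

lemma gint_cmult: "gint (\<lambda>x. c * f x) = c * gint f"
  unfolding gint_def by (simp only: mult.assoc integral_mult_right_zero)

lemma gint_sum: "(\<And>i. i \<in> S \<Longrightarrow> gint_ok (f i)) \<Longrightarrow> gint (\<lambda>x. \<Sum>i\<in>S. f i x) = (\<Sum>i\<in>S. gint (f i))"
  unfolding gint_def by (simp only: sum_distrib_right Bochner_Integration.integral_sum gint_ok_integrable)

lemma gint_refl:
  assumes "\<beta> \<in> Rp" "gint_ok f"
  shows "gint (\<lambda>x. f (refl \<beta> x)) = gint f"
proof -
  have [measurable]: "f \<in> borel_measurable borel" using assms(2) by (auto simp: gint_ok_def)
  have "weight Rp \<kappa> (refl \<beta> x) = weight Rp \<kappa> x" for x using reg_weight_refl[OF assms(1), of 0] by (simp add: reg_weight_0)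
  then show ?thesis
    unfolding gint_def
    using lborel_integral_orthogonal_transformation[OF orthogonal_transformation_refl[of \<beta>],
        of "\<lambda>x. f x * complex_of_real (exp (- (norm x)\<^sup>2 / 2) * weight Rp \<kappa> x)"] by simp
qed

end

section \<open>Integration by parts for Dunkl operators\<close>

context dunkl_system
begin

text \<open>Arbitrary directions are needed because reflections mix the coordinates, and because
  integration by parts in the direction y evaluates the transform of the Gaussian.\<close>

definition dunkl :: "real^'n \<Rightarrow> (real^'n \<Rightarrow> complex) \<Rightarrow> real^'n \<Rightarrow> complex" where
  "dunkl \<xi> f x = frechet_derivative f (at x) \<xi> +
     (\<Sum>\<alpha>\<in>Rp. complex_of_real (\<kappa> \<alpha> * (\<alpha> \<bullet> \<xi>)) * dquot \<alpha> f x)"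

lemma dunkl_op_eq: "dunkl_op Rp \<kappa> j f = dunkl (axis j 1) f"
  by (rule ext) (simp add: dunkl_op_def dunkl_def dquot_def inner_axis)

lemma gint_ok_frechet [simp]: "tame k \<Longrightarrow> gint_ok (\<lambda>x. frechet_derivative k (at x) u)"
  by (simp add: gint_ok_def)

lemma gint_ok_dquot [simp]: "tame k \<Longrightarrow> \<alpha> \<in> Rp \<Longrightarrow> gint_ok (dquot \<alpha> k)"
  by (simp add: gint_ok_def nonzero)

lemma gint_ok_dunkl [simp]: "tame k \<Longrightarrow> gint_ok (dunkl \<xi> k)"
  unfolding dunkl_def[abs_def] by (intro gint_ok_add gint_ok_sum gint_ok_mult) auto

text \<open>Integrating \<open>\<partial>\<^sub>\<xi>\<close> against the regularised weight, the reflection symmetry replaces \<open>2 k\<close> by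
  \<open>k - k \<circ> \<sigma>\<^sub>\<alpha>\<close> in front of the odd factor coming from the logarithmic derivative of the weight.\<close>

lemma regularised_dunkl_integral:
  assumes k: "tame k" and \<epsilon>: "0 < \<epsilon>" "\<epsilon> \<le> 1"
  shows "(\<integral>x. (frechet_derivative k (at x) \<xi> - complex_of_real (\<xi> \<bullet> x) * k x +
       (\<Sum>\<alpha>\<in>Rp. complex_of_real (\<kappa> \<alpha> * (\<alpha> \<bullet> \<xi>)) * dquot \<alpha> k x *
         complex_of_real ((\<alpha> \<bullet> x)\<^sup>2 / ((\<alpha> \<bullet> x)\<^sup>2 + \<epsilon>\<^sup>2)))) *
       complex_of_real (exp (- (norm x)\<^sup>2 / 2) * reg_weight \<epsilon> x) \<partial>lborel) = 0"
proof -
  let ?k' = "\<lambda>x. frechet_derivative k (at x)"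
  define g where "g x = complex_of_real (exp (- (norm x)\<^sup>2 / 2))" for x :: "real^'n"
  define w where "w x = complex_of_real (reg_weight \<epsilon> x)" for x
  define od where "od \<alpha> x = complex_of_real ((\<alpha> \<bullet> x) / ((\<alpha> \<bullet> x)\<^sup>2 + \<epsilon>\<^sup>2))" for \<alpha> x :: "real^'n"
  have pos: "(\<alpha> \<bullet> x)\<^sup>2 + \<epsilon>\<^sup>2 > 0" for \<alpha> x :: "real^'n" using \<epsilon> by (simp add: add_nonneg_pos)
  \<comment> \<open>This bound blows up as \<epsilon> -> 0. It only serves convergence for fixed
    \<epsilon>; the limit is taken after \<open>od\<close> has been absorbed into
    \<open>dquot\<close>.\<close>
  have odb: "exp_bounded (od \<alpha>)" for \<alpha>
  proof (rule exp_bounded_mono)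
    show "exp_bounded (\<lambda>x. complex_of_real (1 / \<epsilon>\<^sup>2) * complex_of_real (\<alpha> \<bullet> x))"
      by (intro exp_bounded_mult exp_bounded_const exp_bounded_inner)
    show "norm (od \<alpha> x) \<le> norm (complex_of_real (1 / \<epsilon>\<^sup>2) * complex_of_real (\<alpha> \<bullet> x))" for x
    proof -
      have "\<bar>\<alpha> \<bullet> x\<bar> / ((\<alpha> \<bullet> x)\<^sup>2 + \<epsilon>\<^sup>2) \<le> \<bar>\<alpha> \<bullet> x\<bar> / \<epsilon>\<^sup>2"
        using \<epsilon> pos[of \<alpha> x] by (intro divide_left_mono) auto
      then show ?thesis using pos[of \<alpha> x] unfolding od_def norm_mult norm_of_real by simp
    qed
  qed
  have wb: "exp_bounded w" unfolding w_def using \<epsilon> by (intro reg_weight_exp_bounded) auto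
  have wm[measurable]: "w \<in> borel_measurable borel" unfolding w_def by measurable
  have odm[measurable]: "od \<alpha> \<in> borel_measurable borel" for \<alpha> unfolding od_def by measurable
  have gm[measurable]: "g \<in> borel_measurable borel" unfolding g_def by measurable
  have int: "integrable lborel (\<lambda>x. f x * g x * w x)" if "gint_ok f" for f
  proof -
    have [measurable]: "f \<in> borel_measurable borel" and "exp_bounded f" using that by (auto simp: gint_ok_def)
    then have "exp_bounded (\<lambda>x. f x * w x)" using wb by auto
    from integrable_exp_bounded_gauss[OF _ this] show ?thesis by (simp add: g_def mult_ac)
  qed
  have odok: "gint_ok (od \<alpha>)" for \<alpha> using odb by (simp add: gint_ok_def)
  define J where "J f = (\<integral>x. f x * g x * w x \<partial>lborel)" for f
  have J_add: "J (\<lambda>x. f x + h x) = J f + J h" if "gint_ok f" "gint_ok h" for f h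
    unfolding J_def using int[OF that(1)] int[OF that(2)] by (simp add: distrib_right)
  have J_sum: "J (\<lambda>x. \<Sum>\<alpha>\<in>Rp. f \<alpha> x) = (\<Sum>\<alpha>\<in>Rp. J (f \<alpha>))" if "\<And>\<alpha>. \<alpha> \<in> Rp \<Longrightarrow> gint_ok (f \<alpha>)" for f
    unfolding J_def sum_distrib_right by (intro Bochner_Integration.integral_sum int that)
  have J_cmult: "J (\<lambda>x. c * f x) = c * J f" for c f
    unfolding J_def by (simp only: mult.assoc integral_mult_right_zero)
  have J_refl: "J (\<lambda>x. f (refl \<alpha> x)) = J f" if "\<alpha> \<in> Rp" "gint_ok f" for f \<alpha>
  proof -
    have [measurable]: "f \<in> borel_measurable borel" using that by (auto simp: gint_ok_def)
    show ?thesis unfolding J_def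
      using lborel_integral_orthogonal_transformation[OF orthogonal_transformation_refl[of \<alpha>],
        of "\<lambda>x. f x * g x * w x"] that(1) by (simp add: g_def w_def)
  qed
  define A where "A x = ?k' x \<xi> - complex_of_real (\<xi> \<bullet> x) * k x" for x
  have Aok: "gint_ok A" unfolding A_def using k by (intro gint_ok_diff gint_ok_mult) auto
  define H where "H x = k x * g x * w x" for x
  define H' where "H' x u = k x * (g x * (w x * (\<Sum>\<alpha>\<in>Rp. complex_of_real (2 * \<kappa> \<alpha> * (\<alpha> \<bullet> u)) * od \<alpha> x))
      + - complex_of_real (x \<bullet> u) * g x * w x) + ?k' x u * (g x * w x)" for x u
  have gd: "(g has_derivative (\<lambda>u. - complex_of_real (x \<bullet> u) * g x)) (at x)" for x
  proof -
    have "((\<lambda>x. exp (- (x \<bullet> x) / 2)) has_derivative (\<lambda>u. - (x \<bullet> u) * exp (- (x \<bullet> x) / 2))) (at x)"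
      by (auto intro!: derivative_eq_intros simp: inner_commute field_simps)
    from has_derivative_of_real[OF this, where ?'a=complex] show ?thesis
      by (simp add: g_def[abs_def] power2_norm_eq_inner)
  qed
  have wd: "(w has_derivative (\<lambda>u. w x * (\<Sum>\<alpha>\<in>Rp. complex_of_real (2 * \<kappa> \<alpha> * (\<alpha> \<bullet> u)) * od \<alpha> x))) (at x)" for x
    using has_derivative_of_real[OF reg_weight_has_derivative[OF \<epsilon>(1)], where ?'a=complex, of x]
    by (simp add: w_def[abs_def] od_def)
  have Hd: "(H has_derivative H' x) (at x)" for x
    unfolding H_def[abs_def] H'_def mult.assoc
    using has_derivative_mult[OF tame_has_derivative[OF k] has_derivative_mult[OF gd wd]]
    by (simp add: mult.assoc)
  have H'_eq: "H' x \<xi> = (A x + (\<Sum>\<alpha>\<in>Rp. complex_of_real (\<kappa> \<alpha> * (\<alpha> \<bullet> \<xi>)) * (2 * k x * od \<alpha> x))) * g x * w x" for x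
    unfolding H'_def A_def
    by (simp add: algebra_simps sum_distrib_left sum_distrib_right inner_commute)
  have Bok: "gint_ok (\<lambda>x. A x + (\<Sum>\<alpha>\<in>Rp. complex_of_real (\<kappa> \<alpha> * (\<alpha> \<bullet> \<xi>)) * (2 * k x * od \<alpha> x)))"
    using k odok Aok by (intro gint_ok_add gint_ok_sum gint_ok_mult) auto
  have "exp_bounded (\<lambda>x. k x * w x)" using k wb by auto
  then obtain C1 where C1: "0 \<le> C1" "\<And>x. norm (k x * w x) * exp (- (norm x)\<^sup>2 / 2) \<le> C1 * exp (- norm x)"
    by (rule exp_bounded_gauss_le) blast
  have "exp_bounded (\<lambda>x. (A x + (\<Sum>\<alpha>\<in>Rp. complex_of_real (\<kappa> \<alpha> * (\<alpha> \<bullet> \<xi>)) * (2 * k x * od \<alpha> x))) * w x)"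
    using Bok wb by (intro exp_bounded_mult) (auto simp: gint_ok_def)
  then obtain C2 where C2: "0 \<le> C2" "\<And>x. norm ((A x + (\<Sum>\<alpha>\<in>Rp. complex_of_real (\<kappa> \<alpha> * (\<alpha> \<bullet> \<xi>)) * (2 * k x * od \<alpha> x))) * w x)
      * exp (- (norm x)\<^sup>2 / 2) \<le> C2 * exp (- norm x)"
    by (rule exp_bounded_gauss_le) blast
  have "(\<integral>x. H' x \<xi> \<partial>lborel) = 0"
  proof (rule integral_directional_derivative_eq_0[OF Hd])
    fix x :: "real^'n"
    have le: "C1 * exp (- norm x) \<le> (C1 + C2) * exp (- norm x)" "C2 * exp (- norm x) \<le> (C1 + C2) * exp (- norm x)"
      using C1 C2 by (auto intro!: mult_right_mono)
    show "norm (H x) \<le> (C1 + C2) * exp (- norm x)"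
      by (rule order_trans[OF _ le(1)]) (use C1(2)[of x] in \<open>simp add: H_def g_def norm_mult mult_ac\<close>)
    show "norm (H' x \<xi>) \<le> (C1 + C2) * exp (- norm x)"
      by (rule order_trans[OF _ le(2)]) (use C2(2)[of x] in \<open>simp add: H'_eq g_def norm_mult mult_ac\<close>)
  qed
  then have "J (\<lambda>x. A x + (\<Sum>\<alpha>\<in>Rp. complex_of_real (\<kappa> \<alpha> * (\<alpha> \<bullet> \<xi>)) * (2 * k x * od \<alpha> x))) = 0"
    unfolding J_def H'_eq .
  moreover have "J (\<lambda>x. A x + (\<Sum>\<alpha>\<in>Rp. complex_of_real (\<kappa> \<alpha> * (\<alpha> \<bullet> \<xi>)) * (2 * k x * od \<alpha> x))) =
     J A + (\<Sum>\<alpha>\<in>Rp. complex_of_real (\<kappa> \<alpha> * (\<alpha> \<bullet> \<xi>)) * J (\<lambda>x. 2 * k x * od \<alpha> x))"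
    using k odok Aok by (subst J_add) (auto simp: J_sum J_cmult)
  moreover have "J (\<lambda>x. 2 * k x * od \<alpha> x) = J (\<lambda>x. dquot \<alpha> k x * complex_of_real ((\<alpha> \<bullet> x)\<^sup>2 / ((\<alpha> \<bullet> x)\<^sup>2 + \<epsilon>\<^sup>2)))"
    if \<alpha>: "\<alpha> \<in> Rp" for \<alpha>
  proof -
    have ko: "gint_ok (\<lambda>x. k x * od \<alpha> x)" using k odok by simp
    have ko': "gint_ok (\<lambda>x. - 1 * (k (refl \<alpha> x) * od \<alpha> x))" 
      using gint_ok_refl[of k \<alpha>] k odok by (intro gint_ok_mult) auto
    have "od \<alpha> (refl \<alpha> x) = - od \<alpha> x" for x by (simp add: od_def inner_refl_self[OF nonzero[OF \<alpha>]])
    then have "J (\<lambda>x. k x * od \<alpha> x) = J (\<lambda>x. - 1 * (k (refl \<alpha> x) * od \<alpha> x))"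
      using J_refl[OF \<alpha> ko] by simp
    then have "J (\<lambda>x. 2 * k x * od \<alpha> x) = J (\<lambda>x. k x * od \<alpha> x) + J (\<lambda>x. - 1 * (k (refl \<alpha> x) * od \<alpha> x))"
      using J_cmult[of 2 "\<lambda>x. k x * od \<alpha> x"] by (simp add: mult.assoc)
    also have "\<dots> = J (\<lambda>x. k x * od \<alpha> x + - 1 * (k (refl \<alpha> x) * od \<alpha> x))"
      by (rule J_add[OF ko ko', symmetric])
    also have "(\<lambda>x. k x * od \<alpha> x + - 1 * (k (refl \<alpha> x) * od \<alpha> x)) =
       (\<lambda>x. dquot \<alpha> k x * complex_of_real ((\<alpha> \<bullet> x)\<^sup>2 / ((\<alpha> \<bullet> x)\<^sup>2 + \<epsilon>\<^sup>2)))"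
    proof
      fix x
      have "k x * od \<alpha> x + - 1 * (k (refl \<alpha> x) * od \<alpha> x) = (k x - k (refl \<alpha> x)) * od \<alpha> x"
        by (simp add: algebra_simps)
      also have "\<dots> = dquot \<alpha> k x * complex_of_real (\<alpha> \<bullet> x) * od \<alpha> x"
        by (simp only: dquot_mult_inner)
      finally show "k x * od \<alpha> x + - 1 * (k (refl \<alpha> x) * od \<alpha> x) =
         dquot \<alpha> k x * complex_of_real ((\<alpha> \<bullet> x)\<^sup>2 / ((\<alpha> \<bullet> x)\<^sup>2 + \<epsilon>\<^sup>2))"
        by (simp add: od_def power2_eq_square)
    qed
    finally show ?thesis .
  qed
  moreover have frac: "gint_ok (\<lambda>x. complex_of_real ((\<alpha> \<bullet> x)\<^sup>2 / ((\<alpha> \<bullet> x)\<^sup>2 + \<epsilon>\<^sup>2)))" for \<alpha>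
  proof -
    have "gint_ok (\<lambda>x. complex_of_real (\<alpha> \<bullet> x) * od \<alpha> x)" using odok by simp
    then show ?thesis by (simp add: od_def power2_eq_square)
  qed
  moreover have "J (\<lambda>x. A x + (\<Sum>\<alpha>\<in>Rp. complex_of_real (\<kappa> \<alpha> * (\<alpha> \<bullet> \<xi>)) *
       (dquot \<alpha> k x * complex_of_real ((\<alpha> \<bullet> x)\<^sup>2 / ((\<alpha> \<bullet> x)\<^sup>2 + \<epsilon>\<^sup>2))))) =
     J A + (\<Sum>\<alpha>\<in>Rp. complex_of_real (\<kappa> \<alpha> * (\<alpha> \<bullet> \<xi>)) *
       J (\<lambda>x. dquot \<alpha> k x * complex_of_real ((\<alpha> \<bullet> x)\<^sup>2 / ((\<alpha> \<bullet> x)\<^sup>2 + \<epsilon>\<^sup>2))))"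
    using k frac Aok by (subst J_add) (auto simp: J_sum J_cmult simp del: of_real_divide)
  ultimately have "J (\<lambda>x. A x + (\<Sum>\<alpha>\<in>Rp. complex_of_real (\<kappa> \<alpha> * (\<alpha> \<bullet> \<xi>)) *
       (dquot \<alpha> k x * complex_of_real ((\<alpha> \<bullet> x)\<^sup>2 / ((\<alpha> \<bullet> x)\<^sup>2 + \<epsilon>\<^sup>2))))) = 0"
    by simp
  then show ?thesis by (simp only: J_def A_def g_def w_def mult.assoc of_real_mult)
qed

text \<open>The limit \<epsilon> -> 0 of \<open>regularised_dunkl_integral\<close>. The ratio
  (\<alpha> . x)^2 / ((\<alpha> . x)^2 + \<epsilon>^2) stays below 1, so one dominating function
  serves for all \<epsilon>, and it tends to 1 off the hyperplane.\<close>

lemma gint_dunkl: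
  assumes k: "tame k"
  shows "gint (\<lambda>x. dunkl \<xi> k x - complex_of_real (\<xi> \<bullet> x) * k x) = 0"
proof -
  define A where "A x = frechet_derivative k (at x) \<xi> - complex_of_real (\<xi> \<bullet> x) * k x" for x
  define c where "c \<alpha> = complex_of_real (\<kappa> \<alpha> * (\<alpha> \<bullet> \<xi>))" for \<alpha>
  define r where "r n \<alpha> x = complex_of_real ((\<alpha> \<bullet> x)\<^sup>2 / ((\<alpha> \<bullet> x)\<^sup>2 + (1 / real (Suc n))\<^sup>2))" for n and \<alpha> x :: "real^'n"
  define b where "b x = norm (A x) + (\<Sum>\<alpha>\<in>Rp. norm (c \<alpha>) * norm (dquot \<alpha> k x))" for x
  define K where "K = (\<Sum>\<alpha>\<in>Rp. 2 * \<kappa> \<alpha> * norm \<alpha>)"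
  have K: "0 \<le> K" unfolding K_def by (intro sum_nonneg) (simp add: \<kappa>_nonneg)
  have Aok: "gint_ok A" unfolding A_def using k by (intro gint_ok_diff gint_ok_mult) auto
  have [measurable]: "A \<in> borel_measurable borel" using Aok by (auto simp: gint_ok_def)
  have [measurable]: "dquot \<alpha> k \<in> borel_measurable borel" for \<alpha> using k by simp
  have [measurable]: "r n \<alpha> \<in> borel_measurable borel" for n \<alpha> unfolding r_def by measurable
  have [measurable]: "b \<in> borel_measurable borel" unfolding b_def by measurable
  have bb: "exp_bounded b"
    unfolding b_def using Aok k nonzero
    by (intro exp_bounded_add exp_bounded_sum exp_bounded_mult exp_bounded_norm) (auto simp: gint_ok_def)
  have eb: "exp_bounded (\<lambda>x::real^'n. complex_of_real (exp (K * norm x)))"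
    by (rule exp_boundedI[of K _ 1]) (use K in auto)
  have bb': "exp_bounded (\<lambda>x. complex_of_real (b x))" using bb by (simp add: exp_bounded_def)
  have "integrable lborel (\<lambda>x. complex_of_real (b x) * complex_of_real (exp (K * norm x)) * complex_of_real (exp (- (norm x)\<^sup>2 / 2)))"
    by (intro integrable_exp_bounded_gauss exp_bounded_mult eb bb') measurable
  then have bi: "integrable lborel (\<lambda>x. b x * exp (K * norm x) * exp (- (norm x)\<^sup>2 / 2))"
    by (simp flip: of_real_mult add: complex_of_real_integrable_eq)
  define s where "s n x = (A x + (\<Sum>\<alpha>\<in>Rp. c \<alpha> * dquot \<alpha> k x * r n \<alpha> x)) *
       complex_of_real (exp (- (norm x)\<^sup>2 / 2) * reg_weight (1 / real (Suc n)) x)" for n x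
  have s0: "(\<integral>x. s n x \<partial>lborel) = 0" for n
    unfolding s_def A_def c_def r_def by (rule regularised_dunkl_integral[OF k]) auto
  define L where "L x = (A x + (\<Sum>\<alpha>\<in>Rp. c \<alpha> * dquot \<alpha> k x)) *
       complex_of_real (exp (- (norm x)\<^sup>2 / 2) * reg_weight 0 x)" for x
  have r1: "norm (r n \<alpha> x) \<le> 1" for n \<alpha> x
  proof -
    have "(\<alpha> \<bullet> x)\<^sup>2 + (1 / real (Suc n))\<^sup>2 > 0" by (intro add_nonneg_pos) auto
    then show ?thesis unfolding r_def norm_of_real by (simp del: of_nat_Suc)
  qed
  have "(\<lambda>n. \<integral>x. s n x \<partial>lborel) \<longlonglongrightarrow> (\<integral>x. L x \<partial>lborel)"
  proof (rule integral_dominated_convergence[OF _ _ bi])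
    show "L \<in> borel_measurable lborel" "s n \<in> borel_measurable lborel" for n
      unfolding L_def s_def by measurable
    show "AE x in lborel. norm (s n x) \<le> b x * exp (K * norm x) * exp (- (norm x)\<^sup>2 / 2)" for n
    proof (rule AE_I2)
      fix x
      have "norm (A x + (\<Sum>\<alpha>\<in>Rp. c \<alpha> * dquot \<alpha> k x * r n \<alpha> x)) \<le>
         norm (A x) + (\<Sum>\<alpha>\<in>Rp. norm (c \<alpha> * dquot \<alpha> k x * r n \<alpha> x))"
        by (rule order_trans[OF norm_triangle_ineq add_left_mono[OF norm_sum]])
      also have "\<dots> \<le> b x" unfolding b_def
        by (intro add_left_mono sum_mono) (use r1 in \<open>auto simp: norm_mult intro!: mult_left_le\<close>)
      finally have 1: "norm (A x + (\<Sum>\<alpha>\<in>Rp. c \<alpha> * dquot \<alpha> k x * r n \<alpha> x)) \<le> b x" .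
      have 2: "reg_weight (1 / real (Suc n)) x \<le> exp (K * norm x)" unfolding K_def by (rule reg_weight_le) auto
      have "norm (s n x) = norm (A x + (\<Sum>\<alpha>\<in>Rp. c \<alpha> * dquot \<alpha> k x * r n \<alpha> x)) *
          reg_weight (1 / real (Suc n)) x * exp (- (norm x)\<^sup>2 / 2)"
        unfolding s_def norm_mult norm_of_real by (simp add: abs_mult)
      also have "\<dots> \<le> b x * exp (K * norm x) * exp (- (norm x)\<^sup>2 / 2)"
        using order_trans[OF norm_ge_zero 1] by (intro mult_right_mono mult_mono 1 2) auto
      finally show "norm (s n x) \<le> b x * exp (K * norm x) * exp (- (norm x)\<^sup>2 / 2)" .
    qed
    show "AE x in lborel. (\<lambda>n. s n x) \<longlonglongrightarrow> L x"
    proof (rule AE_I2)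
      fix x :: "real^'n"
      define e where "e = complex_of_real (exp (- (norm x)\<^sup>2 / 2))"
      have wl: "(\<lambda>n. complex_of_real (reg_weight (1 / real (Suc n)) x)) \<longlonglongrightarrow> complex_of_real (reg_weight 0 x)"
        by (intro tendsto_of_real reg_weight_LIMSEQ)
      have lim: "(\<lambda>n. c \<alpha> * dquot \<alpha> k x * r n \<alpha> x * complex_of_real (reg_weight (1 / real (Suc n)) x))
          \<longlonglongrightarrow> c \<alpha> * dquot \<alpha> k x * complex_of_real (reg_weight 0 x)" if \<alpha>: "\<alpha> \<in> Rp" for \<alpha>
      proof (cases "\<alpha> \<bullet> x = 0")
        case True
        \<comment> \<open>On the hyperplane the ratio is constantly 0 instead of tending to 1. This
          is harmless: either \<kappa> \<alpha> = 0 removes the term, or the weight vanishes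
          there.\<close>
        have "c \<alpha> = 0 \<or> reg_weight 0 x = 0"
          using True \<alpha> finite_Rp by (auto simp: c_def reg_weight_def)
        moreover have "r n \<alpha> x = 0" for n using True by (simp add: r_def)
        ultimately show ?thesis by auto
      next
        case False
        have "(\<lambda>n. r n \<alpha> x) \<longlonglongrightarrow> complex_of_real ((\<alpha> \<bullet> x)\<^sup>2 / ((\<alpha> \<bullet> x)\<^sup>2 + 0\<^sup>2))"
          unfolding r_def using LIMSEQ_inverse_real_of_nat False
          by (intro tendsto_of_real tendsto_intros) (auto simp: inverse_eq_divide)
        then have "(\<lambda>n. r n \<alpha> x) \<longlonglongrightarrow> 1" using False by simp
        from tendsto_mult[OF tendsto_mult[OF tendsto_const this] wl] show ?thesis by simp
      qed
      have "(\<lambda>n. (A x * complex_of_real (reg_weight (1 / real (Suc n)) x) +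
            (\<Sum>\<alpha>\<in>Rp. c \<alpha> * dquot \<alpha> k x * r n \<alpha> x * complex_of_real (reg_weight (1 / real (Suc n)) x))) * e)
          \<longlonglongrightarrow> (A x * complex_of_real (reg_weight 0 x) + (\<Sum>\<alpha>\<in>Rp. c \<alpha> * dquot \<alpha> k x * complex_of_real (reg_weight 0 x))) * e"
        by (intro tendsto_intros wl tendsto_sum lim)
      then show "(\<lambda>n. s n x) \<longlonglongrightarrow> L x"
        unfolding s_def L_def e_def sum_distrib_right[symmetric] of_real_mult
        by (simp only: ring_distribs mult_ac)
    qed
  qed
  then have "(\<integral>x. L x \<partial>lborel) = 0" by (simp add: s0 LIMSEQ_const_iff)
  moreover have "(\<lambda>x. (dunkl \<xi> k x - complex_of_real (\<xi> \<bullet> x) * k x) *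
      complex_of_real (exp (- (norm x)\<^sup>2 / 2) * weight Rp \<kappa> x)) = L"
    by (rule ext) (simp add: L_def A_def c_def dunkl_def reg_weight_0 algebra_simps)
  ultimately show ?thesis by (simp only: gint_def)
qed

lemma frechet_derivative_mult_tame:
  assumes "tame f" "tame g"
  shows "frechet_derivative (\<lambda>x. f x * g x) (at x) \<xi> =
    frechet_derivative f (at x) \<xi> * g x + f x * frechet_derivative g (at x) \<xi>"
  using fun_cong[OF frechet_derivative_at[OF has_derivative_mult[OF tame_has_derivative[OF assms(1)]
    tame_has_derivative[OF assms(2)]], symmetric]] by (simp add: add.commute)

lemma dquot_mult_tame:
  assumes "tame f" "tame g"
  shows "dquot \<alpha> (\<lambda>x. f x * g x) x =
    dquot \<alpha> f x * g x + f x * dquot \<alpha> g x - dquot \<alpha> f x * (g x - g (refl \<alpha> x))"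
  by (auto simp: dquot_def refl_eq_self frechet_derivative_mult_tame[OF assms] divide_simps)
    (simp_all add: algebra_simps)

text \<open>Dunkl operators are not derivations. The correction is arranged so that its second
  factor is odd under the reflection.\<close>

lemma dunkl_mult_tame:
  assumes "tame f" "tame g"
  shows "dunkl \<xi> (\<lambda>x. f x * g x) x = dunkl \<xi> f x * g x + f x * dunkl \<xi> g x
    - (\<Sum>\<alpha>\<in>Rp. complex_of_real (\<kappa> \<alpha> * (\<alpha> \<bullet> \<xi>)) * (dquot \<alpha> f x * (g x - g (refl \<alpha> x))))"
  unfolding dunkl_def frechet_derivative_mult_tame[OF assms] dquot_mult_tame[OF assms]
  by (simp add: algebra_simps sum_distrib_left sum_distrib_right sum.distrib sum_subtractf)

text \<open>Apply \<open>gint_dunkl\<close> to the product. The correction in the product rule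
  integrates to 0, because \<open>dquot \<alpha> f\<close> is even and g minus its reflection is odd
  under a symmetry of the measure.\<close>

lemma gint_dunkl_antisymmetric:
  assumes f: "tame f" and g: "tame g"
  shows "gint (\<lambda>x. (dunkl \<xi> f x - complex_of_real (\<xi> \<bullet> x) * f x) * g x) = - gint (\<lambda>x. f x * dunkl \<xi> g x)"
proof -
  have odd: "gint (\<lambda>x. dquot \<alpha> f x * (g x - g (refl \<alpha> x))) = 0" if \<alpha>: "\<alpha> \<in> Rp" for \<alpha>
  proof -
    have ok: "gint_ok (\<lambda>x. dquot \<alpha> f x * (g x - g (refl \<alpha> x)))"
      using gint_ok_refl[of g \<alpha>] f g \<alpha> by (intro gint_ok_mult gint_ok_diff) auto
    have "gint (\<lambda>x. dquot \<alpha> f x * (g x - g (refl \<alpha> x))) =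
      gint (\<lambda>x. - 1 * (dquot \<alpha> f x * (g x - g (refl \<alpha> x))))"
      using gint_refl[OF \<alpha> ok] by (simp add: dquot_refl[OF nonzero[OF \<alpha>]] algebra_simps)
    then show ?thesis unfolding gint_cmult by simp
  qed
  have ok1: "gint_ok (\<lambda>x. (dunkl \<xi> f x - complex_of_real (\<xi> \<bullet> x) * f x) * g x)"
    using f g by (intro gint_ok_mult gint_ok_diff) auto
  have ok2: "gint_ok (\<lambda>x. f x * dunkl \<xi> g x)" using f g by simp
  have ok3: "gint_ok (\<lambda>x. complex_of_real (\<kappa> \<alpha> * (\<alpha> \<bullet> \<xi>)) * (dquot \<alpha> f x * (g x - g (refl \<alpha> x))))" if "\<alpha> \<in> Rp" for \<alpha>
    using gint_ok_refl[of g \<alpha>] f g that by (intro gint_ok_mult gint_ok_diff) auto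
  have "0 = gint (\<lambda>x. dunkl \<xi> (\<lambda>x. f x * g x) x - complex_of_real (\<xi> \<bullet> x) * (f x * g x))"
    using gint_dunkl[of "\<lambda>x. f x * g x"] f g by simp
  also have "(\<lambda>x. dunkl \<xi> (\<lambda>x. f x * g x) x - complex_of_real (\<xi> \<bullet> x) * (f x * g x)) =
     (\<lambda>x. (dunkl \<xi> f x - complex_of_real (\<xi> \<bullet> x) * f x) * g x + f x * dunkl \<xi> g x -
        (\<Sum>\<alpha>\<in>Rp. complex_of_real (\<kappa> \<alpha> * (\<alpha> \<bullet> \<xi>)) * (dquot \<alpha> f x * (g x - g (refl \<alpha> x)))))"
    by (rule ext) (simp add: dunkl_mult_tame[OF f g] algebra_simps)
  also have "gint \<dots> = gint (\<lambda>x. (dunkl \<xi> f x - complex_of_real (\<xi> \<bullet> x) * f x) * g x) + gint (\<lambda>x. f x * dunkl \<xi> g x)"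
    by (simp only: gint_diff gint_add gint_sum gint_cmult gint_ok_add gint_ok_sum ok1 ok2 ok3 odd
        mult_zero_right sum.neutral_const diff_zero cong: sum.cong)
  finally show ?thesis by (simp add: eq_neg_iff_add_eq_0)
qed

end

section \<open>Growth of the Dunkl kernel\<close>

lemma norm_vec_complex: "(norm (x::complex^'n))\<^sup>2 = (\<Sum>i\<in>UNIV. (Re (x $ i))\<^sup>2 + (Im (x $ i))\<^sup>2)"
  by (simp add: norm_vec_def L2_set_def sum_nonneg cmod_power2)

lemma norm_vector_smult: "norm (c *s (x::complex^'n)) = norm c * norm x"
  by (simp add: norm_vec_def norm_mult L2_set_right_distrib)

lemma norm_mi [simp]: "norm (mi x) = norm x"
  by (simp add: norm_vec_def mi_def norm_mult)

lemma bil_cvec: "bil \<alpha> (cvec x) = complex_of_real (\<alpha> \<bullet> x)"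
  by (simp add: bil_def cvec_def inner_vec_def)

lemma mi_eq: "mi x = (- \<i>) *s cvec x"
  by (simp add: mi_def cvec_def vec_eq_iff)

lemma bil_smult: "bil \<alpha> (c *s x) = c * bil \<alpha> x"
  by (simp add: bil_def sum_distrib_left mult_ac)

lemma bil_mi: "bil \<alpha> (mi x) = - \<i> * complex_of_real (\<alpha> \<bullet> x)"
  by (simp only: mi_eq bil_smult bil_cvec)

lemma linear_mi: "linear mi"
  by (rule linearI) (simp_all add: mi_def vec_eq_iff algebra_simps scaleR_conv_of_real[where 'a=complex])

lemma mi_0 [simp]: "mi 0 = 0"
  by (simp add: mi_def vec_eq_iff)

lemma reflC_mi: "reflC \<alpha> (mi x) = mi (refl \<alpha> x)"
  by (simp add: reflC_def bil_mi refl_def vec_eq_iff)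
    (simp add: mi_def cvec_def inner_commute algebra_simps)

lemma norm_bil_le: "norm (bil y x) \<le> norm y * norm x"
proof -
  have "norm (bil y x) \<le> (\<Sum>i\<in>UNIV. \<bar>norm (y $ i)\<bar> * \<bar>norm (x $ i)\<bar>)"
    unfolding bil_def by (rule sum_norm_le) (simp add: norm_mult)
  also have "\<dots> \<le> L2_set (\<lambda>i. norm (y $ i)) UNIV * L2_set (\<lambda>i. norm (x $ i)) UNIV"
    by (rule L2_set_mult_ineq)
  finally show ?thesis by (simp add: norm_vec_def)
qed

text \<open>\<open>reflC\<close> acts on the real and imaginary parts separately, on each as the
  real reflection.\<close>

lemma norm_reflC [simp]: "norm (reflC \<alpha> x) = norm x"
proof -
  define a b :: "real^'a" where "a = (\<chi> i. Re (x $ i))" and "b = (\<chi> i. Im (x $ i))"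
  have bil: "Re (bil \<alpha> x) = \<alpha> \<bullet> a" "Im (bil \<alpha> x) = \<alpha> \<bullet> b"
    by (simp_all add: bil_def a_def b_def inner_vec_def)
  have "Re (reflC \<alpha> x $ i) = refl \<alpha> a $ i" "Im (reflC \<alpha> x $ i) = refl \<alpha> b $ i" for i
    using bil by (simp_all add: reflC_def refl_def cvec_def inner_commute a_def b_def Re_divide Im_divide
       power2_eq_square Re_divide_of_real Im_divide_of_real flip: of_real_mult)
  then have "(norm (reflC \<alpha> x))\<^sup>2 = (norm (refl \<alpha> a))\<^sup>2 + (norm (refl \<alpha> b))\<^sup>2"
    unfolding norm_vec_complex power2_norm_eq_inner[of "refl \<alpha> a"] power2_norm_eq_inner[of "refl \<alpha> b"]
    by (simp add: inner_vec_def sum.distrib power2_eq_square)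
  also have "\<dots> = (norm x)\<^sup>2"
    unfolding norm_refl norm_vec_complex power2_norm_eq_inner[of a] power2_norm_eq_inner[of b]
    by (simp add: inner_vec_def sum.distrib power2_eq_square a_def b_def)
  finally show ?thesis by simp
qed

locale dunkl_kernel_system = dunkl_system Rp \<kappa> for Rp :: "(real^'n) set" and \<kappa> +
  fixes E :: "complex^'n \<Rightarrow> complex^'n \<Rightarrow> complex"
  assumes kernel: "dunkl_kernel Rp \<kappa> E"
begin

abbreviation Ey' :: "real^'n \<Rightarrow> complex^'n \<Rightarrow> complex^'n \<Rightarrow> complex" where
  "Ey' y x \<equiv> frechet_derivative (\<lambda>u. E u (cvec y)) (at x)"

lemma E_0: "E 0 y = 1"
  using kernel by (simp add: dunkl_kernel_def)

lemma E_has_derivative: "((\<lambda>u. E u (cvec y)) has_derivative Ey' y x) (at x)"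
  and E_derivative_smult: "Ey' y x (c *s u) = c * Ey' y x u"
proof -
  obtain D where D: "((\<lambda>(u, v). E u v) has_derivative D) (at (x, cvec y))"
      and hom: "\<And>c u v. D (c *s u, c *s v) = c * D (u, v)"
    using kernel unfolding dunkl_kernel_def holomorphic2_def by meson
  have "((\<lambda>u. (u, cvec y)) has_derivative (\<lambda>u. (u, 0))) (at x)"
    by (auto intro!: derivative_eq_intros)
  from has_derivative_compose[OF this D]
  have d: "((\<lambda>u. E u (cvec y)) has_derivative (\<lambda>u. D (u, 0))) (at x)" by simp
  then have eq: "Ey' y x = (\<lambda>u. D (u, 0))" by (rule frechet_derivative_at[symmetric])
  show "((\<lambda>u. E u (cvec y)) has_derivative Ey' y x) (at x)" using d eq by simp
  show "Ey' y x (c *s u) = c * Ey' y x u" using hom[of c u 0] by (simp add: eq)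
qed

definition dquotC :: "real^'n \<Rightarrow> (complex^'n \<Rightarrow> complex) \<Rightarrow> complex^'n \<Rightarrow> complex" where
  "dquotC \<alpha> f x = (if bil \<alpha> x = 0 then complex_of_real (2 / (norm \<alpha>)\<^sup>2) * frechet_derivative f (at x) (cvec \<alpha>)
         else (f x - f (reflC \<alpha> x)) / bil \<alpha> x)"

lemma dquotC_mult_bil: "bil \<alpha> x * dquotC \<alpha> f x = f x - f (reflC \<alpha> x)"
  by (auto simp: dquotC_def reflC_def)

text \<open>Complex linearity of the derivative extends the coordinate equations to complex
  directions v. The choice v = x gives the Euler identity, and real v gives the equation for
  \<open>ker\<close>.\<close>

lemma E_eigen:
  "Ey' y x v + (\<Sum>\<alpha>\<in>Rp. complex_of_real (\<kappa> \<alpha>) * bil \<alpha> v * dquotC \<alpha> (\<lambda>u. E u (cvec y)) x)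
     = bil y v * E x (cvec y)"
proof -
  define Q where "Q \<alpha> = dquotC \<alpha> (\<lambda>u. E u (cvec y)) x" for \<alpha>
  have eq: "Ey' y x (axis j 1) + (\<Sum>\<alpha>\<in>Rp. complex_of_real (\<kappa> \<alpha> * \<alpha> $ j) * Q \<alpha>) = complex_of_real (y $ j) * E x (cvec y)" for j
    using kernel by (simp add: dunkl_kernel_def dunkl_opC_def Q_def dquotC_def cvec_def)
  have lin: "linear (Ey' y x)"
    using has_derivative_bounded_linear[OF E_has_derivative] by (rule bounded_linear.linear)
  have "v = (\<Sum>j\<in>UNIV. v $ j *s axis j 1)" by (simp add: basis_expansion)
  then have "Ey' y x v = Ey' y x (\<Sum>j\<in>UNIV. v $ j *s axis j 1)" by simp
  also have "\<dots> = (\<Sum>j\<in>UNIV. v $ j * Ey' y x (axis j 1))"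
    by (simp add: linear_sum[OF lin] E_derivative_smult)
  finally have "Ey' y x v + (\<Sum>\<alpha>\<in>Rp. complex_of_real (\<kappa> \<alpha>) * bil \<alpha> v * Q \<alpha>) =
    (\<Sum>j\<in>UNIV. v $ j * Ey' y x (axis j 1)) + (\<Sum>\<alpha>\<in>Rp. \<Sum>j\<in>UNIV. v $ j * (complex_of_real (\<kappa> \<alpha> * \<alpha> $ j) * Q \<alpha>))"
    by (simp add: bil_def sum_distrib_left sum_distrib_right mult_ac)
  also have "\<dots> = (\<Sum>j\<in>UNIV. v $ j * (Ey' y x (axis j 1) + (\<Sum>\<alpha>\<in>Rp. complex_of_real (\<kappa> \<alpha> * \<alpha> $ j) * Q \<alpha>)))"
    by (subst sum.swap) (simp add: sum.distrib distrib_left sum_distrib_left)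
  also have "\<dots> = bil y v * E x (cvec y)"
    unfolding eq by (simp add: bil_def sum_distrib_left sum_distrib_right mult_ac)
  finally show ?thesis by (simp add: Q_def)
qed

text \<open>In the direction v = x the factor \<open>bil \<alpha> x\<close> cancels the
  denominators, which leaves only values of the kernel at x and its reflections.\<close>

lemma E_euler:
  "Ey' y x x = bil y x * E x (cvec y) - (\<Sum>\<alpha>\<in>Rp. complex_of_real (\<kappa> \<alpha>) * (E x (cvec y) - E (reflC \<alpha> x) (cvec y)))"
  using E_eigen[of y x x] dquotC_mult_bil[of _ x "\<lambda>u. E u (cvec y)"]
  by (simp add: mult.assoc eq_diff_eq)

text \<open>A maximum principle: at a maximum point \<open>x\<^sub>0 \<noteq> 0\<close> of \<open>|E(x, y)| exp (- (|y| + 1) |x|)\<close> on a ball,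
  the Euler identity makes the radial derivative negative, because the reflection terms only help.\<close>

lemma norm_E_le: "norm (E x (cvec y)) \<le> exp ((norm y + 1) * norm x)"
proof -
  define h where "h u = E u (cvec y)" for u
  \<comment> \<open>The surplus 1 over |y| makes the estimate of the radial derivative
    strict.\<close>
  define K where "K = norm y + 1"
  define \<psi> where "\<psi> u = norm (h u) * exp (- K * norm u)" for u
  have hd: "(h has_derivative Ey' y u) (at u)" for u unfolding h_def by (rule E_has_derivative)
  have cont: "continuous_on UNIV h"
    by (intro continuous_at_imp_continuous_on ballI has_derivative_continuous[OF hd])
  have "continuous_on (cball 0 (norm x)) \<psi>"
    unfolding \<psi>_def by (intro continuous_intros continuous_on_subset[OF cont]) auto
  then obtain x0 where x0: "norm x0 \<le> norm x" and max: "\<And>u. norm u \<le> norm x \<Longrightarrow> \<psi> u \<le> \<psi> x0"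
    using continuous_attains_sup[of "cball 0 (norm x)" \<psi>] by auto
  have "x0 = 0"
  proof (rule ccontr)
    assume nz: "x0 \<noteq> 0"
    \<comment> \<open>The normalisation at the origin forces the maximum to be at least 1, so h does
      not vanish at \<open>x0\<close>.\<close>
    have "\<psi> 0 = 1" by (simp add: \<psi>_def h_def E_0)
    with max[of 0] have "\<psi> x0 \<ge> 1" by simp
    then have hnz: "norm (h x0) > 0" by (cases "h x0 = 0") (auto simp: \<psi>_def)
    \<comment> \<open>The square of \<psi> along the ray through \<open>x0\<close>, taken because
      the square is differentiable in s.\<close>
    define m where "m s = (h (s *\<^sub>R x0) \<bullet> h (s *\<^sub>R x0)) * exp (- 2 * K * norm x0 * s)" for s
    define e where "e = exp (- 2 * K * norm x0)"
    have e: "e > 0" by (simp add: e_def)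
    have hs: "((\<lambda>s. h (s *\<^sub>R x0)) has_derivative (\<lambda>t. t *\<^sub>R Ey' y x0 x0)) (at 1)"
    proof -
      have "((\<lambda>s. h (s *\<^sub>R x0)) has_derivative (\<lambda>t. Ey' y (1 *\<^sub>R x0) (t *\<^sub>R x0))) (at 1)"
        by (rule has_derivative_compose[where g=h and f="\<lambda>s. s *\<^sub>R x0" and f'="\<lambda>t. t *\<^sub>R x0"])
          (auto intro!: derivative_eq_intros hd)
      then show ?thesis
        using has_derivative_bounded_linear[OF E_has_derivative] by (simp add: bounded_linear.linear linear_scale)
    qed
    have "(m has_derivative (\<lambda>t. t * (2 * (h x0 \<bullet> Ey' y x0 x0) * e - 2 * K * norm x0 * (h x0 \<bullet> h x0) * e))) (at 1)"
      unfolding m_def by (rule derivative_eq_intros hs refl)+ (auto simp: e_def inner_commute algebra_simps)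
    then have "DERIV m 1 :> 2 * (h x0 \<bullet> Ey' y x0 x0) * e - 2 * K * norm x0 * (h x0 \<bullet> h x0) * e"
      by (simp only: has_field_derivative_def mult_commute_abs)
    moreover have "2 * (h x0 \<bullet> Ey' y x0 x0) * e - 2 * K * norm x0 * (h x0 \<bullet> h x0) * e < 0"
    proof -
      have refl: "h x0 \<bullet> h (reflC \<alpha> x0) \<le> h x0 \<bullet> h x0" for \<alpha>
      proof -
        have "norm (h (reflC \<alpha> x0)) \<le> norm (h x0)"
          using max[of "reflC \<alpha> x0"] x0 by (simp add: \<psi>_def)
        then have "norm (h x0) * norm (h (reflC \<alpha> x0)) \<le> norm (h x0) * norm (h x0)"
          by (intro mult_left_mono) auto
        then show ?thesis
          using norm_cauchy_schwarz[of "h x0" "h (reflC \<alpha> x0)"]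
          by (simp add: power2_norm_eq_inner[symmetric] power2_eq_square)
      qed
      have "h x0 \<bullet> Ey' y x0 x0 = h x0 \<bullet> (bil y x0 * h x0) -
          (\<Sum>\<alpha>\<in>Rp. \<kappa> \<alpha> * (h x0 \<bullet> h x0 - h x0 \<bullet> h (reflC \<alpha> x0)))"
        by (simp add: E_euler h_def inner_diff_right inner_sum_right flip: scaleR_conv_of_real[where 'a=complex])
      also have "\<dots> \<le> h x0 \<bullet> (bil y x0 * h x0)"
        using refl by (simp add: sum_nonneg \<kappa>_nonneg)
      also have "\<dots> \<le> norm (h x0) * (norm (bil y x0) * norm (h x0))"
        using norm_cauchy_schwarz[of "h x0" "bil y x0 * h x0"] by (simp add: norm_mult)
      also have "\<dots> \<le> norm (h x0) * ((norm y * norm x0) * norm (h x0))"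
        by (intro mult_left_mono mult_right_mono norm_bil_le) auto
      also have "\<dots> < K * norm x0 * (norm (h x0) * norm (h x0))"
        using nz hnz by (simp add: K_def algebra_simps)
      also have "\<dots> = K * norm x0 * (h x0 \<bullet> h x0)"
        by (simp add: power2_norm_eq_inner[symmetric] power2_eq_square)
      finally show ?thesis using e by (simp add: algebra_simps)
    qed
    \<comment> \<open>Only points with s < 1 are compared with s = 1, so the argument also covers
      \<open>x0\<close> on the boundary of the ball.\<close>
    ultimately obtain d where d: "d > 0" "\<And>t. 0 < t \<Longrightarrow> t < d \<Longrightarrow> m 1 < m (1 - t)"
      using DERIV_neg_dec_left by blast
    define t where "t = min (d / 2) (1 / 2)"
    have t: "0 < t" "t < d" "t < 1" using d(1) by (auto simp: t_def)
    have meq: "m s = (\<psi> (s *\<^sub>R x0))\<^sup>2" if "0 \<le> s" for s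
      using that unfolding m_def \<psi>_def power_mult_distrib power2_norm_eq_inner
      by (simp add: mult_ac flip: exp_double)
    have "(1 - t) * norm x0 \<le> 1 * norm x" using t x0 by (intro mult_mono) auto
    then have "\<psi> ((1 - t) *\<^sub>R x0) \<le> \<psi> x0" using t by (intro max) auto
    then have "m (1 - t) \<le> m 1"
      using t unfolding meq[of 1, simplified] by (subst meq) (auto intro!: power_mono simp: \<psi>_def)
    with d(2)[OF t(1,2)] show False by simp
  qed
  with max[of x] have "norm (h x) * exp (- K * norm x) \<le> 1" by (simp add: \<psi>_def h_def E_0)
  then have "norm (h x) / exp (K * norm x) \<le> 1" by (simp add: exp_minus divide_inverse)
  then show ?thesis by (simp add: h_def K_def divide_le_eq)
qed

text \<open>Cauchy's inequality on the unit disc of the complex line through x in the normalised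
  direction v. The disc stays in the ball of radius |x| + 1, whence the extra factor exp (|y| +
  1).\<close>

lemma norm_E_derivative_le:
  "norm (Ey' y x v) \<le> exp (norm y + 1) * exp ((norm y + 1) * norm x) * norm v"
proof (cases "v = 0")
  case True
  then show ?thesis using E_derivative_smult[of y x 0 v] by simp
next
  case False
  define v' where "v' = complex_of_real (1 / norm v) *s v"
  have v': "norm v' = 1" using False by (simp add: v'_def norm_vector_smult norm_divide)
  define \<phi> where "\<phi> w = E (x + w *s v') (cvec y)" for w
  have \<phi>d: "(\<phi> has_field_derivative Ey' y (x + w *s v') v') (at w)" for w
  proof -
    have "linear (\<lambda>w. w *s v')"
      by (rule linearI) (simp_all add: vec_eq_iff algebra_simps scaleR_conv_of_real[where 'a=complex])
    then have "((\<lambda>w. w *s v') has_derivative (\<lambda>w. w *s v')) (at w)"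
      by (intro bounded_linear_imp_has_derivative) (simp add: linear_conv_bounded_linear)
    then have "((\<lambda>w. x + w *s v') has_derivative (\<lambda>w. w *s v')) (at w)"
      by (auto intro!: derivative_eq_intros)
    from has_derivative_compose[OF this E_has_derivative]
    show ?thesis unfolding has_field_derivative_def \<phi>_def by (simp only: E_derivative_smult mult_commute_abs)
  qed
  have "norm ((deriv ^^ 1) \<phi> 0) \<le> fact 1 * exp ((norm y + 1) * (norm x + 1)) / 1 ^ 1"
  proof (rule Cauchy_inequality)
    show "\<phi> holomorphic_on ball 0 1"
      using \<phi>d by (auto simp: holomorphic_on_def field_differentiable_def intro: has_field_derivative_at_within)
    show "continuous_on (cball 0 1) \<phi>"
      using \<phi>d by (intro continuous_at_imp_continuous_on ballI DERIV_isCont) auto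
    fix w :: complex assume w: "norm (0 - w) = 1"
    have "norm (x + w *s v') \<le> norm x + 1"
      using norm_triangle_ineq[of x "w *s v'"] w v' by (simp add: norm_vector_smult)
    then have "(norm y + 1) * norm (x + w *s v') \<le> (norm y + 1) * (norm x + 1)" by (intro mult_left_mono) auto
    then show "norm (\<phi> w) \<le> exp ((norm y + 1) * (norm x + 1))"
      unfolding \<phi>_def using norm_E_le[of "x + w *s v'" y] by (meson exp_le_cancel_iff order_trans)
  qed simp
  then have "norm (Ey' y x v') \<le> exp ((norm y + 1) * (norm x + 1))"
    using DERIV_imp_deriv[OF \<phi>d[of 0]] by simp
  moreover have "Ey' y x v' = complex_of_real (1 / norm v) * Ey' y x v"
    unfolding v'_def by (rule E_derivative_smult)
  ultimately show ?thesis using False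
    by (simp add: norm_mult norm_divide field_simps exp_add[symmetric])
qed

section \<open>The kernel of the Dunkl transform as a function on real space\<close>

definition ker :: "real^'n \<Rightarrow> real^'n \<Rightarrow> complex" where
  "ker y x = E (mi x) (cvec y)"

lemma ker_0 [simp]: "ker y 0 = 1"
  by (simp add: ker_def E_0)

lemma ker_has_derivative: "(ker y has_derivative (\<lambda>u. Ey' y (mi x) (mi u))) (at x)"
  unfolding ker_def[abs_def]
  by (rule has_derivative_compose[OF _ E_has_derivative])
    (intro bounded_linear_imp_has_derivative linear_mi[unfolded linear_conv_bounded_linear])

lemma ker_frechet: "frechet_derivative (ker y) (at x) = (\<lambda>u. Ey' y (mi x) (mi u))"
  by (rule frechet_derivative_at[OF ker_has_derivative, symmetric])

lemma tame_ker [simp]: "tame (ker y)"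
proof (rule tameI[OF ker_has_derivative])
  show "exp_bounded (ker y)"
    by (rule exp_boundedI[of "norm y + 1" _ 1]) (use norm_E_le[of "mi _" y] in \<open>auto simp: ker_def\<close>)
  show "norm (Ey' y (mi x) (mi u)) \<le> exp (norm y + 1) * exp ((norm y + 1) * norm x) * norm u" for x u
    using norm_E_derivative_le[of y "mi x" "mi u"] by simp
qed auto

text \<open>\<open>mi\<close> is multiplication by -i, so the derivative contributes a factor -i by
  complex linearity. The quotients contribute the same factor, since
  \<open>bil \<alpha> (mi x)\<close> is -i (\<alpha> . x).\<close>

lemma dunkl_ker: "dunkl \<xi> (ker y) x = - \<i> * complex_of_real (y \<bullet> \<xi>) * ker y x"
proof -
  have mi: "Ey' y (mi x) (mi u) = - \<i> * Ey' y (mi x) (cvec u)" for u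
    by (simp only: mi_eq[of u] E_derivative_smult)
  have "dquot \<alpha> (ker y) x = - \<i> * dquotC \<alpha> (\<lambda>u. E u (cvec y)) (mi x)" for \<alpha>
    by (auto simp: dquot_def dquotC_def bil_mi ker_frechet reflC_mi mi ker_def
        field_simps)
  then have "dunkl \<xi> (ker y) x = - \<i> * (Ey' y (mi x) (cvec \<xi>) +
     (\<Sum>\<alpha>\<in>Rp. complex_of_real (\<kappa> \<alpha>) * bil \<alpha> (cvec \<xi>) * dquotC \<alpha> (\<lambda>u. E u (cvec y)) (mi x)))"
    unfolding dunkl_def ker_frechet mi
    by (simp add: bil_cvec distrib_left sum_distrib_left mult_ac sum_negf)
  then show ?thesis unfolding E_eigen by (simp add: bil_cvec ker_def mult.assoc)
qed

lemma ker_euler: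
  "frechet_derivative (ker y) (at x) x =
     - \<i> * complex_of_real (y \<bullet> x) * ker y x - (\<Sum>\<alpha>\<in>Rp. complex_of_real (\<kappa> \<alpha>) * (ker y x - ker y (refl \<alpha> x)))"
  unfolding ker_frechet E_euler by (simp add: bil_mi ker_def reflC_mi)

end

section \<open>Dunkl operators on polynomials\<close>

text \<open>Polynomial functions of degree at most \<open>n\<close>.\<close>

inductive polyf :: "nat \<Rightarrow> (real^'n \<Rightarrow> complex) \<Rightarrow> bool" where
  const: "polyf n (\<lambda>x. c)"
| add: "polyf n p \<Longrightarrow> polyf n r \<Longrightarrow> polyf n (\<lambda>x. p x + r x)"
| mul: "polyf n p \<Longrightarrow> polyf (Suc n) (\<lambda>x. complex_of_real (u \<bullet> x) * p x)"

lemma polyf_cmult: "polyf n p \<Longrightarrow> polyf n (\<lambda>x. c * p x)"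
proof (induction rule: polyf.induct)
  case (const n d)
  show ?case by (rule polyf.const)
next
  case (add n p r)
  then show ?case unfolding distrib_left by (intro polyf.add)
next
  case (mul n p u)
  have "(\<lambda>x. c * (complex_of_real (u \<bullet> x) * p x)) = (\<lambda>x. complex_of_real (u \<bullet> x) * (c * p x))"
    by (simp add: mult_ac)
  then show ?case using polyf.mul[OF mul.IH] by simp
qed

lemma polyf_Suc: "polyf n p \<Longrightarrow> polyf (Suc n) p"
  by (induction rule: polyf.induct) (auto intro: polyf.intros)

lemma polyf_mono: "polyf n p \<Longrightarrow> n \<le> m \<Longrightarrow> polyf m p"
  by (rule dec_induct[of n m]) (auto intro: polyf_Suc)

lemma polyf_sum: "(\<And>i. i \<in> S \<Longrightarrow> polyf n (f i)) \<Longrightarrow> polyf n (\<lambda>x. \<Sum>i\<in>S. f i x)"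
  by (induction S rule: infinite_finite_induct) (auto intro: polyf.intros)

lemma polyf_diff: "polyf n p \<Longrightarrow> polyf n r \<Longrightarrow> polyf n (\<lambda>x. p x - r x)"
  using polyf.add[OF _ polyf_cmult[of n r "-1"], of p] by simp

lemma polyf_tame [simp]: "polyf n p \<Longrightarrow> tame p"
  by (induction rule: polyf.induct) auto

lemma polyf_refl: "polyf n p \<Longrightarrow> polyf n (\<lambda>x. p (refl \<beta> x))"
proof (induction rule: polyf.induct)
  case (mul n p u)
  show ?case using polyf.mul[OF mul.IH, of "refl \<beta> u"] by (simp add: inner_refl_left)
qed (auto intro: polyf.intros)

text \<open>In the product step the recursion of \<open>q\<close> calls for
  \<open>dunkl u p\<close>, which is not built from p by the introduction rules but has degree at
  most n. The hypothesis is therefore offered for all polynomials of degree at most n.\<close>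

lemma polyf_strong_induct [consumes 1, case_names const add mul]:
  assumes "polyf n p"
    and c: "\<And>n c. P n (\<lambda>x. c)"
    and a: "\<And>n p r. polyf n p \<Longrightarrow> polyf n r \<Longrightarrow> P n p \<Longrightarrow> P n r \<Longrightarrow> P n (\<lambda>x. p x + r x)"
    and m: "\<And>n p u. polyf n p \<Longrightarrow> (\<And>s. polyf n s \<Longrightarrow> P n s) \<Longrightarrow> P (Suc n) (\<lambda>x. complex_of_real (u \<bullet> x) * p x)"
  shows "P n p"
  using assms(1)
proof (induction n arbitrary: p rule: less_induct)
  case (less n)
  have "polyf n p \<Longrightarrow> (\<forall>m<n. \<forall>s. polyf m s \<longrightarrow> P m s) \<longrightarrow> P n p"
    by (induction rule: polyf.induct) (auto intro: c a m)
  with less show ?case by blast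
qed

lemma tame_diff [simp]: "tame f \<Longrightarrow> tame g \<Longrightarrow> tame (\<lambda>x. f x - g x)"
  using tame_add[of f "\<lambda>x. - 1 * g x"] tame_mult[OF tame_const[of "- 1"], of g] by simp

lemma tame_refl: "tame f \<Longrightarrow> tame (\<lambda>x. f (refl \<beta> x))"
  by (rule tame_compose_linear[OF _ linear_refl])

lemma tame_frechet_linear: "tame f \<Longrightarrow> linear (frechet_derivative f (at x))"
  using has_derivative_bounded_linear[OF tame_has_derivative] bounded_linear.linear by blast

lemma frechet_compose_linear:
  fixes T :: "'a::euclidean_space \<Rightarrow> 'a"
  assumes "tame f" "linear T"
  shows "frechet_derivative (\<lambda>x. f (T x)) (at x) u = frechet_derivative f (at (T x)) (T u)"
proof -
  have "((\<lambda>x. f (T x)) has_derivative (\<lambda>u. frechet_derivative f (at (T x)) (T u))) (at x)"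
    using assms(2) by (intro has_derivative_compose[OF bounded_linear_imp_has_derivative tame_has_derivative[OF assms(1)]])
      (simp add: linear_conv_bounded_linear)
  from fun_cong[OF frechet_derivative_at[OF this, symmetric]] show ?thesis .
qed

lemma frechet_inner: "frechet_derivative (\<lambda>x. complex_of_real (u \<bullet> x)) (at x) = (\<lambda>v. complex_of_real (u \<bullet> v))"
  by (rule frechet_derivative_at[symmetric]) (auto intro!: derivative_eq_intros)

lemma frechet_add:
  assumes "tame f" "tame g"
  shows "frechet_derivative (\<lambda>x. f x + g x) (at x) = (\<lambda>v. frechet_derivative f (at x) v + frechet_derivative g (at x) v)"
  by (rule frechet_derivative_at[symmetric]) (intro has_derivative_add tame_has_derivative assms)

lemma frechet_cmult:
  assumes "tame f"
  shows "frechet_derivative (\<lambda>x. c * f x) (at x) = (\<lambda>v. c * frechet_derivative f (at x) v)"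
  by (rule frechet_derivative_at[symmetric]) (intro has_derivative_mult_right tame_has_derivative assms)

lemma dquot_inner:
  assumes "\<alpha> \<noteq> 0"
  shows "dquot \<alpha> (\<lambda>x. complex_of_real (u \<bullet> x)) x = complex_of_real (2 * (\<alpha> \<bullet> u) / (norm \<alpha>)\<^sup>2)"
proof -
  have rf: "u \<bullet> refl \<alpha> x = u \<bullet> x - 2 * (\<alpha> \<bullet> x) * (\<alpha> \<bullet> u) / (norm \<alpha>)\<^sup>2"
    by (simp add: refl_def inner_simps inner_commute)
  show ?thesis using assms by (auto simp: dquot_def frechet_inner rf inner_commute[of u \<alpha>] field_simps)
qed

lemma dquot_const: "dquot \<alpha> (\<lambda>x. c) x = 0"
  by (auto simp: dquot_def)

lemma dquot_minus:
  assumes "tame f"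
  shows "dquot (- \<alpha>) f x = - dquot \<alpha> f x"
  by (auto simp: dquot_def refl_minus_root linear_neg[OF tame_frechet_linear[OF assms]])

lemma dquot_compose_refl:
  assumes "tame f"
  shows "dquot \<alpha> (\<lambda>x. f (refl \<beta> x)) x = dquot (refl \<beta> \<alpha>) f (refl \<beta> x)"
proof -
  have "refl \<beta> \<alpha> \<bullet> refl \<beta> x = \<alpha> \<bullet> x" by (simp add: inner_refl_left)
  then show ?thesis
    by (simp add: dquot_def frechet_compose_linear[OF assms linear_refl] refl_conjugate)
qed

section \<open>Linearity, commutators and equivariance of Dunkl operators\<close>

context dunkl_system
begin

lemma dunkl_const [simp]: "dunkl \<xi> (\<lambda>x. c) = (\<lambda>x. 0)"
  by (rule ext) (simp add: dunkl_def dquot_const)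

lemma dunkl_add: "tame f \<Longrightarrow> tame g \<Longrightarrow> dunkl \<xi> (\<lambda>x. f x + g x) = (\<lambda>x. dunkl \<xi> f x + dunkl \<xi> g x)"
proof (rule ext)
  fix x assume t: "tame f" "tame g"
  have "dquot \<alpha> (\<lambda>x. f x + g x) x = dquot \<alpha> f x + dquot \<alpha> g x" for \<alpha>
    using t by (simp add: dquot_def frechet_add distrib_left add_divide_distrib diff_divide_distrib)
  then show "dunkl \<xi> (\<lambda>x. f x + g x) x = dunkl \<xi> f x + dunkl \<xi> g x"
    using t by (simp add: dunkl_def frechet_add distrib_left sum.distrib)
qed

lemma dunkl_cmult: "tame f \<Longrightarrow> dunkl \<xi> (\<lambda>x. c * f x) = (\<lambda>x. c * dunkl \<xi> f x)"
proof (rule ext)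
  fix x assume t: "tame f"
  have "dquot \<alpha> (\<lambda>x. c * f x) x = c * dquot \<alpha> f x" for \<alpha>
    using t by (simp add: dquot_def frechet_cmult diff_divide_distrib algebra_simps)
  then show "dunkl \<xi> (\<lambda>x. c * f x) x = c * dunkl \<xi> f x"
    using t by (simp add: dunkl_def frechet_cmult distrib_left sum_distrib_left mult_ac)
qed

lemma dunkl_uminus_direction: "tame f \<Longrightarrow> dunkl (- \<xi>) f = (\<lambda>x. - 1 * dunkl \<xi> f x)"
  by (rule ext) (simp add: dunkl_def linear_neg[OF tame_frechet_linear] sum_negf)

text \<open>The reflection part of the commutator of the Dunkl operator in direction \<xi> with
  multiplication by <u, x>. Its symmetry in \<xi> and u is what later makes the operators commute
  under \<open>q\<close>.\<close>

definition refl_term :: "real^'n \<Rightarrow> real^'n \<Rightarrow> (real^'n \<Rightarrow> complex) \<Rightarrow> real^'n \<Rightarrow> complex" where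
  "refl_term \<xi> u p x = (\<Sum>\<alpha>\<in>Rp. complex_of_real (\<kappa> \<alpha> * (\<alpha> \<bullet> \<xi>) * (2 * (\<alpha> \<bullet> u) / (norm \<alpha>)\<^sup>2)) * p (refl \<alpha> x))"

lemma refl_term_commute: "refl_term \<xi> u p = refl_term u \<xi> p"
  by (rule ext) (simp add: refl_term_def mult_ac)

lemma polyf_refl_term: "polyf n p \<Longrightarrow> polyf n (refl_term \<xi> u p)"
  unfolding refl_term_def[abs_def] by (intro polyf_sum polyf_cmult polyf_refl)

text \<open>The reflection quotient of a linear form is a constant. In the product rule it
  multiplies p and then minus (p - p composed with the reflection), so only the reflected p
  survives.\<close>

lemma dunkl_inner_mult:
  assumes "tame p"
  shows "dunkl \<xi> (\<lambda>x. complex_of_real (u \<bullet> x) * p x) =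
    (\<lambda>x. complex_of_real (u \<bullet> x) * dunkl \<xi> p x + complex_of_real (u \<bullet> \<xi>) * p x + refl_term \<xi> u p x)"
proof (rule ext)
  fix x
  have "(\<Sum>\<alpha>\<in>Rp. complex_of_real (\<kappa> \<alpha> * (\<alpha> \<bullet> \<xi>)) * dquot \<alpha> (\<lambda>x. complex_of_real (u \<bullet> x)) x) * p x
     - (\<Sum>\<alpha>\<in>Rp. complex_of_real (\<kappa> \<alpha> * (\<alpha> \<bullet> \<xi>)) * (dquot \<alpha> (\<lambda>x. complex_of_real (u \<bullet> x)) x * (p x - p (refl \<alpha> x))))
     = refl_term \<xi> u p x"
    unfolding sum_distrib_right sum_subtractf[symmetric] refl_term_def
    by (rule sum.cong) (simp_all add: dquot_inner[OF nonzero] algebra_simps diff_divide_distrib)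
  then show "dunkl \<xi> (\<lambda>x. complex_of_real (u \<bullet> x) * p x) x =
    complex_of_real (u \<bullet> x) * dunkl \<xi> p x + complex_of_real (u \<bullet> \<xi>) * p x + refl_term \<xi> u p x"
    unfolding dunkl_mult_tame[OF tame_inner assms] dunkl_def[of \<xi> "\<lambda>x. complex_of_real (u \<bullet> x)"] frechet_inner
    by (simp add: algebra_simps)
qed

text \<open>Truncated subtraction hides the drop in degree at n = 0, so the vanishing on constants
  is carried along; the product step needs it when p is constant.\<close>

lemma polyf_dunkl_aux: "polyf n p \<Longrightarrow> polyf (n - 1) (dunkl \<xi> p) \<and> (n = 0 \<longrightarrow> dunkl \<xi> p = (\<lambda>x. 0))"
proof (induction rule: polyf.induct)
  case (const n c)
  then show ?case by (simp add: polyf.const)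
next
  case (add n p r)
  then show ?case by (simp add: dunkl_add polyf.add)
next
  case (mul n p u)
  have "polyf n (\<lambda>x. complex_of_real (u \<bullet> x) * dunkl \<xi> p x)"
  proof (cases n)
    case 0
    then show ?thesis using mul.IH by (simp add: polyf.const)
  next
    case (Suc m)
    then show ?thesis using mul.IH by (simp add: polyf.mul)
  qed
  then show ?case
    using mul.hyps by (simp add: dunkl_inner_mult polyf.add polyf_cmult polyf_refl_term)
qed

lemma polyf_dunkl: "polyf n p \<Longrightarrow> polyf n (dunkl \<xi> p)"
  using polyf_dunkl_aux[of n p \<xi>] polyf_mono[of "n - 1" _ n] by auto

lemma polyf_dunkl_Suc: "polyf (Suc n) p \<Longrightarrow> polyf n (dunkl \<xi> p)"
  using polyf_dunkl_aux[of "Suc n" p \<xi>] by auto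

lemma dunkl_polyf_0: "polyf 0 p \<Longrightarrow> dunkl \<xi> p = (\<lambda>x. 0)"
  using polyf_dunkl_aux[of 0 p \<xi>] by auto

text \<open>Reindex the roots by \<open>perm\<close>. The undetermined sign of \<pi> \<alpha>
  cancels, since the coefficient and the quotient are both odd in the root.\<close>

lemma dunkl_refl:
  assumes p: "tame p" and \<beta>: "\<beta> \<in> Rp"
  shows "dunkl (refl \<beta> u) (\<lambda>x. p (refl \<beta> x)) = (\<lambda>x. dunkl u p (refl \<beta> x))"
proof (rule ext)
  fix x
  from perm[OF \<beta>] obtain \<pi> where \<pi>: "bij_betw \<pi> Rp Rp"
    "\<And>\<alpha>. \<alpha> \<in> Rp \<Longrightarrow> \<kappa> (\<pi> \<alpha>) = \<kappa> \<alpha> \<and> (\<pi> \<alpha> = refl \<beta> \<alpha> \<or> \<pi> \<alpha> = - refl \<beta> \<alpha>)" by blast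
  have "(\<Sum>\<alpha>\<in>Rp. complex_of_real (\<kappa> \<alpha> * (\<alpha> \<bullet> u)) * dquot \<alpha> p (refl \<beta> x)) =
     (\<Sum>\<alpha>\<in>Rp. complex_of_real (\<kappa> (\<pi> \<alpha>) * (\<pi> \<alpha> \<bullet> u)) * dquot (\<pi> \<alpha>) p (refl \<beta> x))"
    by (rule sum.reindex_bij_betw[OF \<pi>(1), symmetric])
  also have "\<dots> = (\<Sum>\<alpha>\<in>Rp. complex_of_real (\<kappa> \<alpha> * (\<alpha> \<bullet> refl \<beta> u)) * dquot \<alpha> (\<lambda>x. p (refl \<beta> x)) x)"
  proof (rule sum.cong)
    fix \<alpha> assume "\<alpha> \<in> Rp"
    from \<pi>(2)[OF this] show "complex_of_real (\<kappa> (\<pi> \<alpha>) * (\<pi> \<alpha> \<bullet> u)) * dquot (\<pi> \<alpha>) p (refl \<beta> x) =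
      complex_of_real (\<kappa> \<alpha> * (\<alpha> \<bullet> refl \<beta> u)) * dquot \<alpha> (\<lambda>x. p (refl \<beta> x)) x"
      by (auto simp: dquot_compose_refl[OF p] dquot_minus[OF p] inner_refl_left)
  qed simp
  finally show "dunkl (refl \<beta> u) (\<lambda>x. p (refl \<beta> x)) x = dunkl u p (refl \<beta> x)"
    by (simp add: dunkl_def frechet_compose_linear[OF p linear_refl])
qed

lemma dunkl_scale:
  assumes k: "tame k" and s: "s \<noteq> 0"
  shows "dunkl \<xi> (\<lambda>x. k (s *\<^sub>R x)) x = complex_of_real s * dunkl \<xi> k (s *\<^sub>R x)"
proof -
  have fr: "frechet_derivative (\<lambda>x. k (s *\<^sub>R x)) (at x) u = complex_of_real s * frechet_derivative k (at (s *\<^sub>R x)) u" for u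
    by (subst frechet_compose_linear[OF k]) (auto simp: linear_scale[OF tame_frechet_linear[OF k]] scaleR_conv_of_real[where 'a=complex]
        intro: linear_scaleR)
  have "dquot \<alpha> (\<lambda>x. k (s *\<^sub>R x)) x = complex_of_real s * dquot \<alpha> k (s *\<^sub>R x)" for \<alpha>
    using s by (simp add: dquot_def fr linear_scale[OF linear_refl])
  then show ?thesis by (simp add: dunkl_def fr distrib_left sum_distrib_left mult_ac)
qed

section \<open>Limits and derivatives under the weighted Gaussian integral\<close>

lemma gint_dominated_convergence:
  assumes f: "\<And>n. gint_ok (f n)" and D: "gint_ok (\<lambda>x. complex_of_real (D x))"
    and bound: "\<And>n x. norm (f n x) \<le> D x" and lim: "\<And>x. (\<lambda>n. f n x) \<longlonglongrightarrow> g x"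
  shows "(\<lambda>n. gint (f n)) \<longlonglongrightarrow> gint g"
  unfolding gint_def
proof (rule integral_dominated_convergence)
  let ?g = "\<lambda>x. complex_of_real (exp (- (norm x)\<^sup>2 / 2) * weight Rp \<kappa> x)"
  have fm[measurable]: "f n \<in> borel_measurable borel" for n using f by (simp add: gint_ok_def)
  have [measurable]: "g \<in> borel_measurable borel" by (rule borel_measurable_LIMSEQ_metric[OF fm lim])
  have "0 \<le> D x" for x using order_trans[OF norm_ge_zero bound] .
  then show "integrable lborel (\<lambda>x. D x * (exp (- (norm x)\<^sup>2 / 2) * weight Rp \<kappa> x))"
    using integrable_norm[OF gint_ok_integrable[OF D]] by (simp add: norm_mult abs_mult)
  show "AE x in lborel. (\<lambda>n. f n x * ?g x) \<longlonglongrightarrow> g x * ?g x"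
    by (intro AE_I2 tendsto_mult lim tendsto_const)
  show "AE x in lborel. norm (f n x * ?g x) \<le> D x * (exp (- (norm x)\<^sup>2 / 2) * weight Rp \<kappa> x)" for n
    using bound by (intro AE_I2) (simp add: norm_mult abs_mult mult_right_mono)
  show "(\<lambda>x. g x * ?g x) \<in> borel_measurable lborel" "(\<lambda>x. f n x * ?g x) \<in> borel_measurable lborel" for n
    by measurable
qed

text \<open>The slopes converge pointwise and, along a sequence in [-B, B], are dominated by C exp
  (a B |x|) |x| through the mean value inequality.\<close>

lemma gint_scale_has_vector_derivative:
  assumes k: "tame k"
  shows "((\<lambda>s. gint (\<lambda>x. k (s *\<^sub>R x))) has_vector_derivative
     gint (\<lambda>x. frechet_derivative k (at (s *\<^sub>R x)) x)) (at s)"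
proof -
  let ?k' = "\<lambda>x. frechet_derivative k (at x)"
  from k obtain C a where b: "0 \<le> C" "0 \<le> a" "\<And>x u. norm (?k' x u) \<le> C * exp (a * norm x) * norm u"
    by (rule tame_derivative_bound) blast
  have kd: "((\<lambda>r. k (r *\<^sub>R x)) has_vector_derivative ?k' (r *\<^sub>R x) x) (at r)" for x r
  proof -
    have "((\<lambda>r. k (r *\<^sub>R x)) has_derivative (\<lambda>t. ?k' (r *\<^sub>R x) (t *\<^sub>R x))) (at r)"
      by (rule has_derivative_compose[where g=k and f="\<lambda>r. r *\<^sub>R x" and f'="\<lambda>t. t *\<^sub>R x"])
        (auto intro!: derivative_eq_intros tame_has_derivative k)
    then show ?thesis by (simp add: has_vector_derivative_def linear_scale[OF tame_frechet_linear[OF k]])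
  qed
  have ks: "tame (\<lambda>x. k (r *\<^sub>R x))" for r
    by (rule tame_compose_linear[OF k]) (rule linear_scaleR)
  have "((\<lambda>r. (gint (\<lambda>x. k (r *\<^sub>R x)) - gint (\<lambda>x. k (s *\<^sub>R x))) /\<^sub>R (r - s)) \<longlongrightarrow> gint (\<lambda>x. ?k' (s *\<^sub>R x) x)) (at s)"
    unfolding tendsto_at_iff_sequentially comp_def
  proof (intro allI impI)
    fix X :: "nat \<Rightarrow> real" assume X: "\<forall>i. X i \<in> UNIV - {s}" "X \<longlonglongrightarrow> s"
    have Xs: "X i \<noteq> s" for i using X(1) by auto
    obtain B where B: "\<And>n. \<bar>X n\<bar> \<le> B"
      using X(2) by (metis convergentI convergent_imp_bounded bounded_iff rangeI real_norm_def)
    have "\<bar>s\<bar> \<le> B"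
      by (rule tendsto_upperbound[OF tendsto_rabs[OF X(2)]]) (auto simp: B)
    have B0: "0 \<le> B" using \<open>\<bar>s\<bar> \<le> B\<close> by linarith
    define d where "d n x = (k (X n *\<^sub>R x) - k (s *\<^sub>R x)) /\<^sub>R (X n - s)" for n x
    have dt: "tame (d n)" for n
      unfolding d_def scaleR_conv_of_real[where 'a=complex] using ks by (intro tame_mult tame_diff tame_const) auto
    have eq: "(gint (\<lambda>x. k (X n *\<^sub>R x)) - gint (\<lambda>x. k (s *\<^sub>R x))) /\<^sub>R (X n - s) = gint (d n)" for n
      unfolding d_def scaleR_conv_of_real[where 'a=complex] gint_cmult using ks by (simp add: gint_diff)
    have dlim: "(\<lambda>n. d n x) \<longlonglongrightarrow> ?k' (s *\<^sub>R x) x" for x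
    proof -
      have "((\<lambda>r. (k (r *\<^sub>R x) - k (s *\<^sub>R x)) /\<^sub>R (r - s)) \<longlongrightarrow> ?k' (s *\<^sub>R x) x) (at s)"
        using kd[where x=x and r=s] by (simp add: has_vector_derivative_at_iff_slope)
      then show ?thesis unfolding d_def
        by (rule filterlim_compose) (use X Xs in \<open>auto simp: filterlim_at\<close>)
    qed
    define D where "D x = C * exp (a * B * norm x) * norm x" for x :: "real^'n"
    have db: "norm (d n x) \<le> D x" for n x
    proof -
      have "norm (k (X n *\<^sub>R x) - k (s *\<^sub>R x)) \<le> D x * norm (X n - s)"
      proof (rule differentiable_bound[where S="{-B..B}" and f="\<lambda>r. k (r *\<^sub>R x)" and f'="\<lambda>r h. h *\<^sub>R ?k' (r *\<^sub>R x) x"])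
        fix r assume r: "r \<in> {-B..B}"
        show "((\<lambda>r. k (r *\<^sub>R x)) has_derivative (\<lambda>h. h *\<^sub>R ?k' (r *\<^sub>R x) x)) (at r within {-B..B})"
          using kd by (simp add: has_vector_derivative_def has_derivative_at_withinI)
        have "a * norm (r *\<^sub>R x) \<le> a * B * norm x"
          using r b by (auto simp: mult.assoc intro!: mult_left_mono mult_right_mono)
        then have "C * exp (a * norm (r *\<^sub>R x)) * norm x \<le> D x"
          unfolding D_def using b by (intro mult_right_mono mult_left_mono) auto
        then have "norm (?k' (r *\<^sub>R x) x) \<le> D x" using b(3)[of "r *\<^sub>R x" x] by linarith
        then show "onorm (\<lambda>h. h *\<^sub>R ?k' (r *\<^sub>R x) x) \<le> D x"
          by (intro onorm_le) (auto simp: mult.commute[of "D x"] intro: mult_left_mono)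
      qed (use B \<open>\<bar>s\<bar> \<le> B\<close> in \<open>auto simp: abs_le_iff minus_le_iff\<close>)
      moreover have "norm (d n x) = norm (k (X n *\<^sub>R x) - k (s *\<^sub>R x)) / norm (X n - s)"
        by (simp add: d_def divide_inverse_commute)
      ultimately show ?thesis using Xs[of n] by (simp add: divide_le_eq)
    qed
    have "exp_bounded (\<lambda>x::real^'n. complex_of_real (exp (a * B * norm x)))"
      by (rule exp_boundedI[of "a * B" _ 1]) (use b B0 in auto)
    moreover have "exp_bounded (\<lambda>x::real^'n. complex_of_real (norm x))"
      by (rule exp_boundedI[of 1 _ 1]) (use norm_le_exp_norm in auto)
    ultimately have "gint_ok (\<lambda>x. complex_of_real (D x))"
      unfolding D_def gint_ok_def of_real_mult by (intro conjI exp_bounded_mult exp_bounded_const) auto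
    from gint_dominated_convergence[OF _ this db dlim]
    have "(\<lambda>n. gint (d n)) \<longlonglongrightarrow> gint (\<lambda>x. ?k' (s *\<^sub>R x) x)" using dt by simp
    then show "(\<lambda>n. (gint (\<lambda>x. k (X n *\<^sub>R x)) - gint (\<lambda>x. k (s *\<^sub>R x))) /\<^sub>R (X n - s)) \<longlonglongrightarrow> gint (\<lambda>x. ?k' (s *\<^sub>R x) x)"
      by (simp only: eq)
  qed
  then show ?thesis by (simp add: has_vector_derivative_at_iff_slope)
qed

end

section \<open>The normalised transform of polynomials times the Gaussian\<close>

context dunkl_kernel_system
begin

abbreviation c\<^sub>\<kappa> :: complex where "c\<^sub>\<kappa> \<equiv> complex_of_real (cconst Rp \<kappa>)"

lemma gint_1: "gint (\<lambda>x. 1) = c\<^sub>\<kappa>"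
  by (simp add: gint_def cconst_def del: of_real_mult)

text \<open>\<open>q p\<close> is the Dunkl transform of \<open>p\<close> times the Gaussian, divided by the Gaussian.\<close>

definition q :: "(real^'n \<Rightarrow> complex) \<Rightarrow> real^'n \<Rightarrow> complex" where
  "q p y = complex_of_real (exp ((norm y)\<^sup>2 / 2)) / c\<^sub>\<kappa> * gint (\<lambda>x. ker y x * p x)"

lemma q_add: "gint_ok f \<Longrightarrow> gint_ok g \<Longrightarrow> q (\<lambda>x. f x + g x) y = q f y + q g y"
  by (simp add: q_def distrib_left gint_add)

lemma q_cmult: "q (\<lambda>x. c * f x) y = c * q f y"
  using gint_cmult[of c "\<lambda>x. ker y x * f x"] by (simp add: q_def mult_ac)

lemma q_sum: "(\<And>i. i \<in> S \<Longrightarrow> gint_ok (f i)) \<Longrightarrow> q (\<lambda>x. \<Sum>i\<in>S. f i x) y = (\<Sum>i\<in>S. q (f i) y)"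
  by (simp add: q_def sum_distrib_left gint_sum)

lemma q_inner_mult:
  assumes "tame p"
  shows "q (\<lambda>x. complex_of_real (u \<bullet> x) * p x) y = q (dunkl u p) y - \<i> * complex_of_real (y \<bullet> u) * q p y"
proof -
  have ok: "gint_ok (\<lambda>x. ker y x * (complex_of_real (u \<bullet> x) * p x))" "gint_ok (\<lambda>x. ker y x * dunkl u p x)"
    using assms by auto
  have "gint (\<lambda>x. ker y x * dunkl u p x - ker y x * (complex_of_real (u \<bullet> x) * p x)) =
     \<i> * complex_of_real (y \<bullet> u) * gint (\<lambda>x. ker y x * p x)"
    using gint_dunkl_antisymmetric[OF assms tame_ker, of u y]
      gint_cmult[of "- \<i> * complex_of_real (y \<bullet> u)" "\<lambda>x. ker y x * p x"]
    by (simp add: dunkl_ker algebra_simps)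
  then have "gint (\<lambda>x. ker y x * (complex_of_real (u \<bullet> x) * p x)) =
     gint (\<lambda>x. ker y x * dunkl u p x) - \<i> * complex_of_real (y \<bullet> u) * gint (\<lambda>x. ker y x * p x)"
    unfolding gint_diff[OF ok(2,1)] by (simp add: diff_eq_eq add.commute)
  then show ?thesis by (simp add: q_def right_diff_distrib mult_ac)
qed

text \<open>The function \<open>\<phi> s = gint (\<lambda>x. ker y (s *\<^sub>R x))\<close> solves \<open>\<phi>' = - s |y|\<^sup>2 \<phi>\<close>, by the Euler identity and
  integration by parts in direction \<open>y\<close>.\<close>

lemma gint_ker: "gint (ker y) = complex_of_real (exp (- (norm y)\<^sup>2 / 2)) * c\<^sub>\<kappa>"
proof -
  define \<phi> where "\<phi> s = gint (\<lambda>x. ker y (s *\<^sub>R x))" for s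
  define \<phi>' where "\<phi>' s = gint (\<lambda>x. frechet_derivative (ker y) (at (s *\<^sub>R x)) x)" for s
  have \<phi>d: "(\<phi> has_vector_derivative \<phi>' s) (at s)" for s
    unfolding \<phi>_def \<phi>'_def by (rule gint_scale_has_vector_derivative[OF tame_ker])
  have ks: "tame (\<lambda>x. ker y (s *\<^sub>R x))" for s
    by (rule tame_compose_linear[OF tame_ker]) (rule linear_scaleR)
  \<comment> \<open>The Euler identity is applied at s x and a factor s is cancelled, so s = 0
    remains an exceptional point of the interval.\<close>
  have ode: "\<phi>' s = - complex_of_real (s * (norm y)\<^sup>2) * \<phi> s" if s: "s \<noteq> 0" for s
  proof -
    define M where "M = gint (\<lambda>x. complex_of_real (y \<bullet> x) * ker y (s *\<^sub>R x))"
    have oky: "gint_ok (\<lambda>x. complex_of_real (y \<bullet> x) * ker y (s *\<^sub>R x))" using ks[of s] by simp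
    have okr: "gint_ok (\<lambda>x. complex_of_real (\<kappa> \<alpha>) * (ker y (s *\<^sub>R x) - ker y (s *\<^sub>R refl \<alpha> x)))" for \<alpha>
      using ks[of s] gint_ok_refl[OF gint_ok_tame[OF ks[of s]], of \<alpha>] by (intro gint_ok_mult gint_ok_diff) auto
    have "complex_of_real s * \<phi>' s = gint (\<lambda>x. frechet_derivative (ker y) (at (s *\<^sub>R x)) (s *\<^sub>R x))"
      unfolding \<phi>'_def gint_cmult[symmetric]
      by (simp add: linear_scale[OF tame_frechet_linear[OF tame_ker]] scaleR_conv_of_real[where 'a=complex])
    also have "\<dots> = gint (\<lambda>x. (- \<i> * complex_of_real s) * (complex_of_real (y \<bullet> x) * ker y (s *\<^sub>R x)) -
       (\<Sum>\<alpha>\<in>Rp. complex_of_real (\<kappa> \<alpha>) * (ker y (s *\<^sub>R x) - ker y (s *\<^sub>R refl \<alpha> x))))"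
      by (simp add: ker_euler linear_scale[OF linear_refl] mult_ac)
    also have "\<dots> = (- \<i> * complex_of_real s) * M - (\<Sum>\<alpha>\<in>Rp. complex_of_real (\<kappa> \<alpha>) * (\<phi> s - \<phi> s))"
    proof -
      \<comment> \<open>Reflection invariance of \<open>gint\<close> removes the nonlocal terms of
        the Euler identity.\<close>
      have "gint (\<lambda>x. ker y (s *\<^sub>R x) - ker y (s *\<^sub>R refl \<alpha> x)) = \<phi> s - \<phi> s" if "\<alpha> \<in> Rp" for \<alpha>
        using gint_refl[OF that gint_ok_tame[OF ks[of s]]] gint_ok_refl[OF gint_ok_tame[OF ks[of s]], of \<alpha>] ks[of s]
        by (subst gint_diff) (auto simp: \<phi>_def)
      then have "gint (\<lambda>x. \<Sum>\<alpha>\<in>Rp. complex_of_real (\<kappa> \<alpha>) * (ker y (s *\<^sub>R x) - ker y (s *\<^sub>R refl \<alpha> x))) =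
         (\<Sum>\<alpha>\<in>Rp. complex_of_real (\<kappa> \<alpha>) * (\<phi> s - \<phi> s))"
        using okr by (simp add: gint_sum gint_cmult)
      moreover have "gint_ok (\<lambda>x. (- \<i> * complex_of_real s) * (complex_of_real (y \<bullet> x) * ker y (s *\<^sub>R x)))"
        by (intro gint_ok_mult[OF _ oky] gint_ok_tame tame_const)
      ultimately show ?thesis
        unfolding M_def gint_cmult[symmetric] using okr by (subst gint_diff) (auto simp del: diff_self)
    qed
    finally have 1: "complex_of_real s * \<phi>' s = - \<i> * complex_of_real s * M" by simp
    \<comment> \<open>Integration by parts in the direction y: the eigenvalue is then -i s |y|^2,
      which expresses M through \<phi> and closes the equation.\<close>
    have "gint (\<lambda>x. (- \<i> * complex_of_real (s * (norm y)\<^sup>2)) * ker y (s *\<^sub>R x) - complex_of_real (y \<bullet> x) * ker y (s *\<^sub>R x)) = 0"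
      using gint_dunkl[OF ks[of s], of y]
      by (simp add: dunkl_scale[OF tame_ker s] dunkl_ker power2_norm_eq_inner mult_ac)
    then have "M = - \<i> * complex_of_real (s * (norm y)\<^sup>2) * \<phi> s"
      unfolding gint_diff[OF gint_ok_mult[OF gint_ok_tame[OF tame_const] gint_ok_tame[OF ks[of s]]] oky] gint_cmult
      by (simp add: M_def \<phi>_def)
    with 1 have "complex_of_real s * \<phi>' s = complex_of_real s * (- complex_of_real (s * (norm y)\<^sup>2) * \<phi> s)"
      by (simp add: algebra_simps)
    then show ?thesis using s by (metis mult_left_cancel of_real_eq_0_iff)
  qed
  define \<theta> where "\<theta> s = complex_of_real (exp (s\<^sup>2 * (norm y)\<^sup>2 / 2)) * \<phi> s" for s
  have \<theta>d: "(\<theta> has_vector_derivative complex_of_real (exp (s\<^sup>2 * (norm y)\<^sup>2 / 2)) * \<phi>' s +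
     complex_of_real (s * (norm y)\<^sup>2 * exp (s\<^sup>2 * (norm y)\<^sup>2 / 2)) * \<phi> s) (at s)" for s
  proof -
    have "((\<lambda>s. exp (s\<^sup>2 * (norm y)\<^sup>2 / 2)) has_real_derivative s * (norm y)\<^sup>2 * exp (s\<^sup>2 * (norm y)\<^sup>2 / 2)) (at s)"
      by (auto intro!: derivative_eq_intros)
    then have "((\<lambda>s. complex_of_real (exp (s\<^sup>2 * (norm y)\<^sup>2 / 2))) has_vector_derivative
        complex_of_real (s * (norm y)\<^sup>2 * exp (s\<^sup>2 * (norm y)\<^sup>2 / 2))) (at s)"
      by (intro has_vector_derivative_of_real) (simp add: has_real_derivative_iff_has_vector_derivative)
    from has_vector_derivative_mult[OF this \<phi>d] show ?thesis unfolding \<theta>_def .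
  qed
  have "\<theta> 1 = \<theta> 0"
  proof (rule has_derivative_zero_unique_strong_interval[of "{0}" 0 1 \<theta>])
    show "continuous_on {0..1} \<theta>"
      using \<theta>d by (meson continuous_at_imp_continuous_on has_vector_derivative_continuous)
    fix s :: real assume s: "s \<in> {0..1} - {0}"
    have "(\<theta> has_vector_derivative 0) (at s)" using \<theta>d[of s] s by (simp add: ode)
    then show "(\<theta> has_derivative (\<lambda>h. 0)) (at s within {0..1})"
      by (simp add: has_vector_derivative_def has_derivative_at_withinI)
  qed auto
  then show ?thesis
    by (simp add: \<theta>_def \<phi>_def gint_1 exp_minus field_simps)
qed

end

text \<open>\<open>q\<close> divides by the constant, so q 1 = 1 requires it to be nonzero. The
  value 0 is treated separately in the theorem.\<close>

locale dunkl_kernel_normalised = dunkl_kernel_system Rp \<kappa> E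
  for Rp :: "(real^'n) set" and \<kappa> E +
  assumes cconst_nonzero: "cconst Rp \<kappa> \<noteq> 0"
begin

lemma q_const: "q (\<lambda>x. c) = (\<lambda>y. c)"
  using cconst_nonzero gint_cmult[of c "ker _"]
  by (simp add: q_def fun_eq_iff gint_ker mult.commute exp_minus)

lemma polyf_q: "polyf n p \<Longrightarrow> polyf n (q p)"
proof (induction rule: polyf_strong_induct)
  case (const n c)
  then show ?case by (simp add: q_const polyf.const)
next
  case (add n p r)
  then have "q (\<lambda>x. p x + r x) = (\<lambda>y. q p y + q r y)" by (simp add: q_add fun_eq_iff)
  then show ?case using add by (simp add: polyf.add)
next
  case (mul n p u)
  have "q (\<lambda>x. complex_of_real (u \<bullet> x) * p x) = (\<lambda>y. q (dunkl u p) y - \<i> * (complex_of_real (u \<bullet> y) * q p y))"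
    using mul(1) by (simp add: q_inner_mult fun_eq_iff) (simp add: inner_commute mult_ac)
  moreover have "polyf (Suc n) (q (dunkl u p))" using mul polyf_dunkl polyf_Suc by blast
  moreover have "polyf (Suc n) (\<lambda>y. \<i> * (complex_of_real (u \<bullet> y) * q p y))"
    using mul by (intro polyf_cmult polyf.mul)
  ultimately show ?case by (simp add: polyf_diff)
qed

text \<open>Instead of the invariance of the kernel under simultaneous reflection of both arguments,
  the proof uses the recursion of \<open>q\<close> and the equivariance \<open>dunkl_refl\<close>,
  by induction on the degree.\<close>

lemma q_refl: "polyf n p \<Longrightarrow> \<beta> \<in> Rp \<Longrightarrow> q (\<lambda>x. p (refl \<beta> x)) = (\<lambda>y. q p (refl \<beta> y))"
proof (induction rule: polyf_strong_induct)
  case (const n c)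
  then show ?case by (simp add: q_const)
next
  case (add n p r)
  then show ?case by (simp add: q_add fun_eq_iff tame_refl)
next
  case (mul n p u)
  have "q (\<lambda>x. complex_of_real (u \<bullet> refl \<beta> x) * p (refl \<beta> x)) =
     q (\<lambda>x. complex_of_real (refl \<beta> u \<bullet> x) * p (refl \<beta> x))" by (simp add: inner_refl_left)
  also have "\<dots> = (\<lambda>y. q (\<lambda>x. dunkl u p (refl \<beta> x)) y - \<i> * complex_of_real (y \<bullet> refl \<beta> u) * q (\<lambda>x. p (refl \<beta> x)) y)"
    using mul by (simp add: fun_eq_iff q_inner_mult tame_refl dunkl_refl)
  also have "\<dots> = (\<lambda>y. q (\<lambda>x. complex_of_real (u \<bullet> x) * p x) (refl \<beta> y))"
    using mul polyf_dunkl[OF mul(1)] by (simp add: q_inner_mult inner_refl_left)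
  finally show ?case .
qed

lemma q_refl_term:
  assumes "polyf n p"
  shows "q (refl_term \<xi> u p) y = refl_term \<xi> u (q p) y"
proof -
  have "gint_ok (\<lambda>x. complex_of_real (\<kappa> \<alpha> * (\<alpha> \<bullet> \<xi>) * (2 * (\<alpha> \<bullet> u) / (norm \<alpha>)\<^sup>2)) * p (refl \<alpha> x))" for \<alpha>
    using assms tame_refl by (intro gint_ok_mult) auto
  then show ?thesis
    unfolding refl_term_def by (simp only: q_sum q_cmult) (simp add: q_refl[OF assms])
qed

text \<open>Commutativity of the Dunkl operators is only needed after applying \<open>q\<close>, where it is
  the commutativity of multiplication by coordinates.\<close>

lemma q_dunkl_commute:
  assumes p: "polyf n p"
  shows "q (dunkl u (dunkl v p)) y = q (dunkl v (dunkl u p)) y"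
proof -
  have t: "tame p" "tame (dunkl w p)" "tame (refl_term w w' p)" for w w'
    using p polyf_dunkl polyf_refl_term by (blast intro: polyf_tame)+
  \<comment> \<open>Two applications of the recursion. Every term except the first is symmetric in u
    and v, and so is the left-hand side.\<close>
  have key: "q (\<lambda>x. complex_of_real (u \<bullet> x) * (complex_of_real (v \<bullet> x) * p x)) y = q (dunkl v (dunkl u p)) y
     - \<i> * complex_of_real (y \<bullet> v) * q (dunkl u p) y - \<i> * complex_of_real (y \<bullet> u) * q (dunkl v p) y
     - complex_of_real (y \<bullet> u) * complex_of_real (y \<bullet> v) * q p y
     + complex_of_real (u \<bullet> v) * q p y + q (refl_term u v p) y" for u v
    using t by (simp add: q_inner_mult dunkl_inner_mult q_add q_cmult)
      (simp add: inner_commute[of u v] algebra_simps)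
  have "(\<lambda>x. complex_of_real (u \<bullet> x) * (complex_of_real (v \<bullet> x) * p x)) =
     (\<lambda>x. complex_of_real (v \<bullet> x) * (complex_of_real (u \<bullet> x) * p x))" by (simp add: mult_ac)
  with key[of u v] key[of v u] show ?thesis
    by (simp add: refl_term_commute[of u v] inner_commute[of u v] algebra_simps)
qed

text \<open>In the product step both sides expand by the commutator formula. The second-order terms
  match after \<open>q_dunkl_commute\<close> makes \<xi> the outer direction, where the hypothesis
  for \<open>dunkl u p\<close> applies.\<close>

lemma q_dunkl: "polyf n p \<Longrightarrow> q (dunkl \<xi> p) = (\<lambda>y. \<i> * dunkl \<xi> (q p) y)"
proof (induction rule: polyf_strong_induct)
  case (const n c)
  then show ?case by (simp add: q_const)
next
  case (add n p r)
  have "q (\<lambda>x. p x + r x) = (\<lambda>y. q p y + q r y)" using add by (simp add: q_add fun_eq_iff)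
  then show ?case using add polyf_q[OF add(1)] polyf_q[OF add(2)] polyf_dunkl[OF add(1), of \<xi>] polyf_dunkl[OF add(2), of \<xi>]
    by (simp add: dunkl_add q_add fun_eq_iff distrib_left)
next
  case (mul n p u)
  have t: "tame p" "tame (dunkl w p)" "tame (q p)" "tame (q (dunkl w p))" "tame (refl_term w w' p)" for w w'
    using mul(1) polyf_dunkl polyf_q polyf_refl_term by (blast intro: polyf_tame)+
  show ?case
  proof (rule ext)
    fix y
    have eq: "q (\<lambda>x. complex_of_real (u \<bullet> x) * p x) = (\<lambda>y. q (dunkl u p) y + (- \<i>) * (complex_of_real (u \<bullet> y) * q p y))"
      using t by (simp add: q_inner_mult fun_eq_iff) (simp add: inner_commute mult_ac)
    have "q (dunkl \<xi> (\<lambda>x. complex_of_real (u \<bullet> x) * p x)) y =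
      q (dunkl u (dunkl \<xi> p)) y - \<i> * complex_of_real (u \<bullet> y) * q (dunkl \<xi> p) y
       + complex_of_real (u \<bullet> \<xi>) * q p y + refl_term \<xi> u (q p) y"
      using t by (simp add: dunkl_inner_mult q_add q_cmult q_inner_mult q_refl_term[OF mul(1)] inner_commute[of u y])
    also have "q (dunkl u (dunkl \<xi> p)) y = \<i> * dunkl \<xi> (q (dunkl u p)) y"
      using mul(2)[OF polyf_dunkl[OF mul(1)]] by (simp add: q_dunkl_commute[OF mul(1), of u])
    also have "q (dunkl \<xi> p) y = \<i> * dunkl \<xi> (q p) y" using mul(2)[OF mul(1)] by simp
    finally show "q (dunkl \<xi> (\<lambda>x. complex_of_real (u \<bullet> x) * p x)) y =
        \<i> * dunkl \<xi> (q (\<lambda>x. complex_of_real (u \<bullet> x) * p x)) y"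
      unfolding eq by (simp only: dunkl_add dunkl_cmult dunkl_inner_mult t tame_mult tame_const tame_inner)
        (simp add: algebra_simps)
  qed
qed

section \<open>The bilinear pairing and its adjointness relation\<close>

definition pairing :: "(real^'n \<Rightarrow> complex) \<Rightarrow> (real^'n \<Rightarrow> complex) \<Rightarrow> complex" where
  "pairing r p = gint (\<lambda>y. q r y * q p y)"

text \<open>Under \<open>q\<close>, the factor <u, x> becomes i (T_u - <u, y>) acting on
  \<open>q r\<close>. Its transpose for \<open>gint\<close> is -i T_u, and i T_u (q p) is
  \<open>q (dunkl u p)\<close>.\<close>

lemma pairing_inner_mult:
  assumes r: "polyf n r" and p: "polyf m p"
  shows "pairing (\<lambda>x. complex_of_real (u \<bullet> x) * r x) p = - pairing r (dunkl u p)"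
proof -
  have t: "tame r" "tame (q r)" "tame (q p)" using r p polyf_q by (blast intro: polyf_tame)+
  have "q (\<lambda>x. complex_of_real (u \<bullet> x) * r x) y * q p y =
     \<i> * ((dunkl u (q r) y - complex_of_real (u \<bullet> y) * q r y) * q p y)" for y
    using t by (simp add: q_inner_mult q_dunkl[OF r]) (simp add: inner_commute algebra_simps)
  then have "pairing (\<lambda>x. complex_of_real (u \<bullet> x) * r x) p =
     \<i> * gint (\<lambda>y. (dunkl u (q r) y - complex_of_real (u \<bullet> y) * q r y) * q p y)"
    unfolding pairing_def by (simp only: gint_cmult)
  also have "\<dots> = - (\<i> * gint (\<lambda>y. q r y * dunkl u (q p) y))"
    using t by (simp add: gint_dunkl_antisymmetric)
  also have "\<dots> = - pairing r (dunkl u p)"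
    unfolding pairing_def q_dunkl[OF p] gint_cmult[symmetric] by (simp add: mult_ac)
  finally show ?thesis .
qed

end

section \<open>Expansion of the exponential\<close>

lemma has_vector_derivative_power_sum_0:
  "((\<lambda>t. \<Sum>k\<le>n. complex_of_real (t ^ k) * c k) has_vector_derivative (if n = 0 then 0 else c 1)) (at 0)"
proof -
  have "((\<lambda>t. complex_of_real (t ^ k) * c k) has_vector_derivative (if k = 1 then c 1 else 0)) (at 0)" for k
  proof -
    have "((\<lambda>t::real. t ^ k) has_real_derivative real k * 0 ^ (k - 1)) (at 0)"
      by (auto intro!: derivative_eq_intros)
    then have "((\<lambda>t. complex_of_real (t ^ k)) has_vector_derivative complex_of_real (real k * 0 ^ (k - 1))) (at 0)"
      by (intro has_vector_derivative_of_real) (simp add: has_real_derivative_iff_has_vector_derivative)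
    from has_vector_derivative_mult_left[OF this, of "c k"] show ?thesis
      by (cases "k = 1"; cases k) (auto simp: power_0_left)
  qed
  then have "((\<lambda>t. \<Sum>k\<le>n. complex_of_real (t ^ k) * c k) has_vector_derivative (\<Sum>k\<le>n. if k = 1 then c 1 else 0)) (at 0)"
    by (intro has_vector_derivative_sum) auto
  moreover have "(\<Sum>k\<le>n. if k = 1 then c 1 else 0) = (if n = 0 then 0 else c 1)" by (cases n) auto
  ultimately show ?thesis by simp
qed

text \<open>The recursion of \<open>q\<close> on products of \<open>n\<close> linear forms: the factor \<open>a\<close> bounds \<open>\<langle>y, u\<rangle>\<close>, and \<open>b\<close> bounds each of the
  terms that the Dunkl operator produces.\<close>

fun hermite_bound :: "real \<Rightarrow> real \<Rightarrow> nat \<Rightarrow> real" where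
  "hermite_bound a b 0 = 1"
| "hermite_bound a b (Suc 0) = a"
| "hermite_bound a b (Suc (Suc n)) = a * hermite_bound a b (Suc n) + b * real (Suc n) * hermite_bound a b n"

lemma hermite_bound_nonneg: "0 \<le> a \<Longrightarrow> 0 \<le> b \<Longrightarrow> 0 \<le> hermite_bound a b n"
  by (induction a b n rule: hermite_bound.induct) auto

text \<open>The exponential generating function \<open>\<Sum> H\<^sub>n t\<^sup>n / n!\<close> satisfies \<open>S' = (a + b t) S\<close>;
  its truncations satisfy the corresponding differential inequality.\<close>

lemma sum_hermite_bound_le:
  assumes a: "0 \<le> a" and b: "0 \<le> b"
  shows "(\<Sum>n<N. hermite_bound a b n / fact n) \<le> exp (a + b / 2)"
proof -
  define e where "e n = hermite_bound a b n / fact n" for n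
  have e0: "e 0 = 1" and e1: "e (Suc 0) = a" by (simp_all add: e_def)
  have enn: "0 \<le> e n" for n using hermite_bound_nonneg[OF a b] by (simp add: e_def)
  have erec: "real (Suc (Suc n)) * e (Suc (Suc n)) = a * e (Suc n) + b * e n" for n
    unfolding e_def by (simp add: add_divide_distrib distrib_left del: of_nat_Suc)
  define S where "S M t = (\<Sum>n\<le>M. e n * t ^ n)" for M t
  have Snn: "0 \<le> S M t" if "0 \<le> t" for M t unfolding S_def using that enn by (intro sum_nonneg) auto
  \<comment> \<open>Differentiation shifts the truncation: the derivative of S_(M+2) involves
    S_(M+1) and S_M. All terms being nonnegative for t >= 0, both are at most S_(M+2).\<close>
  have deriv: "(\<Sum>n\<le>Suc (Suc M). e n * (real n * t ^ (n - 1))) = a * S (Suc M) t + b * t * S M t" for M t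
  proof (induction M)
    case 0
    show ?case using erec[of 0] by (simp add: S_def e0 e1 algebra_simps)
  next
    case (Suc M)
    have "e (Suc (Suc (Suc M))) * (real (Suc (Suc (Suc M))) * t ^ (Suc (Suc (Suc M)) - 1)) =
       (a * e (Suc (Suc M)) + b * e (Suc M)) * t ^ Suc (Suc M)"
      using erec[of "Suc M"] by (simp add: mult_ac del: of_nat_Suc)
    then show ?case using Suc by (simp add: S_def algebra_simps)
  qed
  have main: "S (Suc (Suc M)) 1 \<le> exp (a + b / 2)" for M
  proof -
    define g where "g t = S (Suc (Suc M)) t * exp (- (a * t + b * t\<^sup>2 / 2))" for t
    have "g 1 \<le> g 0"
    proof (rule DERIV_nonpos_imp_nonincreasing[of 0 1 g])
      fix t :: real assume t: "0 \<le> t" "t \<le> 1"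
      let ?S' = "\<Sum>n\<le>Suc (Suc M). e n * (real n * t ^ (n - 1))"
      have S': "(S (Suc (Suc M)) has_real_derivative ?S') (at t)"
        unfolding S_def
        by (rule DERIV_sum) (auto intro!: derivative_eq_intros)
      have ex: "((\<lambda>t. exp (- (a * t + b * t\<^sup>2 / 2))) has_real_derivative - (a + b * t) * exp (- (a * t + b * t\<^sup>2 / 2))) (at t)"
        by (auto intro!: derivative_eq_intros simp: algebra_simps)
      have "(g has_real_derivative ?S' * exp (- (a * t + b * t\<^sup>2 / 2)) +
         - (a + b * t) * exp (- (a * t + b * t\<^sup>2 / 2)) * S (Suc (Suc M)) t) (at t)"
        unfolding g_def by (rule DERIV_mult[OF S' ex])
      moreover have "?S' \<le> (a + b * t) * S (Suc (Suc M)) t"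
      proof -
        have mono: "S M t \<le> S (Suc (Suc M)) t" "S (Suc M) t \<le> S (Suc (Suc M)) t"
          using enn t by (auto simp: S_def)
        have "a * S (Suc M) t \<le> a * S (Suc (Suc M)) t" "b * t * S M t \<le> b * t * S (Suc (Suc M)) t"
          using mono a b t by (auto intro!: mult_left_mono)
        then show ?thesis unfolding deriv by (simp add: algebra_simps)
      qed
      then have "?S' * exp (- (a * t + b * t\<^sup>2 / 2)) \<le> (a + b * t) * S (Suc (Suc M)) t * exp (- (a * t + b * t\<^sup>2 / 2))"
        by (intro mult_right_mono) auto
      then have "?S' * exp (- (a * t + b * t\<^sup>2 / 2)) +
         - (a + b * t) * exp (- (a * t + b * t\<^sup>2 / 2)) * S (Suc (Suc M)) t \<le> 0" by (simp add: algebra_simps)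
      ultimately show "\<exists>y. (g has_real_derivative y) (at t) \<and> y \<le> 0" by blast
    qed simp
    moreover have "g 0 = 1" unfolding g_def S_def by (simp add: e0 power_0_left sum.atMost_shift)
    ultimately have "S (Suc (Suc M)) 1 * exp (- (a + b / 2)) \<le> 1" by (simp add: g_def)
    then have "S (Suc (Suc M)) 1 / exp (a + b / 2) \<le> 1" by (simp only: exp_minus divide_inverse)
    then show ?thesis by (simp add: divide_le_eq)
  qed
  have "(\<Sum>n<N. e n) \<le> (\<Sum>n\<le>Suc (Suc N). e n)"
    by (rule sum_mono2) (auto simp: enn)
  with main[of N] show ?thesis by (simp add: S_def e_def)
qed

text \<open>Powers of a single linear form are not preserved by Dunkl operators, which reflect some
  of the factors. Products of varying forms are, up to linear combinations, and reflections keep the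
  norms of the vectors.\<close>

primrec linear_product :: "(real^'n) list \<Rightarrow> real^'n \<Rightarrow> complex" where
  "linear_product [] = (\<lambda>x. 1)"
| "linear_product (u # us) = (\<lambda>x. complex_of_real (u \<bullet> x) * linear_product us x)"

lemma polyf_linear_product: "polyf (length us) (linear_product us)"
  by (induction us) (auto intro: polyf.intros)

lemma tame_linear_product [simp]: "tame (linear_product us)"
  using polyf_linear_product polyf_tame by blast

lemma linear_product_refl: "linear_product us (refl \<beta> x) = linear_product (map (refl \<beta>) us) x"
  by (induction us) (auto simp: inner_refl_left)

lemma linear_product_append: "linear_product (us @ vs) x = linear_product us x * linear_product vs x"
  by (induction us) auto

lemma linear_product_replicate: "linear_product (replicate n u) x = complex_of_real (u \<bullet> x) ^ n"
  by (induction n) auto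

section \<open>Growth of the transform on products of linear forms\<close>

context dunkl_kernel_normalised
begin

text \<open>The cost of moving a Dunkl operator past one linear form, divided by \<rho>^2: 1 for the
  inner product <u, v>, and 2 \<kappa> \<alpha> for each reflected term.\<close>

definition growth :: real where "growth = 1 + (\<Sum>\<alpha>\<in>Rp. 2 * \<kappa> \<alpha>)"

lemma growth_nonneg: "0 \<le> growth"
  unfolding growth_def by (intro add_nonneg_nonneg sum_nonneg) (auto simp: \<kappa>_nonneg)

text \<open>The operator moves past one factor at a time; \<open>ws\<close> holds the factors
  already passed. Each passage leaves products of N factors whose coefficients sum in absolute value
  to at most growth \<rho>^2.\<close>

lemma norm_q_linear_product_dunkl_le:
  assumes B: "\<And>vs. length vs = N \<Longrightarrow> \<forall>v\<in>set vs. norm v \<le> \<rho> \<Longrightarrow> norm (q (linear_product vs) y) \<le> B"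
    and "length ws + length us = Suc N" "\<forall>v\<in>set ws. norm v \<le> \<rho>" "\<forall>v\<in>set us. norm v \<le> \<rho>"
    and u: "norm u \<le> \<rho>"
  shows "norm (q (\<lambda>x. linear_product ws x * dunkl u (linear_product us) x) y) \<le> real (length us) * (growth * \<rho>\<^sup>2 * B)"
  using assms(2-4)
proof (induction us arbitrary: ws)
  case Nil
  show ?case using q_const[of 0] by simp
next
  case (Cons v vs)
  have v: "norm v \<le> \<rho>" using Cons.prems by simp
  have \<rho>: "0 \<le> \<rho>" using order_trans[OF norm_ge_zero u] .
  have ip: "\<bar>w \<bullet> w'\<bar> \<le> \<rho>\<^sup>2" if "norm w \<le> \<rho>" "norm w' \<le> \<rho>" for w w' :: "real^'n"
  proof -
    have "norm w * norm w' \<le> \<rho> * \<rho>" using that \<rho> by (intro mult_mono) auto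
    then show ?thesis using Cauchy_Schwarz_ineq2[of w w'] by (simp add: power2_eq_square)
  qed
  define c where "c \<alpha> = \<kappa> \<alpha> * (\<alpha> \<bullet> u) * (2 * (\<alpha> \<bullet> v) / (norm \<alpha>)\<^sup>2)" for \<alpha>
  have cb: "\<bar>c \<alpha>\<bar> \<le> 2 * \<kappa> \<alpha> * \<rho>\<^sup>2" if \<alpha>: "\<alpha> \<in> Rp" for \<alpha>
  proof -
    have "\<bar>\<alpha> \<bullet> u\<bar> * \<bar>\<alpha> \<bullet> v\<bar> \<le> (norm \<alpha> * \<rho>) * (norm \<alpha> * \<rho>)"
      using u v by (intro mult_mono order_trans[OF Cauchy_Schwarz_ineq2] mult_left_mono) (auto simp: \<rho>)
    then have "\<bar>\<alpha> \<bullet> u\<bar> * \<bar>\<alpha> \<bullet> v\<bar> / (norm \<alpha>)\<^sup>2 \<le> \<rho>\<^sup>2"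
      using nonzero[OF \<alpha>] by (simp add: divide_le_eq power2_eq_square mult_ac)
    then have "2 * \<kappa> \<alpha> * (\<bar>\<alpha> \<bullet> u\<bar> * \<bar>\<alpha> \<bullet> v\<bar> / (norm \<alpha>)\<^sup>2) \<le> 2 * \<kappa> \<alpha> * \<rho>\<^sup>2"
      by (rule mult_left_mono) (simp add: \<kappa>_nonneg[OF \<alpha>])
    then show ?thesis using \<kappa>_nonneg[OF \<alpha>] by (simp add: c_def abs_mult mult_ac)
  qed
  have len: "length (ws @ vs) = N" using Cons.prems by simp
  have B0: "0 \<le> B" using order_trans[OF norm_ge_zero B[OF len]] Cons.prems by auto
  have eq: "(\<lambda>x. linear_product ws x * dunkl u (linear_product (v # vs)) x) = (\<lambda>x. linear_product (v # ws) x * dunkl u (linear_product vs) x +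
     complex_of_real (v \<bullet> u) * linear_product (ws @ vs) x + (\<Sum>\<alpha>\<in>Rp. complex_of_real (c \<alpha>) * linear_product (ws @ map (refl \<alpha>) vs) x))"
    by (rule ext, simp add: dunkl_inner_mult refl_term_def c_def linear_product_append linear_product_refl distrib_left
       sum_distrib_left) (simp add: mult_ac)
  have "norm (q (\<lambda>x. linear_product ws x * dunkl u (linear_product (v # vs)) x) y) =
    norm (q (\<lambda>x. linear_product (v # ws) x * dunkl u (linear_product vs) x) y + complex_of_real (v \<bullet> u) * q (linear_product (ws @ vs)) y +
      (\<Sum>\<alpha>\<in>Rp. complex_of_real (c \<alpha>) * q (linear_product (ws @ map (refl \<alpha>) vs)) y))"
    unfolding eq by (simp add: q_add q_sum q_cmult del: linear_product.simps)
  also have "\<dots> \<le> norm (q (\<lambda>x. linear_product (v # ws) x * dunkl u (linear_product vs) x) y) + norm (complex_of_real (v \<bullet> u) * q (linear_product (ws @ vs)) y) +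
      (\<Sum>\<alpha>\<in>Rp. norm (complex_of_real (c \<alpha>) * q (linear_product (ws @ map (refl \<alpha>) vs)) y))"
    by (intro norm_triangle_mono norm_sum order_refl)
  also have "\<dots> \<le> real (length vs) * (growth * \<rho>\<^sup>2 * B) + \<rho>\<^sup>2 * B + (\<Sum>\<alpha>\<in>Rp. 2 * \<kappa> \<alpha> * \<rho>\<^sup>2 * B)"
  proof (intro add_mono sum_mono)
    show "norm (q (\<lambda>x. linear_product (v # ws) x * dunkl u (linear_product vs) x) y) \<le> real (length vs) * (growth * \<rho>\<^sup>2 * B)"
      using Cons.prems by (intro Cons.IH) auto
    show "norm (complex_of_real (v \<bullet> u) * q (linear_product (ws @ vs)) y) \<le> \<rho>\<^sup>2 * B"
      unfolding norm_mult norm_of_real using Cons.prems by (intro mult_mono ip v u B len) auto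
    fix \<alpha> assume \<alpha>: "\<alpha> \<in> Rp"
    show "norm (complex_of_real (c \<alpha>) * q (linear_product (ws @ map (refl \<alpha>) vs)) y) \<le> 2 * \<kappa> \<alpha> * \<rho>\<^sup>2 * B"
      unfolding norm_mult norm_of_real using Cons.prems \<kappa>_nonneg[OF \<alpha>] by (intro mult_mono cb[OF \<alpha>] B) auto
  qed
  also have "\<dots> = real (length (v # vs)) * (growth * \<rho>\<^sup>2 * B)"
    by (simp add: growth_def algebra_simps sum_distrib_left sum_distrib_right sum.distrib)
  finally show ?case .
qed

text \<open>Splitting off one form from n + 2 costs \<rho> |y| times the bound for n + 1 factors,
  plus n + 1 passages of the Dunkl operator, each bounded through n factors. No integral is
  estimated, so the factor exp (|y|^2 / 2) of \<open>q\<close> never enters.\<close>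

lemma norm_q_linear_product_le:
  assumes "\<forall>v\<in>set us. norm v \<le> \<rho>"
  shows "norm (q (linear_product us) y) \<le> hermite_bound (\<rho> * norm y) (growth * \<rho>\<^sup>2) (length us)"
  using assms
proof (induction "length us" arbitrary: us rule: less_induct)
  case less
  have step: "norm (q (linear_product (u # us')) y) \<le> norm (q (dunkl u (linear_product us')) y) + (\<rho> * norm y) * norm (q (linear_product us') y)"
    if "norm u \<le> \<rho>" for u us'
  proof -
    have "\<bar>y \<bullet> u\<bar> \<le> norm y * norm u" by (rule Cauchy_Schwarz_ineq2)
    also have "\<dots> \<le> \<rho> * norm y" using that by (simp add: mult_right_mono mult.commute)
    finally have "\<bar>y \<bullet> u\<bar> * norm (q (linear_product us') y) \<le> \<rho> * norm y * norm (q (linear_product us') y)" by (rule mult_right_mono) simp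
    then show ?thesis
      using norm_triangle_ineq4[of "q (dunkl u (linear_product us')) y" "\<i> * complex_of_real (y \<bullet> u) * q (linear_product us') y"]
      by (simp add: q_inner_mult norm_mult)
  qed
  show ?case
  proof (cases us)
    case Nil
    then show ?thesis by (simp add: q_const)
  next
    case (Cons u us')
    show ?thesis
    proof (cases us')
      case Nil
      then show ?thesis using step[of u "[]"] Cons less.prems q_const[of 0] by (simp add: q_const)
    next
      case (Cons u' us'')
      let ?H = "hermite_bound (\<rho> * norm y) (growth * \<rho>\<^sup>2)"
      have us: "us = u # us'" "us' = u' # us''" by fact+
      have \<rho>: "norm u \<le> \<rho>" "\<forall>v\<in>set us'. norm v \<le> \<rho>" using us less.prems by auto
      have \<rho>0: "0 \<le> \<rho>" using order_trans[OF norm_ge_zero \<rho>(1)] .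
      have "norm (q (\<lambda>x. linear_product [] x * dunkl u (linear_product us') x) y) \<le> real (length us') * (growth * \<rho>\<^sup>2 * ?H (length us''))"
      proof (rule norm_q_linear_product_dunkl_le[where N="length us''"])
        fix vs :: "(real^'n) list" assume "length vs = length us''" "\<forall>v\<in>set vs. norm v \<le> \<rho>"
        then show "norm (q (linear_product vs) y) \<le> ?H (length us'')" using less.hyps[of vs] us by simp
      qed (use \<rho> us in auto)
      moreover have "\<rho> * norm y * norm (q (linear_product us') y) \<le> \<rho> * norm y * ?H (length us')"
        using \<rho> \<rho>0 us less.hyps[of us'] by (intro mult_left_mono) auto
      ultimately show ?thesis using step[OF \<rho>(1), of us'] unfolding us by (simp add: mult_ac)
    qed
  qed
qed

section \<open>The expansion of \<open>Wop\<close> in powers of z\<close>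

definition expo :: "real^'n \<Rightarrow> real^'n \<Rightarrow> complex" where
  "expo z x = complex_of_real (exp (- (x \<bullet> z)))"

text \<open>The inner limit, for fixed y, where the crude kernel bound and exp (|z| |x|) suffice for
  domination.\<close>

lemma q_expo_LIMSEQ:
  "(\<lambda>N. \<Sum>n<N. q (linear_product (replicate n (- z))) y / fact n) \<longlonglongrightarrow> q (expo z) y"
proof -
  define s where "s N x = (\<Sum>n<N. (1 / fact n) * linear_product (replicate n (- z)) x)" for N x
  have st: "tame (s N)" for N unfolding s_def by (intro tame_sum tame_mult tame_const tame_linear_product)
  have seq: "q (s N) y = (\<Sum>n<N. q (linear_product (replicate n (- z))) y / fact n)" for N
  proof -
    have "q (s N) y = (\<Sum>n<N. q (\<lambda>x. (1 / fact n) * linear_product (replicate n (- z)) x) y)"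
      unfolding s_def by (intro q_sum gint_ok_mult gint_ok_tame tame_const tame_linear_product)
    then show ?thesis by (simp only: q_cmult) simp
  qed
  have "(\<lambda>N. gint (\<lambda>x. ker y x * s N x)) \<longlonglongrightarrow> gint (\<lambda>x. ker y x * expo z x)"
  proof (rule gint_dominated_convergence)
    show "gint_ok (\<lambda>x. ker y x * s N x)" for N using st by simp
    show "gint_ok (\<lambda>x. complex_of_real (norm (ker y x) * exp (norm z * norm x)))"
    proof -
      have "exp_bounded (\<lambda>x. complex_of_real (norm (ker y x)))"
        using tame_exp_bounded[OF tame_ker[of y]] by (simp add: exp_bounded_def)
      moreover have "exp_bounded (\<lambda>x::real^'n. complex_of_real (exp (norm z * norm x)))"
        by (rule exp_boundedI[of "norm z" _ 1]) auto
      moreover have [measurable]: "ker y \<in> borel_measurable borel" by simp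
      ultimately show ?thesis unfolding gint_ok_def of_real_mult by auto
    qed
    fix x
    have nle: "norm (s N x) \<le> exp (norm z * norm x)" for N
    proof -
      have "norm (s N x) \<le> (\<Sum>n<N. (norm z * norm x) ^ n /\<^sub>R fact n)"
        unfolding s_def
      proof (rule sum_norm_le)
        fix n
        have "\<bar>z \<bullet> x\<bar> ^ n \<le> (norm z * norm x) ^ n" by (intro power_mono Cauchy_Schwarz_ineq2) auto
        then show "norm ((1 / fact n) * linear_product (replicate n (- z)) x) \<le> (norm z * norm x) ^ n /\<^sub>R fact n"
          by (simp add: linear_product_replicate norm_mult norm_divide norm_power divide_right_mono field_simps)
      qed
      also have "\<dots> \<le> exp (norm z * norm x)"
        unfolding exp_def by (rule sum_le_suminf[OF summable_exp_generic]) auto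
      finally show ?thesis .
    qed
    show "norm (ker y x * s N x) \<le> norm (ker y x) * exp (norm z * norm x)" for N
      unfolding norm_mult using nle by (intro mult_left_mono) auto
    have "(\<lambda>n. (complex_of_real ((- z) \<bullet> x)) ^ n /\<^sub>R fact n) sums exp (complex_of_real ((- z) \<bullet> x))"
      by (rule exp_converges)
    then have "(\<lambda>N. s N x) \<longlonglongrightarrow> expo z x"
      unfolding sums_def s_def expo_def
      by (simp add: linear_product_replicate scaleR_conv_of_real inner_commute divide_inverse mult_ac exp_of_real flip: of_real_minus)
    then show "(\<lambda>N. ker y x * s N x) \<longlonglongrightarrow> ker y x * expo z x" by (intro tendsto_intros)
  qed
  then have "(\<lambda>N. q (s N) y) \<longlonglongrightarrow> q (expo z) y"
    unfolding q_def by (intro tendsto_intros)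
  then show ?thesis unfolding seq .
qed

text \<open>The factor exp (|y|^2 / 2) in \<open>Lker\<close> is the one in \<open>q\<close>, while
  the transform of p times the Gaussian is \<open>q p\<close> times the Gaussian in y, which
  supplies the measure of \<open>gint\<close>.\<close>

lemma Wop_eq: "Wop Rp \<kappa> E p z = 1 / c\<^sub>\<kappa> * gint (\<lambda>y. q (expo z) y * q p y)"
proof -
  have L: "Lker Rp \<kappa> E y z = q (expo z) y" for y
  proof -
    have "(\<lambda>x. E (mi x) (cvec y) * complex_of_real (exp (- (x \<bullet> z)) * exp (- (norm x)\<^sup>2 / 2) * exp ((norm y)\<^sup>2 / 2)
            * weight Rp \<kappa> x)) = (\<lambda>x. complex_of_real (exp ((norm y)\<^sup>2 / 2)) *
         (ker y x * expo z x * complex_of_real (exp (- (norm x)\<^sup>2 / 2) * weight Rp \<kappa> x)))"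
      by (simp add: ker_def expo_def mult_ac)
    then show ?thesis unfolding Lker_def q_def gint_def by (simp only:) simp
  qed
  have T: "dunkl_transform Rp \<kappa> E (\<lambda>x. p x * complex_of_real (exp (- (norm x)\<^sup>2 / 2))) y
     = complex_of_real (exp (- (norm y)\<^sup>2 / 2)) * q p y" for y
  proof -
    have "dunkl_transform Rp \<kappa> E (\<lambda>x. p x * complex_of_real (exp (- (norm x)\<^sup>2 / 2))) y
       = 1 / c\<^sub>\<kappa> * gint (\<lambda>x. ker y x * p x)"
      unfolding dunkl_transform_def gint_def ker_def by (simp add: mult_ac)
    also have "\<dots> = complex_of_real (exp (- (norm y)\<^sup>2 / 2) * exp ((norm y)\<^sup>2 / 2)) / c\<^sub>\<kappa> * gint (\<lambda>x. ker y x * p x)"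
      by (simp flip: exp_add)
    finally show ?thesis by (simp add: q_def)
  qed
  show ?thesis unfolding Wop_def L T gint_def by (simp add: mult_ac)
qed

lemma gint_ok_q: "polyf n p \<Longrightarrow> gint_ok (q p)"
  by (simp add: polyf_q[THEN polyf_tame])

lemma pairing_sum:
  assumes "\<And>i. i \<in> S \<Longrightarrow> polyf n (r i)" "polyf m p"
  shows "pairing (\<lambda>x. \<Sum>i\<in>S. c i * r i x) p = (\<Sum>i\<in>S. c i * pairing (r i) p)"
proof -
  have "q (\<lambda>x. \<Sum>i\<in>S. c i * r i x) y = (\<Sum>i\<in>S. q (\<lambda>x. c i * r i x) y)" for y
    using assms(1) by (intro q_sum gint_ok_mult gint_ok_tame tame_const) (rule polyf_tame)
  then have "q (\<lambda>x. \<Sum>i\<in>S. c i * r i x) y * q p y = (\<Sum>i\<in>S. c i * (q (r i) y * q p y))" for y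
    by (simp add: q_cmult sum_distrib_right mult.assoc)
  then show ?thesis
    unfolding pairing_def using assms by (simp only: gint_cmult[symmetric])
      (intro gint_sum gint_ok_mult gint_ok_tame[OF tame_const] gint_ok_q)
qed

text \<open>Every linear form moves to p as a Dunkl operator and lowers its degree; more than M of
  them annihilate p.\<close>

lemma pairing_linear_product_eq_0: "polyf M p \<Longrightarrow> M < length us \<Longrightarrow> pairing (linear_product us) p = 0"
proof (induction us arbitrary: M p)
  case (Cons u us)
  have "pairing (linear_product us) (dunkl u p) = 0"
  proof (cases M)
    case 0
    then show ?thesis using Cons.prems dunkl_polyf_0[of p u] q_const[of 0] by (simp add: pairing_def gint_def)
  next
    case (Suc M')
    then show ?thesis using Cons.prems polyf_dunkl_Suc[of M' p u] by (intro Cons.IH[of M']) auto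
  qed
  then show ?case using pairing_inner_mult[OF polyf_linear_product Cons.prems(1)] by simp
qed simp

text \<open>The outer limit. By the Hermite-type bounds all partial sums are at most exp (|z| |y| +
  K / 2), which is only exponential in |y| and hence integrable against the Gaussian even after
  multiplication by \<open>q p\<close>.\<close>

lemma Wop_polyf:
  assumes p: "polyf M p"
  shows "Wop Rp \<kappa> E p z = 1 / c\<^sub>\<kappa> * (\<Sum>n\<le>M. pairing (linear_product (replicate n (- z))) p / fact n)"
proof -
  define a where "a n = pairing (linear_product (replicate n (- z))) p / fact n" for n
  define s where "s N y = (\<Sum>n<N. q (linear_product (replicate n (- z))) y / fact n)" for N y
  define K where "K = growth * (norm z)\<^sup>2"
  have K: "0 \<le> K" unfolding K_def using growth_nonneg by simp
  have sok: "gint_ok (s N)" for N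
    unfolding s_def divide_inverse using gint_ok_q[OF polyf_linear_product] by (intro gint_ok_sum gint_ok_mult) auto
  have "(\<lambda>N. gint (\<lambda>y. s N y * q p y)) \<longlonglongrightarrow> gint (\<lambda>y. q (expo z) y * q p y)"
  proof (rule gint_dominated_convergence)
    show "gint_ok (\<lambda>y. s N y * q p y)" for N using sok gint_ok_q[OF p] by simp
    show "gint_ok (\<lambda>y. complex_of_real (exp (norm z * norm y + K / 2) * norm (q p y)))"
    proof -
      have "exp_bounded (\<lambda>y. complex_of_real (norm (q p y)))" and [measurable]: "q p \<in> borel_measurable borel"
        using gint_ok_q[OF p] by (auto simp: gint_ok_def exp_bounded_def)
      moreover have "exp_bounded (\<lambda>y::real^'n. complex_of_real (exp (norm z * norm y + K / 2)))"
        by (rule exp_boundedI[of "norm z" _ "exp (K / 2)"]) (auto simp: exp_add norm_mult)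
      ultimately show ?thesis unfolding gint_ok_def of_real_mult by auto
    qed
    fix y
    have "norm (s N y) \<le> exp (norm z * norm y + K / 2)" for N
    proof -
      have "norm (s N y) \<le> (\<Sum>n<N. hermite_bound (norm z * norm y) K n / fact n)"
        unfolding s_def
      proof (rule sum_norm_le)
        fix n
        show "norm (q (linear_product (replicate n (- z))) y / fact n) \<le> hermite_bound (norm z * norm y) K n / fact n"
          using norm_q_linear_product_le[of "replicate n (- z)" "norm z" y]
          by (simp add: norm_divide divide_right_mono K_def)
      qed
      also have "\<dots> \<le> exp (norm z * norm y + K / 2)" by (rule sum_hermite_bound_le) (use K in auto)
      finally show ?thesis .
    qed
    then show "norm (s N y * q p y) \<le> exp (norm z * norm y + K / 2) * norm (q p y)" for N
      by (simp add: norm_mult mult_right_mono)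
    show "(\<lambda>N. s N y * q p y) \<longlonglongrightarrow> q (expo z) y * q p y"
      unfolding s_def by (intro tendsto_intros q_expo_LIMSEQ)
  qed
  moreover have "gint (\<lambda>y. s N y * q p y) = (\<Sum>n<N. a n)" for N
  proof -
    have "gint (\<lambda>y. s N y * q p y) = gint (\<lambda>y. \<Sum>n<N. (1 / fact n) * (q (linear_product (replicate n (- z))) y * q p y))"
      by (simp add: s_def sum_distrib_right)
    also have "\<dots> = (\<Sum>n<N. a n)"
    proof -
      have "gint (\<lambda>y. \<Sum>n<N. (1 / fact n) * (q (linear_product (replicate n (- z))) y * q p y)) =
         (\<Sum>n<N. gint (\<lambda>y. (1 / fact n) * (q (linear_product (replicate n (- z))) y * q p y)))"
        by (intro gint_sum gint_ok_mult gint_ok_tame[OF tame_const] gint_ok_q[OF polyf_linear_product] gint_ok_q[OF p])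
      then show ?thesis by (simp only: gint_cmult) (simp add: a_def pairing_def)
    qed
    finally show ?thesis .
  qed
  ultimately have "a sums gint (\<lambda>y. q (expo z) y * q p y)" by (simp add: sums_def)
  moreover have "a sums (\<Sum>n\<le>M. a n)"
    by (rule sums_finite) (auto simp: a_def pairing_linear_product_eq_0[OF p])
  ultimately have "gint (\<lambda>y. q (expo z) y * q p y) = (\<Sum>n\<le>M. a n)" by (rule sums_unique2)
  then show ?thesis unfolding Wop_eq a_def by simp
qed

text \<open>Binomial expansion in t leaves n times the pairing with one factor -<e, x>. Its sign
  cancels the one in \<open>pairing_inner_mult\<close>.\<close>

lemma pairing_power_has_vector_derivative:
  assumes p: "polyf M p"
  shows "((\<lambda>t. pairing (linear_product (replicate n (- (z + t *\<^sub>R e)))) p) has_vector_derivative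
     (if n = 0 then 0 else of_nat n * pairing (linear_product (replicate (n - 1) (- z))) (dunkl e p))) (at 0)"
proof -
  define c where "c k = of_nat (n choose k) * pairing (linear_product (replicate k (- e) @ replicate (n - k) (- z))) p" for k
  have "pairing (linear_product (replicate n (- (z + t *\<^sub>R e)))) p = (\<Sum>k\<le>n. complex_of_real (t ^ k) * c k)" for t
  proof -
    have eq: "linear_product (replicate n (- (z + t *\<^sub>R e))) = (\<lambda>x. \<Sum>k\<le>n. (complex_of_real (t ^ k) * of_nat (n choose k)) *
        linear_product (replicate k (- e) @ replicate (n - k) (- z)) x)"
    proof
      fix x
      have "complex_of_real (- (z + t *\<^sub>R e) \<bullet> x) = complex_of_real t * complex_of_real (- e \<bullet> x) + complex_of_real (- z \<bullet> x)"
        by (simp add: inner_simps)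
      then show "linear_product (replicate n (- (z + t *\<^sub>R e))) x = (\<Sum>k\<le>n. (complex_of_real (t ^ k) * of_nat (n choose k)) *
        linear_product (replicate k (- e) @ replicate (n - k) (- z)) x)"
        unfolding linear_product_replicate linear_product_append
        by (simp only: binomial_ring power_mult_distrib) (simp add: mult_ac)
    qed
    have "polyf n (linear_product (replicate k (- e) @ replicate (n - k) (- z)))" if "k \<in> {..n}" for k
      using polyf_linear_product[of "replicate k (- e) @ replicate (n - k) (- z)"] that by simp
    then show ?thesis unfolding eq by (subst pairing_sum[OF _ p]) (auto simp: c_def mult.assoc)
  qed
  moreover have "c 1 = of_nat n * pairing (linear_product (replicate (n - 1) (- z))) (dunkl e p)" if "n \<noteq> 0"
  proof -
    have "pairing (linear_product (- e # replicate (n - 1) (- z))) p = - pairing (linear_product (replicate (n - 1) (- z))) (\<lambda>x. - 1 * dunkl e p x)"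
      using pairing_inner_mult[OF polyf_linear_product p, of "- e"] dunkl_uminus_direction[OF polyf_tame[OF p]] by simp
    also have "\<dots> = pairing (linear_product (replicate (n - 1) (- z))) (dunkl e p)"
      unfolding pairing_def using gint_cmult[of "- 1" "\<lambda>y. q (linear_product (replicate (n - 1) (- z))) y * q (dunkl e p) y"]
      by (simp only: q_cmult) simp
    finally show ?thesis by (simp add: c_def)
  qed
  ultimately show ?thesis
    using has_vector_derivative_power_sum_0[where n=n and c=c] by (auto simp: cong: if_cong)
qed

lemma Wop_dunkl:
  assumes "polyf M p"
  shows "((\<lambda>t. Wop Rp \<kappa> E p (z + t *\<^sub>R e)) has_vector_derivative Wop Rp \<kappa> E (dunkl e p) z) (at 0)"
proof -
  \<comment> \<open>Raising the degree bound lets \<open>Wop\<close> of p be summed up to M + 1 and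
    \<open>Wop\<close> of \<open>dunkl e p\<close> up to M, which fits the shift n / n! = 1 / (n -
    1)!.\<close>
  have p: "polyf (Suc M) p" using assms by (rule polyf_Suc)
  let ?b = "\<lambda>n. pairing (linear_product (replicate n (- z))) (dunkl e p)"
  have "((\<lambda>t. 1 / c\<^sub>\<kappa> * (\<Sum>n\<le>Suc M. pairing (linear_product (replicate n (- (z + t *\<^sub>R e)))) p / fact n)) has_vector_derivative
     1 / c\<^sub>\<kappa> * (\<Sum>n\<le>Suc M. (if n = 0 then 0 else of_nat n * ?b (n - 1)) / fact n)) (at 0)"
    by (intro has_vector_derivative_mult_right has_vector_derivative_sum has_vector_derivative_divide
       pairing_power_has_vector_derivative[OF p])
  moreover have "(\<Sum>n\<le>Suc M. (if n = 0 then 0 else of_nat n * ?b (n - 1)) / fact n) = (\<Sum>n\<le>M. ?b n / fact n)"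
    by (subst sum.atMost_Suc_shift) (simp del: of_nat_Suc)
  ultimately show ?thesis
    unfolding Wop_polyf[OF p] Wop_polyf[OF polyf_dunkl_Suc[OF p]] by (simp only:)
qed

end

section \<open>From root systems and coordinate polynomials to the locales\<close>

lemma dunkl_system_root_system:
  assumes R: "root_system R" and P: "positive_subsystem R Rp" and K: "multiplicity R \<kappa>"
  shows "dunkl_system Rp \<kappa>"
proof
  from P obtain b where b: "\<And>\<alpha>. \<alpha> \<in> R \<Longrightarrow> \<alpha> \<bullet> b \<noteq> 0" and Rp: "Rp = {\<alpha>\<in>R. \<alpha> \<bullet> b > 0}"
    unfolding positive_subsystem_def by blast
  show "finite Rp" using R Rp by (simp add: root_system_def)
  show nz: "\<alpha> \<noteq> 0" if "\<alpha> \<in> Rp" for \<alpha> using R Rp that by (auto simp: root_system_def)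
  show "0 \<le> \<kappa> \<alpha>" if "\<alpha> \<in> Rp" for \<alpha> using K Rp that by (auto simp: multiplicity_def)
  have R0: "\<alpha> \<noteq> 0" if "\<alpha> \<in> R" for \<alpha> using R that by (auto simp: root_system_def)
  have reflR: "refl \<beta> \<alpha> \<in> R" if "\<alpha> \<in> R" "\<beta> \<in> R" for \<alpha> \<beta> using R that by (simp add: root_system_def)
  have neg: "- \<alpha> \<in> R" if "\<alpha> \<in> R" for \<alpha> using reflR[OF that that] refl_self[OF R0[OF that]] by simp
  have kr: "\<kappa> (refl \<beta> \<alpha>) = \<kappa> \<alpha>" if "\<alpha> \<in> R" "\<beta> \<in> R" for \<alpha> \<beta>
    using K refl_group.step[OF refl_group.id_in that(2)] that(1) by (auto simp: multiplicity_def)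
  have kn: "\<kappa> (- \<alpha>) = \<kappa> \<alpha>" if "\<alpha> \<in> R" for \<alpha> using kr[OF that that] refl_self[OF R0[OF that]] by simp
  fix \<beta> assume \<beta>: "\<beta> \<in> Rp"
  then have \<beta>R: "\<beta> \<in> R" using Rp by simp
  \<comment> \<open>The positive representative of plus or minus the reflected root. It is an
    involution on the positive roots, hence a bijection.\<close>
  define \<pi> where "\<pi> \<alpha> = (if refl \<beta> \<alpha> \<in> Rp then refl \<beta> \<alpha> else - refl \<beta> \<alpha>)" for \<alpha>
  have in_Rp: "\<pi> \<alpha> \<in> Rp" if "\<alpha> \<in> Rp" for \<alpha>
    using that \<beta>R reflR[of \<alpha> \<beta>] neg[of "refl \<beta> \<alpha>"] b[of "refl \<beta> \<alpha>"] by (auto simp: Rp \<pi>_def)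
  have inv: "\<pi> (\<pi> \<alpha>) = \<alpha>" if "\<alpha> \<in> Rp" for \<alpha>
  proof (cases "refl \<beta> \<alpha> \<in> Rp")
    case True
    then show ?thesis using that by (simp add: \<pi>_def)
  next
    case False
    have "- \<alpha> \<notin> Rp" using that by (simp add: Rp)
    with False show ?thesis by (simp add: \<pi>_def linear_neg[OF linear_refl])
  qed
  have "bij_betw \<pi> Rp Rp" by (rule bij_betw_byWitness[where f'=\<pi>]) (use in_Rp inv in auto)
  moreover have "\<kappa> (\<pi> \<alpha>) = \<kappa> \<alpha> \<and> (\<pi> \<alpha> = refl \<beta> \<alpha> \<or> \<pi> \<alpha> = - refl \<beta> \<alpha>)" if "\<alpha> \<in> Rp" for \<alpha>
    using that \<beta>R kr[of \<alpha> \<beta>] kn[of "refl \<beta> \<alpha>"] reflR[of \<alpha> \<beta>] by (auto simp: \<pi>_def Rp)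
  ultimately show "\<exists>\<pi>. bij_betw \<pi> Rp Rp \<and>
      (\<forall>\<alpha>\<in>Rp. \<kappa> (\<pi> \<alpha>) = \<kappa> \<alpha> \<and> (\<pi> \<alpha> = refl \<beta> \<alpha> \<or> \<pi> \<alpha> = - refl \<beta> \<alpha>))" by blast
qed

lemma polyf_coordinate_power_mult:
  "polyf n p \<Longrightarrow> polyf (k + n) (\<lambda>x. complex_of_real (x $ i) ^ k * p x)"
proof (induction k)
  case (Suc k)
  have "x $ i = axis i 1 \<bullet> x" for x :: "real^'a" by (simp add: inner_axis inner_commute)
  then show ?case using polyf.mul[OF Suc.IH[OF Suc.prems], of "axis i 1"] by (simp add: mult.assoc)
qed simp

lemma polynomial_fun_polyf:
  assumes "polynomial_fun p"
  obtains n where "polyf n p"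
proof -
  from assms obtain S :: "('a \<Rightarrow> nat) set" and c where S: "finite S"
      and p: "p = (\<lambda>x. \<Sum>a\<in>S. c a * (\<Prod>i\<in>UNIV. complex_of_real (x $ i) ^ a i))"
    unfolding polynomial_fun_def by blast
  have mono: "polyf (\<Sum>i\<in>T. a i) (\<lambda>x. \<Prod>i\<in>T. complex_of_real (x $ i) ^ a i)" if "finite T" for a :: "'a \<Rightarrow> nat" and T
    using that by (induction T rule: finite_induct) (auto intro: polyf.const polyf_coordinate_power_mult)
  \<comment> \<open>For empty S the maximum is an unspecified number, which is harmless because p is
    then the constant 0.\<close>
  have "polyf (Max ((\<lambda>a. \<Sum>i\<in>UNIV. a i) ` S)) p"
    unfolding p
    by (intro polyf_sum polyf_cmult polyf_mono[OF mono]) (auto simp: S)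
  then show ?thesis by (rule that)
qed

theorem mainTheorem6:
  fixes R Rp :: "(real^'n) set" and \<kappa> :: "real^'n \<Rightarrow> real"
    and E :: "complex^'n \<Rightarrow> complex^'n \<Rightarrow> complex"
    and p :: "real^'n \<Rightarrow> complex" and j :: 'n and z :: "real^'n"
  assumes "root_system R" and "positive_subsystem R Rp" and "multiplicity R \<kappa>"
    and "dunkl_kernel Rp \<kappa> E"
    and "polynomial_fun p"
  shows "((\<lambda>t. Wop Rp \<kappa> E p (z + t *\<^sub>R axis j 1)) has_vector_derivative
            Wop Rp \<kappa> E (dunkl_op Rp \<kappa> j p) z) (at 0)"
proof (cases "cconst Rp \<kappa> = 0")
  case True
  \<comment> \<open>As 1 / 0 = 0 in HOL, \<open>Wop\<close> is identically 0 in this case.\<close>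
  then show ?thesis by (simp add: Wop_def)
next
  case False
  interpret dunkl_system Rp \<kappa> using assms(1-3) by (rule dunkl_system_root_system)
  interpret dunkl_kernel_normalised Rp \<kappa> E by unfold_locales (use assms(4) False in auto)
  from assms(5) obtain n where "polyf n p" by (rule polynomial_fun_polyf)
  then show ?thesis unfolding dunkl_op_eq by (rule Wop_dunkl)
qed

end
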